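(* Assume that $\lambda\not\in \frac12-\frac12\mathbb{Z}_{\geq0}$ and the summation formula \[ \alpha(\infty)f(\infty)+\sum_{n=-\infty}^{\infty} \alpha(n)(\mathcal{F}f)(n) =\beta(\infty) f_{\infty}(\infty)+ \sum_{n=-\infty}^{\infty} \beta(n)(\mathcal{F}f_{\infty})\left(\frac{n}{N}\right) \] holds for any $f\in \mathcal{V}_{\lambda,\ell}^{\infty}$. (1) The $L$-functions $\xi_{\pm}(\alpha;s)$ and $\xi_{\pm}(\beta;s)$ have analytic continuations to meromorphic functions on the whole $s$-plane with poles only at $s=2-2\lambda$ and $s=1$. The orders of the poles are at most $1$ and the residues are \begin{gather*} \mathrm{Res}_{s=1} \xi_\pm(\alpha;s) = i^\ell \beta(\infty), \quad \mathrm{Res}_{s=2-2\lambda} \xi_\pm(\alpha;s) = \pm i (2\pi)^{-(2\lambda-1)} \Gamma(2\lambda-1)(i^\ell e^{\mp \lambda \pi i} - e^{\pm \lambda \pi i}) \beta(0), \\ \mathrm{Res}_{s=1} \xi_\pm(\beta;s) = \frac{\alpha(\infty)}{N}, \quad \mathrm{Res}_{s=2-2\lambda} \xi_\pm(\beta;s) = \mp i N^{2\lambda-2} (2\pi)^{-(2\lambda-1)}\Gamma(2\lambda-1) (i^{-\ell}e^{\pm\pi i \lambda} - e^{\mp \pi i \lambda})\alpha(0). \end{gather*} (2) With $\Xi_{\pm}(\alpha;s)=(2\pi)^{-s} \Gamma(s) \xi_{\pm}(\alpha;s)$, $\Xi_{\pm}(\beta;s)=(2\pi)^{-s} \Gamma(s)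 \xi_{\pm}(\beta;s)$, $\gamma(s) = \begin{pmatrix} e^{\pi s i/2} & e^{-\pi s i/2} \\ e^{-\pi s i/2} & e^{\pi s i/2} \end{pmatrix}$, $\Sigma(\ell) = \begin{pmatrix} 0 & i^{\ell} \\ 1 & 0 \end{pmatrix}$, the completed $L$-functions satisfy \[ \gamma(s)\begin{pmatrix} \Xi_{+}(\alpha;s) \\ \Xi_{-}(\alpha;s) \end{pmatrix} = N^{2-2\lambda-s}\,\Sigma(\ell)\,\gamma(2-2\lambda-s)\begin{pmatrix} \Xi_{+}(\beta;2-2\lambda-s) \\ \Xi_{-}(\beta;2-2\lambda-s) \end{pmatrix}. \] (3) The functions $(s-1)(s+2\lambda-2)\xi_{\pm}(\alpha; s)$ and $(s-1)(s+2\lambda-2)\xi_{\pm}(\beta; s)$ are entire functions of order at most $1$.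
   Context: Fix $\lambda\in\mathbb{C}$, $\ell\in\mathbb{Z}$ and a positive integer $N$. For a smooth $f$ on $\mathbb{R}$ put $f_\infty(x)=(\mathrm{sgn}\,x)^{\ell/2}|x|^{-2\lambda}f(-1/x)$ with $(\mathrm{sgn}\,x)^{\ell/2}=1$ for $x>0$ and $i^\ell$ for $x<0$. $\mathcal{V}^\infty_{\lambda,\ell}$ is the space of $C^\infty$ functions $f$ on $\mathbb{R}$ such that $f_\infty$ extends to a $C^\infty$ function on $\mathbb{R}$. Put $f(\infty)=f_\infty(0)$ (so $f_\infty(\infty)=i^\ell f(0)$). Fourier transform: for $t\ne0$, $\mathcal{F}f(t)=\left(\frac{-1}{2\pi it}\right)^m\int_{\mathbb{R}}f^{(m)}(x)\exp(2\pi ixt)\,dx$ for any integer $m\ge0$ with $\Re\lambda+m/2>1/2$. Local zeta functions $\Phi_\pm(f;s)=\int_0^\infty x^{s-1}f(\pm x)\,dx$, continued meromorphically via $\Phi_\pm(f;s)=\frac{(\mp1)^m}{s(s+1)\cdots(s+m-1)}\Phi_\pm(f^{(m)};s+m)$; the regularized value is $(\mathcal{F}f)(0)=\Phi_+(f;1)+\Phi_-(f;1)$. Here $\{\alpha(n)\}_{n\in\mathbb{Z}}$, $\{\beta(n)\}_{n\in\mathbb{Z}}$ are complex sequences of polynomial growth, $\alpha(\infty),\beta(\infty)\in\mathbb{C}$, and $\xi_\pm(\alpha;s)=\sum_{n\ge1}\alpha(\pm n)n^{-s}$, $\xi_\pm(\beta;s)=\sum_{n\ge1}\beta(\pm n)n^{-s}$.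 *)

theory Defs
  imports "HOL-Complex_Analysis.Complex_Analysis" "HOL-Library.Landau_Symbols"
begin

definition nderiv :: "nat \<Rightarrow> (real \<Rightarrow> complex) \<Rightarrow> real \<Rightarrow> complex" where
  "nderiv m f = ((\<lambda>g x. vector_derivative g (at x)) ^^ m) f"

definition smooth :: "(real \<Rightarrow> complex) \<Rightarrow> bool" where
  "smooth f \<longleftrightarrow> (\<forall>m x. nderiv m f differentiable (at x))"

text \<open>The factor $(\mathrm{sgn}\,x)^{\ell/2}$; the value at $0$ is never used.\<close>

definition sgn_half :: "int \<Rightarrow> real \<Rightarrow> complex" where
  "sgn_half l x = (if x < 0 then \<i> powi l else 1)"

definition twist_formula :: "complex \<Rightarrow> int \<Rightarrow> (real \<Rightarrow> complex) \<Rightarrow> real \<Rightarrow> complex" where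
  "twist_formula lam l f x = sgn_half l x * (of_real \<bar>x\<bar> powr (- 2 * lam)) * f (- 1 / x)"

text \<open>The function $f_\infty$ on all of $\mathbb{R}$, extended to $x = 0$ by continuity.\<close>

definition twist :: "complex \<Rightarrow> int \<Rightarrow> (real \<Rightarrow> complex) \<Rightarrow> real \<Rightarrow> complex" where
  "twist lam l f x =
     (if x = 0 then Lim (at 0) (twist_formula lam l f) else twist_formula lam l f x)"

definition V_infty :: "complex \<Rightarrow> int \<Rightarrow> (real \<Rightarrow> complex) set" where
  "V_infty lam l = {f. smooth f \<and> (\<exists>g. smooth g \<and> (\<forall>x. x \<noteq> 0 \<longrightarrow> g x = twist_formula lam l f x))}"

text \<open>The value $f(\infty) = f_\infty(0)$.\<close>

definition at_inf :: "complex \<Rightarrow> int \<Rightarrow> (real \<Rightarrow> complex) \<Rightarrow> complex" where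
  "at_inf lam l f = twist lam l f 0"

text \<open>The Mellin integral $\int_0^\infty x^{s-1} f(\varepsilon x)\,dx$ for a sign
  $\varepsilon \in \{1, -1\}$.\<close>

definition mellin_integral :: "int \<Rightarrow> (real \<Rightarrow> complex) \<Rightarrow> complex \<Rightarrow> complex" where
  "mellin_integral \<epsilon> f s =
     (LINT x:{0<..}|lborel. of_real x powr (s - 1) * f (of_int \<epsilon> * x))"

text \<open>The local zeta function $\Phi_\varepsilon(f; s)$ as a meromorphic function on $\mathbb{C}$.
  For $f \in \mathcal{V}^\infty_{\lambda,\ell}$ one has $f^{(m)}(x) = O(|x|^{-2\Re\lambda - m})$ at
  infinity, so the Mellin integral of $f^{(m)}$ at $s + m$ converges absolutely for
  $-m < \Re s < 2\Re\lambda$. This strip is non-empty for large $m$, so its prescribed values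
  determine the continuation to $\mathbb{C}$; \<^const>\<open>nicely_meromorphic_on\<close> fixes the value $0$
  at poles. The zeros of the Pochhammer symbol are the possible poles in the strip.\<close>

definition local_zeta :: "complex \<Rightarrow> int \<Rightarrow> (real \<Rightarrow> complex) \<Rightarrow> complex \<Rightarrow> complex" where
  "local_zeta lam \<epsilon> f = (THE F. F nicely_meromorphic_on UNIV \<and>
     (\<forall>(m::nat) s. - real m < Re s \<and> Re s < 2 * Re lam \<and> pochhammer s m \<noteq> 0 \<longrightarrow>
        F s = (- of_int \<epsilon>) ^ m / pochhammer s m * mellin_integral \<epsilon> (nderiv m f) (s + of_nat m)))"

text \<open>For $t \neq 0$ the value does not depend on the choice of $m$ with
  $\Re\lambda + m/2 > 1/2$; the least one is taken.\<close>

definition fourier :: "complex \<Rightarrow> (real \<Rightarrow> complex) \<Rightarrow> real \<Rightarrow> complex" where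
  "fourier lam f t =
     (if t = 0 then local_zeta lam 1 f 1 + local_zeta lam (-1) f 1
      else (let m = (LEAST m::nat. Re lam + real m / 2 > 1 / 2)
            in (- 1 / (2 * of_real pi * \<i> * of_real t)) ^ m *
               (LINT x|lborel. nderiv m f x * exp (2 * of_real pi * \<i> * of_real x * of_real t))))"

definition polynomial_growth :: "(int \<Rightarrow> complex) \<Rightarrow> bool" where
  "polynomial_growth a \<longleftrightarrow> (\<exists>C (k::nat). \<forall>n. norm (a n) \<le> C * (1 + \<bar>real_of_int n\<bar>) ^ k)"

text \<open>The terms of the Dirichlet series $\sum_{n \ge 1} a(\varepsilon n) n^{-s}$, with the index
  shifted to start at $0$.\<close>

definition xi_term :: "(int \<Rightarrow> complex) \<Rightarrow> int \<Rightarrow> complex \<Rightarrow> nat \<Rightarrow> complex" where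
  "xi_term a \<epsilon> s n = a (\<epsilon> * int (Suc n)) * of_nat (Suc n) powr (- s)"

definition meromorphic_continuation_xi ::
    "(int \<Rightarrow> complex) \<Rightarrow> int \<Rightarrow> (complex \<Rightarrow> complex) \<Rightarrow> bool" where
  "meromorphic_continuation_xi a \<epsilon> X \<longleftrightarrow>
     X nicely_meromorphic_on UNIV \<and>
     (\<exists>\<sigma>::real. \<forall>s. Re s > \<sigma> \<longrightarrow>
        summable (\<lambda>n. norm (xi_term a \<epsilon> s n)) \<and> X s = (\<Sum>n. xi_term a \<epsilon> s n))"

definition completed :: "(complex \<Rightarrow> complex) \<Rightarrow> complex \<Rightarrow> complex" where
  "completed X s = of_real (2 * pi) powr (- s) * Gamma s * X s"

definition gamma_matrix :: "complex \<Rightarrow> complex ^ 2 ^ 2" where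
  "gamma_matrix s = vector
     [vector [exp (of_real pi * s * \<i> / 2), exp (- (of_real pi * s * \<i> / 2))],
      vector [exp (- (of_real pi * s * \<i> / 2)), exp (of_real pi * s * \<i> / 2)]]"

definition Sigma_matrix :: "int \<Rightarrow> complex ^ 2 ^ 2" where
  "Sigma_matrix l = vector [vector [0, \<i> powi l], vector [1, 0]]"

text \<open>The order of growth of an entire function.\<close>

definition entire_order :: "(complex \<Rightarrow> complex) \<Rightarrow> ereal" where
  "entire_order F =
     Inf {ereal a | a. a \<ge> 0 \<and> F \<in> O[at_infinity](\<lambda>z. of_real (exp (norm z powr a)))}"

lemma twist_twist:
  assumes "f \<in> V_infty lam l"
  shows "twist lam l (twist lam l f) x = \<i> powi l * f x"
proof -
  have eq: "twist_formula lam l (twist lam l f) y = \<i> powi l * f y" if "y \<noteq> 0" for y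
  proof -
    have p: "(of_real \<bar>y\<bar> powr (- 2 * lam)) * (of_real \<bar>- 1 / y\<bar> powr (- 2 * lam)) = (1::complex)"
    proof -
      have "(of_real \<bar>- 1 / y\<bar> :: complex) powr (- 2 * lam)
              = exp (- 2 * lam * of_real (ln (1 / \<bar>y\<bar>)))"
        using that by (simp add: powr_def Ln_of_real flip: of_real_divide)
      moreover have "(of_real \<bar>y\<bar> :: complex) powr (- 2 * lam) = exp (- 2 * lam * of_real (ln \<bar>y\<bar>))"
        using that by (simp add: powr_def Ln_of_real)
      moreover have "ln (1 / \<bar>y\<bar>) = - ln \<bar>y\<bar>" using that by (simp add: ln_div)
      ultimately show ?thesis by (simp add: exp_minus)
    qed
    have s: "sgn_half l y * sgn_half l (- 1 / y) = \<i> powi l"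
      using that by (auto simp: sgn_half_def divide_simps)
    have "twist_formula lam l (twist lam l f) y
       = (sgn_half l y * sgn_half l (- 1 / y)) *
         ((of_real \<bar>y\<bar> powr (- 2 * lam)) * (of_real \<bar>- 1 / y\<bar> powr (- 2 * lam))) * f y"
      using that by (simp add: twist_formula_def twist_def)
    then show ?thesis unfolding p s by simp
  qed
  show ?thesis
  proof (cases "x = 0")
    case True
    have "nderiv 0 f differentiable (at 0)"
      using assms unfolding V_infty_def smooth_def by blast
    then have "isCont f 0"
      by (simp add: nderiv_def differentiable_imp_continuous_within)
    then have "((\<lambda>y. \<i> powi l * f y) \<longlongrightarrow> \<i> powi l * f 0) (at 0)"
      by (intro tendsto_intros) (simp add: isCont_def)
    then have "(twist_formula lam l (twist lam l f) \<longlongrightarrow> \<i> powi l * f 0) (at 0)"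
      by (rule Lim_transform_eventually) (auto simp: eq eventually_at_filter)
    then show ?thesis
      using True by (simp add: twist_def tendsto_Lim)
  next
    case False
    then show ?thesis using eq by (simp add: twist_def)
  qed
qed

lemma at_inf_twist:
  assumes "f \<in> V_infty lam l"
  shows "at_inf lam l (twist lam l f) = \<i> powi l * f 0"
  using twist_twist[OF assms] by (simp add: at_inf_def)

end

theory Submission
  imports Defs "HOL-Probability.Characteristic_Functions"
begin

text \<open>For \<open>j \<le> 1\<close> the function \<open>q\<close> is an eigenfunction of the
  Fourier transform with eigenvalue \<open>\<i> ^ j\<close>, so the two parities isolate
  \<open>\<xi>\<^sub>+ + \<xi>\<^sub>-\<close> and \<open>\<xi>\<^sub>+ - \<xi>\<^sub>-\<close>,
  each with a single Gamma factor. Twisting twice multiplies by \<open>\<i> powi l\<close>; hence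
  the formula for twisted test functions exchanges the sequences, with \<open>\<alpha>\<close>
  replaced by \<open>\<i> powi (- l) * N powr (2 * lam - 2) * \<alpha>\<close>. One argument then
  serves both sides, and the functional equation arises by comparing the left half-plane behaviour
  of one continuation with the series of the other. The obstacle is the regularised
  \<open>fourier\<close>. For small \<open>Re lam\<close> the twist of \<open>q\<close> is not
  integrable, so its transform is reached only after \<open>k\<close> integrations by parts, and its
  value at 0 is that of a meromorphic function given by a description, which has to be identified by
  uniqueness of continuation. The hypothesis on \<open>lam\<close> says that
  \<open>2 * lam - 1\<close> is not a nonpositive integer. It keeps 1 and \<open>2 - 2 * lam\<close>
  apart and \<open>Gamma (2 * lam - 1)\<close> finite, so that the poles are simple.\<close>

text \<open>
  Gaussian test functions suffice. For \<open>j = 0, 1\<close> put \<open>q x = x ^ j * exp (- pi * x\<^sup>2)\<close>. Applied to the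
  dilates of \<open>q\<close> and to their twists, the summation formula becomes, for both pairs of sequences, an
  inversion formula \<open>r \<mapsto> 1 / r\<close> between the theta series with terms
  \<open>a n * (\<i> * r * n) ^ j * exp (- pi * (r * n)\<^sup>2)\<close> and the series of the values of the Fourier transform of
  the twist of \<open>q\<close> at \<open>n / (r * N)\<close>. Splitting the Mellin integral of the theta series at \<open>r = 1\<close>
  continues \<open>\<xi>\<^sub>+ + (- 1) ^ j * \<xi>\<^sub>-\<close> up to the entire factor \<open>1 / Gamma ((s + j) / 2)\<close>; the terms with
  \<open>n = 0\<close> or \<open>n = \<infinity>\<close> give the poles and residues, and the pole at \<open>s = 0\<close> is cancelled by that factor.

  The twist of \<open>q\<close> is \<open>x powr (- 2 * lam - j) * exp (- pi / x\<^sup>2)\<close> on either half-line up to constants.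
  It is flat at \<open>0\<close>, so that the Mellin transform of its Fourier transform is again an explicit product of
  Gamma factors, and this gives the functional equation where the Dirichlet series of the other side
  converges. The growth estimate uses the Dirichlet series on a right half-plane, the functional equation
  on a left half-plane, and the boundedness of the split integrals on the strip between them.
\<close>

section \<open>Mellin transforms\<close>

text \<open>Complex \<open>powr\<close> is discontinuous on the negative axis, so continuity does
  not settle measurability; on real arguments the logarithm splits into
  \<open>ln \<bar>x\<bar>\<close> and a step function.\<close>

lemma borel_measurable_complex_of_real_powr [measurable (raw)]:
  assumes [measurable]: "f \<in> borel_measurable M"
  shows "(\<lambda>x. complex_of_real (f x) powr z) \<in> borel_measurable M"
proof -
  have "(\<lambda>x. complex_of_real (f x) powr z) =
    (\<lambda>x. if f x = 0 then 0 else exp (z * (of_real (ln \<bar>f x\<bar>) + of_real (if f x < 0 then pi else 0) * \<i>)))"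
    by (auto simp: powr_def Ln_of_real' fun_eq_iff)
  also have "\<dots> \<in> borel_measurable M" by measurable
  finally show ?thesis .
qed

lemma of_real_powr_eq_exp: "x > 0 \<Longrightarrow> complex_of_real x powr z = exp (z * of_real (ln x))"
  by (simp add: powr_def Ln_of_real)

text \<open>Stated for real-valued functions, to which the change of variables theorem is applied;
  the complex form below is obtained from real and imaginary parts.\<close>

lemma integral_exp_substitution_real:
  fixes f :: "real \<Rightarrow> real"
  assumes [measurable]: "f \<in> borel_measurable borel"
  shows "integrable lborel (\<lambda>x. indicator {0<..} x * f x) \<longleftrightarrow> integrable lborel (\<lambda>x. exp x * f (exp x))"
    and "(LINT x|lborel. indicator {0<..} x * f x) = (LINT x|lborel. exp x * f (exp x))"
proof -
  have r: "range (exp :: real \<Rightarrow> real) = {0<..}"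
    by (auto simp: image_def) (metis exp_ln)
  have cv: "(\<lambda>x. \<bar>exp x\<bar> * f (exp x)) absolutely_integrable_on UNIV \<and> integral UNIV (\<lambda>x. \<bar>exp x\<bar> * f (exp x)) = b
     \<longleftrightarrow> f absolutely_integrable_on range exp \<and> integral (range exp) f = b" for b
    by (rule has_absolute_integral_change_of_variables_1')
       (auto intro!: derivative_eq_intros simp: inj_on_def)
  have 1: "(\<lambda>x. exp x * f (exp x)) absolutely_integrable_on UNIV \<longleftrightarrow> integrable lborel (\<lambda>x. exp x * f (exp x))"
    by (simp add: set_integrable_def integrable_completion)
  have 2: "f absolutely_integrable_on {0<..} \<longleftrightarrow> integrable lborel (\<lambda>x. indicator {0<..} x * f x)"
    by (simp add: set_integrable_def integrable_completion)
  show i: "integrable lborel (\<lambda>x. indicator {0<..} x * f x) \<longleftrightarrow> integrable lborel (\<lambda>x. exp x * f (exp x))"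
    using cv unfolding r 1[symmetric] 2[symmetric] by auto
  show "(LINT x|lborel. indicator {0<..} x * f x) = (LINT x|lborel. exp x * f (exp x))"
  proof (cases "integrable lborel (\<lambda>x. exp x * f (exp x))")
    case True
    with 1 2 i have a: "(\<lambda>x. exp x * f (exp x)) absolutely_integrable_on UNIV" "f absolutely_integrable_on {0<..}" by auto
    have "(LINT x|lborel. indicator {0<..} x * f x) = integral {0<..} f"
      using set_lebesgue_integral_eq_integral(2)[OF a(2)]
      by (simp add: set_lebesgue_integral_def integral_completion)
    also have "\<dots> = integral UNIV (\<lambda>x. exp x * f (exp x))"
      using cv a r by auto
    also have "\<dots> = (LINT x|lborel. exp x * f (exp x))"
      using set_lebesgue_integral_eq_integral(2)[OF a(1)]
      by (simp add: set_lebesgue_integral_def integral_completion)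
    finally show ?thesis .
  next
    case False
    then show ?thesis using i by (simp add: not_integrable_integral_eq)
  qed
qed

lemma has_bochner_integral_complex_iff:
  "has_bochner_integral M f v \<longleftrightarrow>
    has_bochner_integral M (\<lambda>x. Re (f x)) (Re v) \<and> has_bochner_integral M (\<lambda>x. Im (f x)) (Im v)"
proof
  assume "has_bochner_integral M (\<lambda>x. Re (f x)) (Re v) \<and> has_bochner_integral M (\<lambda>x. Im (f x)) (Im v)"
  then have "has_bochner_integral M (\<lambda>x. of_real (Re (f x)) + \<i> * of_real (Im (f x))) (of_real (Re v) + \<i> * of_real (Im v))"
    by (intro has_bochner_integral_add has_bochner_integral_mult_right has_bochner_integral_of_real) auto
  then show "has_bochner_integral M f v" by (simp flip: complex_eq)
qed (auto intro: has_bochner_integral_Re has_bochner_integral_Im)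

lemma has_bochner_integral_exp_substitution:
  fixes f :: "real \<Rightarrow> complex"
  assumes [measurable]: "f \<in> borel_measurable borel"
  shows "has_bochner_integral lborel (\<lambda>x. indicator {0<..} x *\<^sub>R f x) v \<longleftrightarrow>
    has_bochner_integral lborel (\<lambda>x. exp x *\<^sub>R f (exp x)) v"
  unfolding has_bochner_integral_complex_iff[of _ _ v]
  using integral_exp_substitution_real[of "\<lambda>x. Re (f x)"] integral_exp_substitution_real[of "\<lambda>x. Im (f x)"]
  by (simp add: has_bochner_integral_iff)

text \<open>Convergence is part of the relation: the bare integral has the default value 0 for a
  non-integrable integrand, and the rules for sums and limits need integrability.\<close>

definition has_mellin :: "(real \<Rightarrow> complex) \<Rightarrow> complex \<Rightarrow> complex \<Rightarrow> bool" where
  "has_mellin f s v \<longleftrightarrow> has_bochner_integral lborel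
     (\<lambda>x. indicator {0<..} x *\<^sub>R (of_real x powr (s - 1) * f x)) v"

lemma has_mellin_imp_mellin_integral:
  "has_mellin (\<lambda>x. f (of_int \<epsilon> * x)) s v \<Longrightarrow> mellin_integral \<epsilon> f s = v"
  by (simp add: has_mellin_def mellin_integral_def set_lebesgue_integral_def has_bochner_integral_iff)

lemma has_mellin_cong:
  assumes "\<And>x. x > 0 \<Longrightarrow> f x = g x"
  shows "has_mellin f s v \<longleftrightarrow> has_mellin g s v"
  unfolding has_mellin_def
  by (rule arg_cong2[where f = "\<lambda>f v. has_bochner_integral lborel f v"])
     (auto simp: assms fun_eq_iff indicator_def)

lemma has_mellin_add:
  "has_mellin f s v \<Longrightarrow> has_mellin g s w \<Longrightarrow> has_mellin (\<lambda>x. f x + g x) s (v + w)"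
  unfolding has_mellin_def by (drule (1) has_bochner_integral_add) (simp add: algebra_simps)

lemma has_mellin_cmult:
  "has_mellin f s v \<Longrightarrow> has_mellin (\<lambda>x. c * f x) s (c * v)"
  unfolding has_mellin_def
  using has_bochner_integral_mult_right[of c lborel "\<lambda>x. indicator {0<..} x *\<^sub>R (of_real x powr (s - 1) * f x)" v]
  by (simp add: algebra_simps)

text \<open>In the variable \<open>ln x\<close> the kernel becomes an exponential on the whole line.
  Dilation, inversion and squaring of the argument then become translation, reflection and scaling
  of Lebesgue measure.\<close>

lemma has_mellin_exp_iff:
  assumes [measurable]: "f \<in> borel_measurable borel"
  shows "has_mellin f s v \<longleftrightarrow> has_bochner_integral lborel (\<lambda>x. exp (s * of_real x) * f (exp x)) v"
proof -
  have "exp x *\<^sub>R (of_real (exp x) powr (s - 1) * f (exp x)) = exp (s * of_real x) * f (exp x)" for x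
  proof -
    have "complex_of_real (exp x) powr (s - 1) = exp ((s - 1) * of_real x)"
      by (subst of_real_powr_eq_exp) simp_all
    then show ?thesis
      by (simp add: scaleR_conv_of_real exp_of_real ring_distribs exp_diff)
  qed
  then show ?thesis
    unfolding has_mellin_def by (subst has_bochner_integral_exp_substitution) auto
qed

lemma has_mellin_powr_times:
  "has_mellin f (s + a) v \<Longrightarrow> has_mellin (\<lambda>x. of_real x powr a * f x) s v"
  unfolding has_mellin_def
  by (erule has_bochner_integral_cong[THEN iffD1, rotated -1])
     (auto simp: indicator_def powr_add[symmetric] algebra_simps simp flip: mult.assoc)

lemma has_mellin_scale:
  assumes [measurable]: "f \<in> borel_measurable borel" and "k > 0" and "has_mellin f s v"
  shows "has_mellin (\<lambda>x. f (k * x)) s (of_real k powr (- s) * v)"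
proof -
  have "has_bochner_integral lborel (\<lambda>x. exp (s * of_real x) * f (exp x)) v"
    using assms by (simp add: has_mellin_exp_iff)
  from lborel_has_bochner_integral_real_affine_iff[of 1 _ _ "ln k", THEN iffD1, OF _ this]
  have "has_bochner_integral lborel (\<lambda>x. exp (s * of_real (ln k + x)) * f (exp (ln k + x))) v"
    by simp
  from has_bochner_integral_mult_right[OF this, of "of_real k powr (- s)"] show ?thesis
    using \<open>k > 0\<close> by (subst has_mellin_exp_iff)
      (simp_all add: of_real_powr_eq_exp exp_add ring_distribs exp_minus field_simps)
qed

lemma has_mellin_inverse:
  assumes [measurable]: "f \<in> borel_measurable borel" and "has_mellin f (- s) v"
  shows "has_mellin (\<lambda>x. f (1 / x)) s v"
proof -
  have "has_bochner_integral lborel (\<lambda>x. exp (- s * of_real x) * f (exp x)) v"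
    using assms by (simp add: has_mellin_exp_iff)
  from lborel_has_bochner_integral_real_affine_iff[of "-1" _ _ 0, THEN iffD1, OF _ this]
  show ?thesis by (subst has_mellin_exp_iff) (simp_all add: exp_minus field_simps)
qed

lemma has_mellin_power2:
  assumes [measurable]: "f \<in> borel_measurable borel" and "has_mellin f (s / 2) v"
  shows "has_mellin (\<lambda>x. f (x\<^sup>2)) s (v / 2)"
proof -
  have "has_bochner_integral lborel (\<lambda>x. exp (s / 2 * of_real x) * f (exp x)) v"
    using assms by (simp add: has_mellin_exp_iff)
  from lborel_has_bochner_integral_real_affine_iff[of 2 _ _ 0, THEN iffD1, OF _ this]
  show ?thesis by (subst has_mellin_exp_iff)
     (simp_all add: exp_double scaleR_conv_of_real field_simps exp_of_nat_mult[of 2, simplified, symmetric])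
qed

lemma has_mellin_exp:
  assumes "Re s > 0"
  shows "has_mellin (\<lambda>x. of_real (exp (- x))) s (Gamma s)"
proof -
  have a: "(\<lambda>t. complex_of_real t powr (s - 1) / of_real (exp t)) absolutely_integrable_on {0<..}"
    by (rule absolutely_integrable_Gamma_integral'[OF assms])
  have m: "(\<lambda>x. indicator {0<..} x *\<^sub>R (complex_of_real x powr (s - 1) * of_real (exp (- x)))) \<in> borel_measurable borel"
    by measurable
  have "integral {0<..} (\<lambda>t. complex_of_real t powr (s - 1) / of_real (exp t)) = Gamma s"
    using Gamma_integral_complex'[OF assms] by (rule integral_unique)
  with set_lebesgue_integral_eq_integral(2)[OF a] a m show ?thesis
    unfolding has_mellin_def has_bochner_integral_iff set_integrable_def set_lebesgue_integral_def
    by (simp add: integrable_completion integral_completion exp_minus field_simps)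
qed

section \<open>Holomorphic parameter integrals\<close>

text \<open>Cauchy's inequality on discs of radius \<open>r / 2\<close> around points of the half
  disc bounds the derivative by \<open>2 * B / r\<close>. This dominates the difference quotients in
  the next lemma.\<close>

lemma difference_bound_of_holomorphic:
  fixes f :: "complex \<Rightarrow> complex"
  assumes hol: "f holomorphic_on S" and S: "open S" "cball z r \<subseteq> S" and r: "r > 0"
    and bound: "\<And>w. w \<in> cball z r \<Longrightarrow> norm (f w) \<le> B" and h: "norm h \<le> r / 2"
  shows "norm (f (z + h) - f z) \<le> 2 * B / r * norm h"
proof -
  have sub: "cball w (r / 2) \<subseteq> cball z r" if "w \<in> cball z (r / 2)" for w
  proof
    fix x assume "x \<in> cball w (r / 2)"
    with that dist_triangle[of z x w] show "x \<in> cball z r" by (simp add: dist_commute)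
  qed
  have "norm (f (z + h) - f z) \<le> (2 * B / r) * norm (z + h - z)"
  proof (rule field_differentiable_bound[where S = "cball z (r / 2)"])
    fix w assume w: "w \<in> cball z (r / 2)"
    have wS: "cball w (r / 2) \<subseteq> S" using sub[OF w] S by auto
    then have "w \<in> S" using r by auto
    then show "(f has_field_derivative deriv f w) (at w within cball z (r / 2))"
      by (intro has_field_derivative_at_within[OF holomorphic_derivI[OF hol S(1)]])
    have "norm ((deriv ^^ 1) f w) \<le> fact 1 * B / (r / 2) ^ 1"
    proof (rule Cauchy_inequality)
      show "f holomorphic_on ball w (r / 2)"
        using hol wS ball_subset_cball[of w "r / 2"] by (blast intro: holomorphic_on_subset)
      show "continuous_on (cball w (r / 2)) f"
        using hol wS by (blast intro: holomorphic_on_imp_continuous_on holomorphic_on_subset)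
      fix x assume "cmod (w - x) = r / 2"
      then have "x \<in> cball w (r / 2)" by (simp add: dist_norm)
      then show "norm (f x) \<le> B" using sub[OF w] bound by blast
    qed (use r in auto)
    then show "norm (deriv f w) \<le> 2 * B / r" by (simp add: field_simps)
  qed (use r h in \<open>auto simp: dist_norm\<close>)
  then show ?thesis by simp
qed

text \<open>A local bound on the integrand alone is enough, since Cauchy's inequality turns it into
  a bound on the difference quotients. Limits are taken along sequences so that dominated
  convergence applies.\<close>

lemma holomorphic_on_integral:
  fixes f :: "complex \<Rightarrow> 'a \<Rightarrow> complex"
  assumes S: "open S"
    and hol: "\<And>x. x \<in> space M \<Longrightarrow> (\<lambda>z. f z x) holomorphic_on S"
    and meas: "\<And>z. z \<in> S \<Longrightarrow> f z \<in> borel_measurable M"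
    and dom: "\<And>z0. z0 \<in> S \<Longrightarrow> \<exists>r>0. \<exists>G. cball z0 r \<subseteq> S \<and> integrable M G \<and>
      (\<forall>z\<in>cball z0 r. \<forall>x\<in>space M. norm (f z x) \<le> G x)"
  shows "(\<lambda>z. LINT x|M. f z x) holomorphic_on S"
proof -
  have int: "integrable M (f z)" if "z \<in> S" for z
  proof -
    from dom[OF that] obtain r G where "r > 0" "integrable M G"
      "\<And>w x. w \<in> cball z r \<Longrightarrow> x \<in> space M \<Longrightarrow> norm (f w x) \<le> G x" by blast
    then have "norm (f z x) \<le> norm (G x)" if "x \<in> space M" for x
      using that \<open>r > 0\<close> by (metis abs_ge_self centre_in_cball less_imp_le order_trans real_norm_def)
    then have "AE x in M. norm (f z x) \<le> norm (G x)" by (rule AE_I2)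
    with \<open>integrable M G\<close> meas[OF that] show ?thesis
      by (rule Bochner_Integration.integrable_bound)
  qed
  have "((\<lambda>z. LINT x|M. f z x) has_field_derivative (LINT x|M. deriv (\<lambda>z. f z x) z0)) (at z0)" if z0: "z0 \<in> S" for z0
  proof -
    from dom[OF z0] obtain r G where r: "r > 0" "cball z0 r \<subseteq> S" "integrable M G"
      and G: "\<And>w x. w \<in> cball z0 r \<Longrightarrow> x \<in> space M \<Longrightarrow> norm (f w x) \<le> G x" by blast
    show ?thesis unfolding DERIV_def tendsto_at_iff_sequentially
    proof (intro allI impI)
      fix X :: "nat \<Rightarrow> complex" assume X: "\<forall>i. X i \<in> UNIV - {0}" "X \<longlonglongrightarrow> 0"
      from X(2) r(1) have "eventually (\<lambda>n. norm (X n) < r / 2) sequentially"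
        by (intro order_tendstoD(2)[OF tendsto_norm_zero[OF X(2)]]) simp
      then obtain n0 where n0: "\<And>n. n \<ge> n0 \<Longrightarrow> norm (X n) < r / 2"
        by (auto simp: eventually_sequentially)
      \<comment> \<open>Discarding \<open>n0\<close> terms puts every increment into the half disc,
        so that the domination holds for all \<open>n\<close> and not just eventually.\<close>
      define Y where "Y n = X (n + n0)" for n
      have Y: "Y n \<noteq> 0" "norm (Y n) \<le> r / 2" for n using X n0[of "n + n0"] by (auto simp: Y_def)
      have Yl: "Y \<longlonglongrightarrow> 0" using X(2) unfolding Y_def by (rule LIMSEQ_ignore_initial_segment)
      have YS: "z0 + Y n \<in> S" for n
        using r Y(2)[of n] by (auto simp: dist_norm intro!: subsetD[OF r(2)])
      have lim: "(\<lambda>n. (f (z0 + Y n) x - f z0 x) / Y n) \<longlonglongrightarrow> deriv (\<lambda>z. f z x) z0" if x: "x \<in> space M" for x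
      proof -
        have "((\<lambda>z. f z x) has_field_derivative deriv (\<lambda>z. f z x) z0) (at z0)"
          using holomorphic_derivI[OF hol[OF x] S z0] .
        then show ?thesis unfolding DERIV_def tendsto_at_iff_sequentially
          using Y Yl by (auto simp: o_def)
      qed
      have "(\<lambda>n. LINT x|M. (f (z0 + Y n) x - f z0 x) / Y n) \<longlonglongrightarrow> (LINT x|M. deriv (\<lambda>z. f z x) z0)"
      proof (rule integral_dominated_convergence[where w = "\<lambda>x. 2 * G x / r"])
        show m: "(\<lambda>x. (f (z0 + Y n) x - f z0 x) / Y n) \<in> borel_measurable M" for n
          using meas[OF YS[of n]] meas[OF z0] by (intro borel_measurable_divide borel_measurable_diff) auto
        show "(\<lambda>x. deriv (\<lambda>z. f z x) z0) \<in> borel_measurable M"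
          by (rule borel_measurable_LIMSEQ_metric[OF m lim])
        show "AE x in M. norm ((f (z0 + Y n) x - f z0 x) / Y n) \<le> 2 * G x / r" for n
        proof (rule AE_I2)
          fix x assume x: "x \<in> space M"
          have "norm (f (z0 + Y n) x - f z0 x) \<le> 2 * G x / r * norm (Y n)"
            by (rule difference_bound_of_holomorphic[OF hol[OF x] S r(2,1)]) (use G x Y in auto)
          then show "norm ((f (z0 + Y n) x - f z0 x) / Y n) \<le> 2 * G x / r"
            using Y(1)[of n] r(1) by (simp add: norm_divide divide_simps)
        qed
      qed (use r lim in auto)
      moreover have "(LINT x|M. (f (z0 + Y n) x - f z0 x) / Y n) =
          ((LINT x|M. f (z0 + Y n) x) - (LINT x|M. f z0 x)) / Y n" for n
        using int[OF YS[of n]] int[OF z0] by simp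
      ultimately have "(\<lambda>n. ((LINT x|M. f (z0 + Y n) x) - (LINT x|M. f z0 x)) / Y n)
          \<longlonglongrightarrow> (LINT x|M. deriv (\<lambda>z. f z x) z0)" by (simp only:)
      then show "((\<lambda>h. ((LINT x|M. f (z0 + h) x) - (LINT x|M. f z0 x)) / h) \<circ> X)
          \<longlonglongrightarrow> (LINT x|M. deriv (\<lambda>z. f z x) z0)"
        unfolding Y_def o_def by (rule LIMSEQ_offset)
    qed
  qed
  then show ?thesis using S by (auto simp: holomorphic_on_open)
qed

lemma norm_of_real_powr: "x > 0 \<Longrightarrow> norm (complex_of_real x powr z) = x powr Re z"
  by (simp add: norm_powr_real_powr)

text \<open>For real \<open>c\<close> this is a rescaled Gamma integral; both sides are holomorphic
  in \<open>c\<close> on the right half-plane, so the identity theorem replaces a rotation of the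
  contour.\<close>

lemma has_mellin_exp_complex:
  assumes w: "Re w > 0" and c: "Re c > 0"
  shows "has_mellin (\<lambda>x. exp (- c * of_real x)) w (Gamma w * c powr (- w))"
proof -
  define f where "f c x = indicator {0<..} x *\<^sub>R (complex_of_real x powr (w - 1) * exp (- c * of_real x))" for c x
  have meas[measurable]: "f c \<in> borel_measurable borel" for c unfolding f_def by measurable
  have real: "has_bochner_integral lborel (f (of_real k)) (Gamma w * of_real k powr (- w))" if "k > 0" for k
  proof -
    have "has_mellin (\<lambda>x. of_real (exp (- (k * x)))) w (of_real k powr (- w) * Gamma w)"
      using w that by (intro has_mellin_scale[of "\<lambda>x. of_real (exp (- x))"] has_mellin_exp) auto
    then show ?thesis unfolding f_def by (simp add: has_mellin_def exp_of_real mult.commute[of "Gamma w"] flip: of_real_minus of_real_mult)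
  qed
  have dom: "norm (f c x) \<le> norm (f (of_real k) x)" if "k \<le> Re c" for c k x
    using that by (auto simp: f_def indicator_def norm_mult intro!: mult_left_mono)
  have hol: "(\<lambda>c. LINT x|lborel. f c x) holomorphic_on {c. Re c > 0}"
  proof (rule holomorphic_on_integral)
    fix z0 :: complex assume z0: "z0 \<in> {c. Re c > 0}"
    define r where "r = Re z0 / 2"
    have r: "r > 0" using z0 by (simp add: r_def)
    have Re: "Re z \<ge> r" if "z \<in> cball z0 r" for z
      using that abs_Re_le_cmod[of "z0 - z"] unfolding r_def by (simp add: dist_norm)
    have "integrable lborel (\<lambda>x. norm (f (of_real r) x))"
      using real[OF r] by (simp add: has_bochner_integral_iff)
    moreover have "cball z0 r \<subseteq> {c. Re c > 0}"
    proof
      fix z assume "z \<in> cball z0 r"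
      from Re[OF this] r show "z \<in> {c. Re c > 0}" by simp
    qed
    moreover have "\<forall>z\<in>cball z0 r. \<forall>x\<in>space lborel. norm (f z x) \<le> norm (f (of_real r) x)"
      using Re dom by blast
    ultimately show "\<exists>r>0. \<exists>G. cball z0 r \<subseteq> {c. Re c > 0} \<and> integrable lborel G \<and>
      (\<forall>z\<in>cball z0 r. \<forall>x\<in>space lborel. norm (f z x) \<le> G x)"
      using r by blast
  qed (auto simp: f_def open_halfspace_Re_gt intro!: holomorphic_intros)
  have "(LINT x|lborel. f c x) - Gamma w * c powr (- w) = 0"
  proof (rule analytic_continuation[where f = "\<lambda>c. (LINT x|lborel. f c x) - Gamma w * c powr (- w)"
      and U = "of_real ` {0<..}" and \<xi> = 1 and S = "{c. Re c > 0}"])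
    show "(\<lambda>c. (LINT x|lborel. f c x) - Gamma w * c powr (- w)) holomorphic_on {c. Re c > 0}"
      by (intro holomorphic_intros hol) (auto simp: complex_nonpos_Reals_iff)
    show "connected {c. Re c > 0}" by (intro convex_connected convex_halfspace_Re_gt)
    show "1 islimpt complex_of_real ` {0<..}"
    proof (rule islimptI)
      fix T :: "complex set" assume "1 \<in> T" "open T"
      then obtain e where e: "e > 0" "ball 1 e \<subseteq> T" by (auto simp: open_contains_ball)
      then have "complex_of_real (1 + e / 2) \<in> T"
        by (intro subsetD[OF e(2)]) (auto simp: dist_norm norm_divide)
      then show "\<exists>y\<in>complex_of_real ` {0<..}. y \<in> T \<and> y \<noteq> 1"
        using e(1) by (intro bexI[of _ "complex_of_real (1 + e / 2)"]) (auto simp del: of_real_add simp: of_real_eq_1_iff)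
    qed
    show "(LINT x|lborel. f z x) - Gamma w * z powr (- w) = 0" if "z \<in> of_real ` {0<..}" for z
      using that real by (auto simp: has_bochner_integral_iff)
  qed (use c in \<open>auto simp: open_halfspace_Re_gt\<close>)
  moreover have "integrable lborel (f c)"
  proof (rule Bochner_Integration.integrable_bound)
    show "integrable lborel (f (of_real (Re c)))"
      using real[OF c] by (simp add: has_bochner_integral_iff)
    show "AE x in lborel. norm (f c x) \<le> norm (f (of_real (Re c)) x)"
      by (intro AE_I2 dom order_refl)
  qed simp
  ultimately show ?thesis by (simp add: has_mellin_def has_bochner_integral_iff f_def[abs_def])
qed

section \<open>Rapidly decreasing functions and Dirichlet series\<close>

lemma set_integrable_exp_left:
  assumes "a > (0::real)"
  shows "set_integrable lborel {..<0} (\<lambda>x. exp (a * x))"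
proof -
  have e: "einterval (-\<infinity>) 0 = {..<0::real}" by (auto simp: einterval_def)
  have "set_integrable lborel (einterval (-\<infinity>) 0) (\<lambda>x. exp (a * x))"
  proof (rule interval_integral_FTC_nonneg(1)[where F = "\<lambda>x. exp (a * x) / a" and A = 0 and B = "1 / a"])
    show "(((\<lambda>x. exp (a * x) / a) \<circ> real_of_ereal) \<longlongrightarrow> 0) (at_right (-\<infinity>))"
    proof -
      have "((\<lambda>x. exp (a * x) / a) \<longlongrightarrow> 0 / a) at_bot" using assms
        by (intro tendsto_intros filterlim_compose[OF exp_at_bot] filterlim_tendsto_pos_mult_at_bot[OF tendsto_const]) (auto simp: filterlim_ident)
      then show ?thesis by (simp add: ereal_tendsto_simps)
    qed
    have "((\<lambda>x. exp (a * x) / a) \<longlongrightarrow> exp (a * 0) / a) (at_left 0)"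
      by (intro tendsto_intros) (use assms in auto)
    then show "(((\<lambda>x. exp (a * x) / a) \<circ> real_of_ereal) \<longlongrightarrow> 1 / a) (at_left 0)"
      by (simp add: ereal_tendsto_simps zero_ereal_def)
  qed (use assms in \<open>auto intro!: derivative_eq_intros\<close>)
  then show ?thesis by (simp only: e)
qed

lemma has_bochner_integral_exp_left:
  assumes s: "Re s > 0"
  shows "has_bochner_integral lborel (\<lambda>x. exp (s * of_real x) * indicator {..<0} x) (1 / s)"
proof -
  have s0: "s \<noteq> 0" using s by auto
  have e: "einterval (-\<infinity>) 0 = {..<0::real}" by (auto simp: einterval_def)
  have i: "set_integrable lborel (einterval (-\<infinity>) 0) (\<lambda>x. exp (s * complex_of_real x))"
    unfolding e set_integrable_def
    by (rule Bochner_Integration.integrable_bound[OF set_integrable_exp_left[OF s, unfolded set_integrable_def]])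
       (auto intro!: AE_I2 simp: indicator_def)
  have "(LBINT x=-\<infinity>..0. exp (s * complex_of_real x)) = 1 / s - 0"
  proof (rule interval_integral_FTC_integrable[where F = "\<lambda>x. exp (s * of_real x) / s"])
    show "((\<lambda>x. exp (s * complex_of_real x) / s) has_vector_derivative exp (s * complex_of_real x)) (at x)" for x
    proof -
      have "((\<lambda>z. exp (s * z) / s) has_field_derivative exp (s * of_real x)) (at (of_real x))"
        using s0 by (auto intro!: derivative_eq_intros)
      from has_vector_derivative_real_field[OF this] show ?thesis .
    qed
    have "((\<lambda>x. exp (s * complex_of_real x) / s) \<longlongrightarrow> 0) at_bot"
    proof (rule tendsto_norm_zero_cancel)
      have "((\<lambda>x. exp (Re s * x) / norm s) \<longlongrightarrow> 0 / norm s) at_bot" using s s0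
        by (intro tendsto_intros filterlim_compose[OF exp_at_bot] filterlim_tendsto_pos_mult_at_bot[OF tendsto_const]) (auto simp: filterlim_ident)
      then show "((\<lambda>x. norm (exp (s * complex_of_real x) / s)) \<longlongrightarrow> 0) at_bot"
        by (simp add: norm_divide)
    qed
    then show "(((\<lambda>x. exp (s * complex_of_real x) / s) \<circ> real_of_ereal) \<longlongrightarrow> 0) (at_right (-\<infinity>))"
      by (simp add: ereal_tendsto_simps)
    have "((\<lambda>x. exp (s * complex_of_real x) / s) \<longlongrightarrow> exp (s * complex_of_real 0) / s) (at_left 0)"
      by (intro tendsto_intros) (use s0 in auto)
    then show "(((\<lambda>x. exp (s * complex_of_real x) / s) \<circ> real_of_ereal) \<longlongrightarrow> 1 / s) (at_left 0)"
      by (simp add: ereal_tendsto_simps zero_ereal_def)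
  qed (use i in \<open>auto intro!: continuous_intros\<close>)
  with i show ?thesis
    by (simp add: has_bochner_integral_iff set_integrable_def interval_lebesgue_integral_def e
        set_lebesgue_integral_def scaleR_conv_of_real mult.commute of_real_indicator)
qed

lemma has_mellin_below_one:
  assumes "Re s > 0"
  shows "has_mellin (\<lambda>x. indicator {..<1} x) s (1 / s)"
proof -
  have "(\<lambda>x. exp (s * of_real x) * indicator {..<1::real} (exp x)) =
      (\<lambda>x. exp (s * of_real x) * indicator {..<0} x)"
    by (auto simp: indicator_def fun_eq_iff)
  then show ?thesis using has_bochner_integral_exp_left[OF assms] by (simp add: has_mellin_exp_iff)
qed

lemma has_mellin_above_one:
  assumes "Re s < 0"
  shows "has_mellin (\<lambda>x. indicator {1<..} x) s (- 1 / s)"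
proof -
  have "has_mellin (\<lambda>x. indicator {..<1} (1 / x)) s (1 / (- s))"
    using assms by (intro has_mellin_inverse has_mellin_below_one) auto
  then show ?thesis
    by (subst has_mellin_cong[of _ "\<lambda>x. indicator {..<1} (1 / x)"]) (auto simp: indicator_def field_simps)
qed

lemma has_mellin_dominated:
  assumes [measurable]: "f \<in> borel_measurable borel" and g: "has_mellin g (of_real (Re s)) v"
    and le: "\<And>x. x > 0 \<Longrightarrow> x \<noteq> 1 \<Longrightarrow> norm (f x) \<le> norm (g x)"
  shows "has_mellin f s (mellin_integral 1 f s)"
proof -
  have "integrable lborel (\<lambda>x. indicator {0<..} x *\<^sub>R (of_real x powr (s - 1) * f x))"
  proof (rule Bochner_Integration.integrable_bound)
    show "integrable lborel (\<lambda>x. indicator {0<..} x *\<^sub>R (of_real x powr (of_real (Re s) - 1) * g x))"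
      using g by (simp add: has_mellin_def has_bochner_integral_iff)
    have "AE x in lborel. x \<noteq> (1::real)" by (simp add: AE_lborel_singleton)
    then show "AE x in lborel. norm (indicator {0<..} x *\<^sub>R (complex_of_real x powr (s - 1) * f x)) \<le>
       norm (indicator {0<..} x *\<^sub>R (complex_of_real x powr (of_real (Re s) - 1) * g x))"
      by eventually_elim (auto simp: indicator_def norm_mult norm_of_real_powr le intro!: mult_left_mono)
  qed measurable
  then show ?thesis
    by (simp add: has_mellin_def has_bochner_integral_iff mellin_integral_def set_lebesgue_integral_def)
qed

text \<open>The comparison function is a multiple of \<open>x powr (- a)\<close> below 1 and of
  \<open>x powr (- b)\<close> above 1; its Mellin integral converges on the strip between the two
  exponents. The point 1 is a null set.\<close>

lemma has_mellin_of_bounds: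
  assumes [measurable]: "f \<in> borel_measurable borel"
    and 0: "\<And>x. x > 0 \<Longrightarrow> x < 1 \<Longrightarrow> norm (f x) \<le> C * x powr - a"
    and 1: "\<And>x. x > 1 \<Longrightarrow> norm (f x) \<le> D * x powr - b"
    and s: "a < Re s" "Re s < b"
  shows "has_mellin f s (mellin_integral 1 f s)"
proof -
  define g where "g x = of_real \<bar>C\<bar> * (of_real x powr of_real (- a) * indicator {..<1} x) +
      of_real \<bar>D\<bar> * (complex_of_real x powr of_real (- b) * indicator {1<..} x)" for x
  have "has_mellin g (of_real (Re s)) (of_real \<bar>C\<bar> * (1 / (of_real (Re s) + of_real (-a))) +
      of_real \<bar>D\<bar> * (- 1 / (of_real (Re s) + of_real (-b))))"
    unfolding g_def using s
    by (intro has_mellin_add has_mellin_cmult has_mellin_powr_times has_mellin_below_one has_mellin_above_one) auto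
  moreover have "norm (f x) \<le> norm (g x)" if x: "x > 0" "x \<noteq> 1" for x
  proof (cases "x < 1")
    case True
    have "norm (g x) = \<bar>C\<bar> * x powr - a" using True x by (simp add: g_def norm_mult norm_of_real_powr)
    moreover have "C * x powr - a \<le> \<bar>C\<bar> * x powr - a" by (intro mult_right_mono) auto
    ultimately show ?thesis using 0[OF x(1) True] by simp
  next
    case False
    then have x1: "x > 1" using x by simp
    have "norm (g x) = \<bar>D\<bar> * x powr - b" using x1 by (simp add: g_def norm_mult norm_of_real_powr)
    moreover have "D * x powr - b \<le> \<bar>D\<bar> * x powr - b" by (intro mult_right_mono) auto
    ultimately show ?thesis using 1[OF x1] by simp
  qed
  ultimately show ?thesis by (intro has_mellin_dominated[of f g]) auto
qed

text \<open>One family of bounds controls both ends: decay faster than any power at infinity, and growth of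
  order at most \<open>k\<close> at \<open>0\<close>.\<close>

definition rapid :: "nat \<Rightarrow> (real \<Rightarrow> complex) \<Rightarrow> bool" where
  "rapid k f \<longleftrightarrow> f \<in> borel_measurable borel \<and> (\<forall>K\<ge>k. \<exists>C. \<forall>x>0. norm (f x) \<le> C / x ^ K)"

lemma rapid_measurable: "rapid k f \<Longrightarrow> f \<in> borel_measurable borel"
  by (simp add: rapid_def)

lemma rapidE:
  assumes "rapid k f" "K \<ge> k"
  obtains C where "C \<ge> 0" "\<And>x. x > 0 \<Longrightarrow> norm (f x) \<le> C / x ^ K"
proof -
  from assms obtain C where C: "\<And>x. x > 0 \<Longrightarrow> norm (f x) \<le> C / x ^ K" by (auto simp: rapid_def)
  from C[of 1] have "C \<ge> 0" using order_trans[OF norm_ge_zero] by fastforce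
  with C show ?thesis using that by blast
qed

lemma rapid_mono: "rapid k f \<Longrightarrow> k \<le> k' \<Longrightarrow> rapid k' f"
  by (auto simp: rapid_def)

lemma rapid_add:
  assumes "rapid k f" "rapid k g"
  shows "rapid k (\<lambda>x. f x + g x)"
  unfolding rapid_def
proof (intro conjI allI impI)
  show "(\<lambda>x. f x + g x) \<in> borel_measurable borel"
    using assms[THEN rapid_measurable] by measurable
  fix K assume "K \<ge> k"
  from rapidE[OF assms(1) this] obtain C where C: "\<And>x. x > 0 \<Longrightarrow> norm (f x) \<le> C / x ^ K" by metis
  from rapidE[OF assms(2) \<open>K \<ge> k\<close>] obtain D where D: "\<And>x. x > 0 \<Longrightarrow> norm (g x) \<le> D / x ^ K" by metis
  show "\<exists>C. \<forall>x>0. norm (f x + g x) \<le> C / x ^ K"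
    using C D by (intro exI[of _ "C + D"]) (auto intro!: norm_triangle_le simp: add_divide_distrib add_mono)
qed

lemma rapid_cmult:
  assumes "rapid k f"
  shows "rapid k (\<lambda>x. c * f x)"
  unfolding rapid_def
proof (intro conjI allI impI)
  show "(\<lambda>x. c * f x) \<in> borel_measurable borel"
    using assms[THEN rapid_measurable] by measurable
  fix K assume "K \<ge> k"
  from rapidE[OF assms(1) this] obtain C where C: "\<And>x. x > 0 \<Longrightarrow> norm (f x) \<le> C / x ^ K" by metis
  show "\<exists>C. \<forall>x>0. norm (c * f x) \<le> C / x ^ K"
    using mult_left_mono[OF C norm_ge_zero[of c]]
    by (intro exI[of _ "norm c * C"]) (auto simp: norm_mult)
qed

lemma rapid_scale:
  assumes "rapid k f" "r > 0"
  shows "rapid k (\<lambda>x. f (r * x))"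
  unfolding rapid_def
proof (intro conjI allI impI)
  show "(\<lambda>x. f (r * x)) \<in> borel_measurable borel"
    using assms(1)[THEN rapid_measurable] by measurable
  fix K assume "K \<ge> k"
  from rapidE[OF assms(1) this] obtain C where C: "\<And>x. x > 0 \<Longrightarrow> norm (f x) \<le> C / x ^ K" by metis
  show "\<exists>C. \<forall>x>0. norm (f (r * x)) \<le> C / x ^ K"
    using C[of "r * x" for x] assms(2)
    by (intro exI[of _ "C / r ^ K"]) (auto simp: power_mult_distrib)
qed

lemma has_mellin_rapid:
  assumes f: "rapid k f" and s: "Re s > real k"
  shows "has_mellin f s (mellin_integral 1 f s)"
proof -
  define K where "K = max k (nat \<lceil>Re s\<rceil> + 1)"
  have K: "K \<ge> k" "real K > Re s" unfolding K_def by linarith+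
  from rapidE[OF f order_refl] obtain C where C: "\<And>x. x > 0 \<Longrightarrow> norm (f x) \<le> C / x ^ k" by metis
  from rapidE[OF f K(1)] obtain D where D: "\<And>x. x > 0 \<Longrightarrow> norm (f x) \<le> D / x ^ K" by metis
  show ?thesis
    by (rule has_mellin_of_bounds[OF rapid_measurable[OF f], of C "real k" D "real K"])
       (use C D s K in \<open>auto simp: powr_minus powr_realpow divide_inverse\<close>)
qed

text \<open>Of the extra exponent \<open>m + 2\<close>, the part \<open>m\<close> absorbs the growth
  of the coefficients, and the 2 leaves the convergent series of \<open>1 / n ^ 2\<close> once the
  power of \<open>x\<close> is factored out.\<close>

lemma rapid_series:
  assumes f: "rapid k f" and c: "\<And>n. norm (c n) \<le> D * real (Suc n) ^ m"
  defines "F \<equiv> \<lambda>x. \<Sum>n. c n * f (real (Suc n) * x)"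
  shows rapid_series_summable: "\<And>x. x > 0 \<Longrightarrow> summable (\<lambda>n. norm (c n * f (real (Suc n) * x)))"
    and rapid_series_rapid: "rapid (k + m + 2) F"
proof -
  have D0: "D \<ge> 0" using order_trans[OF norm_ge_zero c[of 0]] by simp
  have sq: "summable (\<lambda>n. 1 / real (Suc n) ^ 2)"
    using inverse_power_summable[of 2, where 'a = real] by (subst summable_Suc_iff) (simp add: divide_inverse)
  have *: "norm (c n * f (real (Suc n) * x)) \<le> D * C / x ^ K * (1 / real (Suc n) ^ 2)"
    if x: "x > 0" and K: "K \<ge> k + m + 2" and C: "C \<ge> 0" "\<And>x. x > 0 \<Longrightarrow> norm (f x) \<le> C / x ^ K" for x n C K
  proof -
    have "norm (c n * f (real (Suc n) * x)) \<le> (D * real (Suc n) ^ m) * (C / (real (Suc n) * x) ^ K)"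
      unfolding norm_mult using x by (intro mult_mono c C(2)) (auto intro!: mult_nonneg_nonneg D0)
    also have "\<dots> = D * C / x ^ K * (real (Suc n) ^ m / real (Suc n) ^ K)"
      by (simp add: power_mult_distrib mult_ac)
    also have "real (Suc n) ^ m / real (Suc n) ^ K \<le> 1 / real (Suc n) ^ 2"
    proof -
      have "real (Suc n) ^ (m + 2) \<le> real (Suc n) ^ K" using K by (intro power_increasing) auto
      then show ?thesis by (simp add: field_simps power_add power2_eq_square del: of_nat_Suc)
    qed
    then have "D * C / x ^ K * (real (Suc n) ^ m / real (Suc n) ^ K) \<le> D * C / x ^ K * (1 / real (Suc n) ^ 2)"
      using x D0 C(1) by (intro mult_left_mono) auto
    finally show ?thesis .
  qed
  show sm: "summable (\<lambda>n. norm (c n * f (real (Suc n) * x)))" if x: "x > 0" for x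
  proof -
    from rapidE[OF f, of "k + m + 2"] obtain C where C: "C \<ge> 0" "\<And>x. x > 0 \<Longrightarrow> norm (f x) \<le> C / x ^ (k + m + 2)" by auto
    show ?thesis
      by (rule summable_comparison_test'[OF summable_mult[OF sq, of "D * C / x ^ (k + m + 2)"], of 0])
         (use *[OF x order_refl C] in simp)
  qed
  show "rapid (k + m + 2) F" unfolding rapid_def
  proof (intro conjI allI impI)
    show "F \<in> borel_measurable borel" unfolding F_def using rapid_measurable[OF f] by measurable
    fix K assume K: "K \<ge> k + m + 2"
    from rapidE[OF f, of K] K obtain C where C: "C \<ge> 0" "\<And>x. x > 0 \<Longrightarrow> norm (f x) \<le> C / x ^ K" by auto
    have "norm (F x) \<le> D * C * (\<Sum>n. 1 / real (Suc n) ^ 2) / x ^ K" if x: "x > 0" for x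
    proof -
      have "norm (F x) \<le> (\<Sum>n. norm (c n * f (real (Suc n) * x)))"
        unfolding F_def by (rule summable_norm[OF sm[OF x]])
      also have "\<dots> \<le> (\<Sum>n. D * C / x ^ K * (1 / real (Suc n) ^ 2))"
        by (intro suminf_le sm[OF x] summable_mult sq *[OF x K C])
      also have "\<dots> = D * C / x ^ K * (\<Sum>n. 1 / real (Suc n) ^ 2)"
        by (rule suminf_mult[OF sq])
      finally show ?thesis by (simp add: field_simps)
    qed
    then show "\<exists>C. \<forall>x>0. norm (F x) \<le> C / x ^ K" by blast
  qed
qed

text \<open>The margin 2 over the growth exponent allows a plain comparison with
  \<open>1 / n ^ 2\<close>.\<close>

lemma summable_norm_dirichlet:
  assumes c: "\<And>n. norm (c n) \<le> D * real (Suc n) ^ m" and s: "Re s \<ge> real m + 2"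
  shows "summable (\<lambda>n. norm (c n * of_nat (Suc n) powr (- s)))"
proof -
  have D0: "D \<ge> 0" using order_trans[OF norm_ge_zero c[of 0]] by simp
  have sq: "summable (\<lambda>n. 1 / real (Suc n) ^ 2)"
    using inverse_power_summable[of 2, where 'a = real] by (subst summable_Suc_iff) (simp add: divide_inverse)
  have "norm (c n * of_nat (Suc n) powr (- s)) \<le> D * (1 / real (Suc n) ^ 2)" for n
  proof -
    have "norm (of_nat (Suc n) powr (- s)) = real (Suc n) powr (- Re s)"
      using norm_of_real_powr[of "real (Suc n)" "- s"] by simp
    also have "\<dots> \<le> real (Suc n) powr (- real (m + 2))"
      using s by (intro powr_mono) auto
    also have "\<dots> = 1 / real (Suc n) ^ (m + 2)"
      by (subst powr_minus_divide, subst powr_realpow) auto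
    finally have "norm (c n * of_nat (Suc n) powr (- s)) \<le> (D * real (Suc n) ^ m) * (1 / real (Suc n) ^ (m + 2))"
      unfolding norm_mult by (intro mult_mono c) (auto intro!: mult_nonneg_nonneg D0)
    also have "\<dots> = D * (1 / real (Suc n) ^ 2)" by (simp add: power_add power2_eq_square)
    finally show ?thesis .
  qed
  then show ?thesis
    by (intro summable_comparison_test'[OF summable_mult[OF sq, of D], of 0]) simp
qed

text \<open>Termwise integration; the margin in \<open>Re s\<close> makes the sum of the integrals
  of the norms converge.\<close>

lemma has_mellin_rapid_series:
  assumes f: "rapid k f" and c: "\<And>n. norm (c n) \<le> D * real (Suc n) ^ m"
    and s: "Re s > real (k + m + 2)"
  shows "has_mellin (\<lambda>x. \<Sum>n. c n * f (real (Suc n) * x)) s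
    ((\<Sum>n. c n * of_nat (Suc n) powr (- s)) * mellin_integral 1 f s)"
proof -
  note [measurable] = rapid_measurable[OF f]
  define G where "G n x = indicator {0<..} x *\<^sub>R (complex_of_real x powr (s - 1) * (c n * f (real (Suc n) * x)))" for n x
  have hm: "has_mellin f s (mellin_integral 1 f s)"
    using has_mellin_rapid[OF f] s by simp
  \<comment> \<open>The norm of \<open>f\<close>, viewed as a complex function, obeys the same
    scaling rule. This evaluates the integral of \<open>norm (G n x)\<close> as the norm of a
    Dirichlet term times a constant.\<close>
  define nf where "nf x = complex_of_real (norm (f x))" for x
  define J where "J = mellin_integral 1 nf (of_real (Re s))"
  have [measurable]: "nf \<in> borel_measurable borel" unfolding nf_def by measurable
  have nf: "has_mellin nf (of_real (Re s)) J"
  proof -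
    have "rapid k nf" using f unfolding rapid_def nf_def by auto
    from has_mellin_rapid[OF this] s show ?thesis by (simp add: J_def)
  qed
  have G: "has_bochner_integral lborel (G n) (c n * of_nat (Suc n) powr (- s) * mellin_integral 1 f s)" for n
    using has_mellin_cmult[OF has_mellin_scale[OF _ _ hm, of "real (Suc n)"], of "c n"]
    unfolding G_def[abs_def] has_mellin_def by (simp add: mult.assoc del: of_nat_Suc)
  have nG: "(LINT x|lborel. norm (G n x)) = norm (c n) * real (Suc n) powr (- Re s) * Re J" for n
  proof -
    have "has_mellin (\<lambda>x. of_real (norm (c n)) * nf (real (Suc n) * x)) (of_real (Re s))
       (of_real (norm (c n)) * (of_real (real (Suc n)) powr (- of_real (Re s)) * J))"
      by (intro has_mellin_cmult has_mellin_scale nf) auto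
    then have "has_bochner_integral lborel (\<lambda>x. Re (indicator {0<..} x *\<^sub>R (of_real x powr (of_real (Re s) - 1) * (of_real (norm (c n)) * nf (real (Suc n) * x)))))
        (Re (of_real (norm (c n)) * (of_real (real (Suc n)) powr (- of_real (Re s)) * J)))"
      unfolding has_mellin_def by (rule has_bochner_integral_Re)
    moreover have "Re (indicator {0<..} x *\<^sub>R (of_real x powr (of_real (Re s) - 1) * (of_real (norm (c n)) * nf (real (Suc n) * x)))) = norm (G n x)" for x
    proof (cases "x > 0")
      case True
      have "complex_of_real x powr (of_real (Re s) - 1) = of_real (x powr (Re s - 1))"
        using True powr_of_real[of x "Re s - 1"] by simp
      then show ?thesis using True by (simp add: G_def nf_def norm_mult norm_of_real_powr)
    qed (simp add: G_def)
    moreover have "Re (of_real (norm (c n)) * (of_real (real (Suc n)) powr (- of_real (Re s)) * J)) =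
        norm (c n) * real (Suc n) powr (- Re s) * Re J"
    proof -
      have "complex_of_real (real (Suc n)) powr (- of_real (Re s)) = of_real (real (Suc n) powr (- Re s))"
        using powr_of_real[of "real (Suc n)" "- Re s"] by simp
      then show ?thesis by simp
    qed
    ultimately show ?thesis by (simp add: has_bochner_integral_iff)
  qed
  have sd: "summable (\<lambda>n. norm (c n * of_nat (Suc n) powr (- s)))"
    by (rule summable_norm_dirichlet[OF c]) (use s in auto)
  have ne: "norm (c n * of_nat (Suc n) powr (- s)) = norm (c n) * real (Suc n) powr (- Re s)" for n
    using norm_of_real_powr[of "real (Suc n)" "- s"] by (simp add: norm_mult)
  have AE: "AE x in lborel. summable (\<lambda>n. norm (G n x))"
  proof (rule AE_I2)
    fix x :: real
    show "summable (\<lambda>n. norm (G n x))"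
    proof (cases "x > 0")
      case True
      have "summable (\<lambda>n. norm (complex_of_real x powr (s - 1)) * norm (c n * f (real (Suc n) * x)))"
        by (intro summable_mult rapid_series_summable[OF f c] True)
      then show ?thesis using True by (simp add: G_def norm_mult)
    qed (simp add: G_def)
  qed
  have sI: "summable (\<lambda>n. LINT x|lborel. norm (G n x))"
    unfolding nG using summable_mult2[OF sd[unfolded ne]] .
  have iG: "integrable lborel (G n)" for n using G by (simp add: has_bochner_integral_iff)
  have "(\<Sum>n. G n x) = indicator {0<..} x *\<^sub>R (of_real x powr (s - 1) * (\<Sum>n. c n * f (real (Suc n) * x)))" for x
  proof (cases "x > 0")
    case True
    have "summable (\<lambda>n. c n * f (real (Suc n) * x))"
      by (rule summable_norm_cancel[OF rapid_series_summable[OF f c True]])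
    then show ?thesis using True by (simp add: G_def suminf_mult)
  qed (simp add: G_def)
  moreover have "(\<Sum>n. integral\<^sup>L lborel (G n)) = (\<Sum>n. c n * of_nat (Suc n) powr (- s)) * mellin_integral 1 f s"
    using G suminf_mult2[OF summable_norm_cancel[OF sd], of "mellin_integral 1 f s"] by (simp add: has_bochner_integral_iff)
  ultimately show ?thesis
    using integrable_suminf[OF iG AE sI] integral_suminf[OF iG AE sI]
    by (simp add: has_mellin_def has_bochner_integral_iff)
qed

section \<open>A flat function and its derivatives\<close>

text \<open>An explicit family of successive derivatives identifies \<open>nderiv\<close> and gives
  smoothness at once. The recursive families \<open>flat_deriv\<close> and
  \<open>gauss_deriv\<close> are built to fit it.\<close>

lemma nderiv_chain:
  assumes "\<And>m x. (D m has_vector_derivative D (Suc m) x) (at x)"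
  shows "nderiv m (D 0) = D m" and "smooth (D 0)"
proof -
  have *: "nderiv m (D 0) = D m" for m
    by (induction m) (auto simp: nderiv_def vector_derivative_at[OF assms])
  then show "nderiv m (D 0) = D m" .
  show "smooth (D 0)"
    unfolding smooth_def * by (meson assms differentiableI_vector)
qed

text \<open>The exponent is left free because differentiation shifts it; the case needed later is
  \<open>a = 2 * lam + of_nat j\<close>, on one half-line at a time.\<close>

definition flat :: "complex \<Rightarrow> real \<Rightarrow> complex" where
  "flat a x = (if x > 0 then of_real x powr (- a) * of_real (exp (- (pi / x\<^sup>2))) else 0)"

text \<open>One derivative of \<open>x powr (- a) * exp (- (pi / x\<^sup>2))\<close> yields the
  exponents \<open>a + 1\<close> and \<open>a + 3\<close>. The recursion takes this derivative
  before the remaining \<open>m\<close>, so inductions over it generalise \<open>a\<close>.\<close>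

primrec flat_deriv :: "nat \<Rightarrow> complex \<Rightarrow> real \<Rightarrow> complex" where
  "flat_deriv 0 a x = flat a x"
| "flat_deriv (Suc m) a x = - a * flat_deriv m (a + 1) x + 2 * of_real pi * flat_deriv m (a + 3) x"

lemma flat_deriv_nonpos: "x \<le> 0 \<Longrightarrow> flat_deriv m a x = 0"
  by (induction m arbitrary: a) (auto simp: flat_def)

lemma powr_le_exp:
  assumes "d \<ge> (0::real)"
  obtains C where "C > 0" "\<And>u. u \<ge> 0 \<Longrightarrow> u powr d \<le> C * exp (pi * u)"
proof -
  \<comment> \<open>Since \<open>1 + u\<close> is at least 1, the exponent may be rounded up, and
    \<open>(1 + u) ^ n / fact n\<close> is a single term of the exponential series.\<close>
  define n where "n = nat \<lceil>d\<rceil>"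
  have "u powr d \<le> (fact n * exp 1) * exp (pi * u)" if u: "u \<ge> 0" for u
  proof -
    have "u powr d \<le> (1 + u) powr d" using u assms by (intro powr_mono2) auto
    also have "\<dots> \<le> (1 + u) powr real n" using u real_nat_ceiling_ge[of d] unfolding n_def by (intro powr_mono) auto
    also have "\<dots> = fact n * ((1 + u) ^ n / fact n)" using u by (simp add: powr_realpow)
    also have "(1 + u) ^ n / fact n \<le> exp (1 + u)"
      using sum_le_suminf[OF summable_exp[of "1 + u"], of "{n}"] u
      by (simp add: exp_def divide_inverse mult.commute)
    also have "exp (1 + u) = exp 1 * exp u" by (simp add: exp_add)
    also have "exp u \<le> exp (pi * u)" using u pi_gt3 mult_right_mono[of 1 pi u] by simp
    finally show ?thesis by (simp add: mult_ac)
  qed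
  then show ?thesis by (intro that[of "fact n * exp 1"]) auto
qed

text \<open>With \<open>u = 1 / x\<^sup>2\<close> the exponential beats every power of
  \<open>u\<close>, so near 0 all powers are allowed; at infinity the exponential tends to 1 and
  \<open>b\<close> may not exceed \<open>Re a\<close>.\<close>

lemma flat_bound:
  assumes "b \<le> Re a"
  obtains C where "\<And>x. x > 0 \<Longrightarrow> norm (flat a x) \<le> C * x powr (- b)"
proof -
  from powr_le_exp[of "(Re a - b) / 2"] assms obtain C
    where C: "\<And>u. u \<ge> 0 \<Longrightarrow> u powr ((Re a - b) / 2) \<le> C * exp (pi * u)" by auto
  have "norm (flat a x) \<le> C * x powr (- b)" if x: "x > 0" for x
  proof -
    have eq: "(1 / x\<^sup>2) powr ((Re a - b) / 2) = x powr (b - Re a)"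
      using x by (simp add: powr_def ln_div ln_realpow field_simps)
    have "norm (flat a x) = x powr (- Re a) * exp (- (pi / x\<^sup>2))"
      using x by (simp add: flat_def norm_mult norm_of_real_powr)
    also have "\<dots> = x powr (- b) * (x powr (b - Re a) * exp (- (pi / x\<^sup>2)))"
      using x by (simp flip: powr_add mult.assoc)
    also have "x powr (b - Re a) * exp (- (pi / x\<^sup>2)) \<le> C"
      using C[of "1 / x\<^sup>2"] eq by (simp add: exp_minus field_simps)
    finally show ?thesis using x by (simp add: mult.commute)
  qed
  then show ?thesis using that by blast
qed

text \<open>Each differentiation raises the exponent by at least 1, hence the gain of
  \<open>m\<close> in the decay at infinity.\<close>

lemma flat_deriv_bound:
  "b \<le> Re a + real m \<Longrightarrow> \<exists>C. \<forall>x>0. norm (flat_deriv m a x) \<le> C * x powr (- b)"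
proof (induction m arbitrary: a)
  case 0
  then show ?case using flat_bound[of b a] by (auto; metis)
next
  case (Suc m)
  from Suc.IH[of "a + 1"] Suc.prems obtain C where C: "\<And>x. x > 0 \<Longrightarrow> norm (flat_deriv m (a + 1) x) \<le> C * x powr (- b)" by auto
  from Suc.IH[of "a + 3"] Suc.prems obtain D where D: "\<And>x. x > 0 \<Longrightarrow> norm (flat_deriv m (a + 3) x) \<le> D * x powr (- b)" by auto
  have "norm (flat_deriv (Suc m) a x) \<le> (norm a * C + 2 * pi * D) * x powr (- b)" if x: "x > 0" for x
  proof -
    have "norm (flat_deriv (Suc m) a x) \<le> norm a * norm (flat_deriv m (a + 1) x) + 2 * pi * norm (flat_deriv m (a + 3) x)"
      using norm_triangle_ineq[of "- a * flat_deriv m (a + 1) x" "2 * of_real pi * flat_deriv m (a + 3) x"]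
      by (simp add: norm_mult)
    also have "\<dots> \<le> norm a * (C * x powr (- b)) + 2 * pi * (D * x powr (- b))"
      by (intro add_mono mult_left_mono C D x) auto
    finally show ?thesis by (simp add: algebra_simps)
  qed
  then show ?case by blast
qed

lemma flat_has_vector_derivative:
  "(flat a has_vector_derivative - a * flat (a + 1) x + 2 * of_real pi * flat (a + 3) x) (at x)"
proof -
  consider "x > 0" | "x < 0" | "x = 0" by linarith
  then show ?thesis
  proof cases
    case 1
    have "((\<lambda>z. z powr (- a) * exp (- (of_real pi / z\<^sup>2))) has_field_derivative
        (- a) * of_real x powr (- a - 1) * exp (- (of_real pi / (of_real x)\<^sup>2)) +
        of_real x powr (- a) * (exp (- (of_real pi / (of_real x)\<^sup>2)) * (2 * of_real pi / of_real x ^ 3))) (at (complex_of_real x))"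
      using 1 by (auto intro!: derivative_eq_intros simp: complex_nonpos_Reals_iff power2_eq_square power3_eq_cube field_simps)
    from has_vector_derivative_real_field[OF this]
    have "((\<lambda>x. of_real x powr (- a) * exp (- (of_real pi / (of_real x)\<^sup>2))) has_vector_derivative
        (- a) * of_real x powr (- a - 1) * exp (- (of_real pi / (of_real x)\<^sup>2)) +
        of_real x powr (- a) * (exp (- (of_real pi / (of_real x)\<^sup>2)) * (2 * of_real pi / of_real x ^ 3))) (at x)" .
    then have "(flat a has_vector_derivative
        (- a) * of_real x powr (- a - 1) * exp (- (of_real pi / (of_real x)\<^sup>2)) +
        of_real x powr (- a) * (exp (- (of_real pi / (of_real x)\<^sup>2)) * (2 * of_real pi / of_real x ^ 3))) (at x)"
      by (rule has_vector_derivative_transform_within_open[of _ _ _ "{0<..}"])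
         (use 1 in \<open>auto simp: flat_def exp_of_real[symmetric]\<close>)
    moreover have "complex_of_real x powr (- (a + 3)) = of_real x powr (- a) / of_real x ^ 3"
    proof -
      have "complex_of_real x powr (- a - of_nat 3) = of_real x powr (- a) / of_real x powr (of_nat 3)"
        by (rule powr_diff)
      then show ?thesis using 1 by (simp add: powr_nat')
    qed
    moreover have "complex_of_real x powr (- (a + 1)) = of_real x powr (- a - 1)" by simp
    ultimately show ?thesis using 1
      by (simp add: flat_def exp_of_real[symmetric] mult_ac)
  next
    case 2
    have "((\<lambda>_. 0) has_vector_derivative 0) (at x)" by simp
    then have "(flat a has_vector_derivative 0) (at x)"
      by (rule has_vector_derivative_transform_within_open[of _ _ _ "{..<0}"])
         (use 2 in \<open>auto simp: flat_def\<close>)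
    then show ?thesis using 2 by (simp add: flat_def)
  next
    case 3
    \<comment> \<open>The cap \<open>- 2\<close> yields a bound by a multiple of
      \<open>y\<^sup>2\<close> near 0, which forces the derivative at 0 to vanish.\<close>
    from flat_bound[of "min (Re a) (- 2)" a] obtain C
      where C: "\<And>x. x > 0 \<Longrightarrow> norm (flat a x) \<le> C * x powr (- min (Re a) (- 2))" by auto
    have bd: "norm (flat a y) \<le> \<bar>C\<bar> * y\<^sup>2" if "\<bar>y\<bar> < 1" for y
    proof (cases "y > 0")
      case True
      have "norm (flat a y) \<le> \<bar>C\<bar> * y powr (- min (Re a) (- 2))"
        by (rule order_trans[OF C[OF True]]) (intro mult_right_mono, auto)
      also have "\<dots> \<le> \<bar>C\<bar> * y powr 2"
        using True that by (intro mult_left_mono powr_mono') auto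
      finally show ?thesis using True by simp
    qed (simp add: flat_def)
    have "((\<lambda>y. flat a y /\<^sub>R norm y) \<longlongrightarrow> 0) (at 0)"
    proof (rule Lim_null_comparison)
      have "\<forall>\<^sub>F y in at 0. \<bar>y\<bar> < (1::real)"
        by (rule eventually_at_ball'[of 1 0 UNIV, THEN eventually_mono]) (auto simp: dist_norm)
      then show "\<forall>\<^sub>F y in at 0. norm (flat a y /\<^sub>R norm y) \<le> \<bar>C\<bar> * \<bar>y\<bar>"
      proof eventually_elim
        case (elim y)
        from bd[OF elim] show ?case
          by (cases "y = 0") (auto simp: field_simps power2_eq_square abs_mult_self_eq)
      qed
      show "((\<lambda>y. \<bar>C\<bar> * \<bar>y\<bar>) \<longlongrightarrow> 0) (at 0)" by (auto intro!: tendsto_eq_intros)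
    qed
    from tendsto_norm_zero[OF this] have "(flat a has_vector_derivative 0) (at 0)"
      unfolding has_vector_derivative_def has_derivative_at by (simp add: divide_inverse_commute flat_def[of a 0])
    then show ?thesis using 3 by (simp add: flat_def)
  qed
qed

lemma flat_deriv_has_vector_derivative:
  "(flat_deriv m a has_vector_derivative flat_deriv (Suc m) a x) (at x)"
proof (induction m arbitrary: a)
  case 0
  have "flat_deriv 0 a = flat a" by (simp add: fun_eq_iff)
  then show ?case using flat_has_vector_derivative[of a x] by simp
next
  case (Suc m)
  have "((\<lambda>x. - a * flat_deriv m (a + 1) x + 2 * of_real pi * flat_deriv m (a + 3) x) has_vector_derivative
      - a * flat_deriv (Suc m) (a + 1) x + 2 * of_real pi * flat_deriv (Suc m) (a + 3) x) (at x)"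
    by (intro has_vector_derivative_add has_vector_derivative_mult_right Suc.IH)
  moreover have "flat_deriv (Suc m) a = (\<lambda>x. - a * flat_deriv m (a + 1) x + 2 * of_real pi * flat_deriv m (a + 3) x)"
    by (simp add: fun_eq_iff)
  ultimately show ?case by (simp only: flat_deriv.simps(2)[of "Suc m"])
qed

lemma continuous_on_flat_deriv: "continuous_on S (flat_deriv m a)"
  by (meson continuous_at_imp_continuous_on flat_deriv_has_vector_derivative has_vector_derivative_continuous)

lemma flat_deriv_measurable [measurable]: "flat_deriv m a \<in> borel_measurable borel"
  by (rule borel_measurable_continuous_onI[OF continuous_on_flat_deriv])

text \<open>The substitution \<open>u = pi / x\<^sup>2\<close> turns the Mellin integral of
  \<open>flat a\<close> into this Gamma value. The formula is kept for all \<open>w\<close>, as it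
  also serves as the meromorphic continuation.\<close>

definition flat_mellin :: "complex \<Rightarrow> complex \<Rightarrow> complex" where
  "flat_mellin a w = of_real pi powr (- ((a - w) / 2)) * Gamma ((a - w) / 2) / 2"

text \<open>The analytic form of integration by parts: differentiating \<open>flat a\<close> and
  moving to \<open>w + 1\<close> multiplies the transform by \<open>- w\<close>. It reduces to
  \<open>Gamma (u + 1) = u * Gamma u\<close>.\<close>

lemma flat_mellin_recurrence:
  assumes "Re w < Re a"
  shows "- a * flat_mellin (a + 1) (w + 1) + 2 * of_real pi * flat_mellin (a + 3) (w + 1) = - w * flat_mellin a w"
proof -
  define u where "u = (a - w) / 2"
  have u: "Re u > 0" using assms by (simp add: u_def)
  then have u0: "u \<notin> \<int>\<^sub>\<le>\<^sub>0" by (auto elim!: nonpos_Ints_cases)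
  have G: "Gamma (u + 1) = u * Gamma u" using Gamma_plus1[OF u0] .
  have p: "complex_of_real pi powr (- (u + 1)) * of_real pi = of_real pi powr (- u)"
    by (simp add: powr_diff)
  have e1: "(a + 1 - (w + 1)) / 2 = u" "(a - w) / 2 = u" "(a + 3 - (w + 1)) / 2 = u + 1"
    by (auto simp: u_def field_simps)
  have "2 * of_real pi * flat_mellin (a + 3) (w + 1) = (complex_of_real pi powr (- (u + 1)) * of_real pi) * Gamma (u + 1)"
    unfolding flat_mellin_def e1 by simp
  also have "\<dots> = of_real pi powr (- u) * (u * Gamma u)" unfolding p G ..
  finally have *: "2 * of_real pi * flat_mellin (a + 3) (w + 1) = of_real pi powr (- u) * (u * Gamma u)" .
  have w: "w = a - 2 * u" by (simp add: u_def field_simps)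
  show ?thesis unfolding * unfolding flat_mellin_def e1 unfolding w by (simp add: algebra_simps)
qed

lemma has_mellin_flat:
  assumes "Re w < Re a"
  shows "has_mellin (flat a) w (flat_mellin a w)"
proof -
  have "has_mellin (\<lambda>x. of_real (exp (- (pi * x)))) ((a - w) / 2) (of_real pi powr (- ((a - w) / 2)) * Gamma ((a - w) / 2))"
    using assms by (intro has_mellin_scale[of "\<lambda>x. of_real (exp (- x))"] has_mellin_exp) auto
  then have "has_mellin (\<lambda>x. of_real (exp (- (pi * x\<^sup>2)))) (a - w) (flat_mellin a w)"
    unfolding flat_mellin_def by (intro has_mellin_power2[of "\<lambda>x. of_real (exp (- (pi * x)))"]) auto
  then have "has_mellin (\<lambda>x. of_real (exp (- (pi * (1 / x)\<^sup>2)))) (w + - a) (flat_mellin a w)"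
    by (intro has_mellin_inverse[of "\<lambda>x. of_real (exp (- (pi * x\<^sup>2)))"]) auto
  then have "has_mellin (\<lambda>x. of_real x powr (- a) * of_real (exp (- (pi * (1 / x)\<^sup>2)))) w (flat_mellin a w)"
    by (rule has_mellin_powr_times)
  then show ?thesis
    by (subst has_mellin_cong[of _ "\<lambda>x. of_real x powr (- a) * of_real (exp (- (pi * (1 / x)\<^sup>2)))"])
       (auto simp: flat_def power_divide)
qed

text \<open>Flatness at 0 makes an upper bound on \<open>Re w\<close> the only constraint; iterating
  the recurrence produces the Pochhammer symbol.\<close>

lemma has_mellin_flat_deriv:
  "Re w < Re a \<Longrightarrow> has_mellin (flat_deriv m a) (w + of_nat m) ((- 1) ^ m * pochhammer w m * flat_mellin a w)"
proof (induction m arbitrary: a w)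
  case 0
  have "flat_deriv 0 a = flat a" by (simp add: fun_eq_iff)
  with has_mellin_flat[OF 0] show ?case by simp
next
  case (Suc m)
  have 1: "has_mellin (flat_deriv m (a + 1)) (w + 1 + of_nat m) ((- 1) ^ m * pochhammer (w + 1) m * flat_mellin (a + 1) (w + 1))"
    using Suc.prems by (intro Suc.IH) simp
  have 2: "has_mellin (flat_deriv m (a + 3)) (w + 1 + of_nat m) ((- 1) ^ m * pochhammer (w + 1) m * flat_mellin (a + 3) (w + 1))"
    using Suc.prems by (intro Suc.IH) simp
  have "has_mellin (\<lambda>x. - a * flat_deriv m (a + 1) x + 2 * of_real pi * flat_deriv m (a + 3) x) (w + 1 + of_nat m)
      (- a * ((- 1) ^ m * pochhammer (w + 1) m * flat_mellin (a + 1) (w + 1)) +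
       2 * of_real pi * ((- 1) ^ m * pochhammer (w + 1) m * flat_mellin (a + 3) (w + 1)))"
    by (intro has_mellin_add has_mellin_cmult 1 2)
  also have "- a * ((- 1) ^ m * pochhammer (w + 1) m * flat_mellin (a + 1) (w + 1)) +
       2 * of_real pi * ((- 1) ^ m * pochhammer (w + 1) m * flat_mellin (a + 3) (w + 1)) =
       (- 1) ^ m * pochhammer (w + 1) m * (- a * flat_mellin (a + 1) (w + 1) + 2 * of_real pi * flat_mellin (a + 3) (w + 1))"
    by (simp add: algebra_simps)
  also have "\<dots> = (- 1) ^ Suc m * pochhammer w (Suc m) * flat_mellin a w"
    unfolding flat_mellin_recurrence[OF Suc.prems] by (simp add: pochhammer_rec)
  also have "(\<lambda>x. - a * flat_deriv m (a + 1) x + 2 * of_real pi * flat_deriv m (a + 3) x) = flat_deriv (Suc m) a"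
    by (simp add: fun_eq_iff)
  also have "w + 1 + of_nat m = w + of_nat (Suc m)" by simp
  finally show ?case .
qed

section \<open>Fourier transforms and local zeta functions\<close>

definition ft :: "(real \<Rightarrow> complex) \<Rightarrow> real \<Rightarrow> complex" where
  "ft f t = (LINT x|lborel. f x * exp (2 * of_real pi * \<i> * of_real x * of_real t))"

lemma integrable_ft:
  assumes f: "integrable lborel f"
  shows "integrable lborel (\<lambda>x. f x * exp (2 * of_real pi * \<i> * of_real x * of_real t))"
proof (rule Bochner_Integration.integrable_bound[OF f])
  have [measurable]: "f \<in> borel_measurable borel" using f by auto
  show "(\<lambda>x. f x * exp (2 * of_real pi * \<i> * of_real x * of_real t)) \<in> borel_measurable lborel"
    by measurable
qed (auto simp: norm_mult)

lemma norm_ft_le: "norm (ft f t) \<le> (LINT x|lborel. norm (f x))"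
proof -
  have "norm (ft f t) \<le> (LINT x|lborel. norm (f x * exp (2 * of_real pi * \<i> * of_real x * of_real t)))"
    unfolding ft_def by (rule integral_norm_bound)
  then show ?thesis by (simp add: norm_mult)
qed

lemma ft_deriv:
  assumes der: "\<And>x. (f has_vector_derivative f' x) (at x)" and cont: "\<And>x. isCont f' x"
    and int: "integrable lborel f" "integrable lborel f'"
    and lim: "(f \<longlongrightarrow> 0) at_top" "(f \<longlongrightarrow> 0) at_bot"
  shows "ft f' t = - (2 * of_real pi * \<i> * of_real t) * ft f t"
proof -
  define e where "e x = exp (2 * complex_of_real pi * \<i> * of_real x * of_real t)" for x
  define c where "c = 2 * complex_of_real pi * \<i> * of_real t"
  have ne: "norm (e x) = 1" for x unfolding e_def by simp
  have e': "(e has_vector_derivative c * e x) (at x)" for x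
  proof -
    have "((\<lambda>z. exp (2 * complex_of_real pi * \<i> * z * of_real t)) has_field_derivative c * e x) (at (of_real x))"
      unfolding c_def e_def by (auto intro!: derivative_eq_intros)
    from has_vector_derivative_real_field[OF this] show ?thesis by (simp add: e_def[abs_def])
  qed
  have ec: "isCont e x" for x using e' by (rule has_vector_derivative_continuous)
  have fc: "isCont f x" for x using der by (rule has_vector_derivative_continuous)
  have i: "integrable lborel (\<lambda>x. f' x * e x)" "integrable lborel (\<lambda>x. f x * e x)"
    using int[THEN integrable_ft, of t] by (simp_all add: e_def)
  have "(LBINT x=-\<infinity>..\<infinity>. f x * (c * e x) + f' x * e x) = 0 - 0"
  proof (rule interval_integral_FTC_integrable[where F = "\<lambda>x. f x * e x"])
    show "((\<lambda>x. f x * e x) has_vector_derivative f x * (c * e x) + f' x * e x) (at x)" for x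
      by (rule has_vector_derivative_mult[OF der e'])
    show "isCont (\<lambda>x. f x * (c * e x) + f' x * e x) x" for x
      by (intro continuous_intros cont ec fc)
    show "set_integrable lborel (einterval (-\<infinity>) \<infinity>) (\<lambda>x. f x * (c * e x) + f' x * e x)"
      using i integrable_mult_right[OF i(2), of c] by (simp add: set_integrable_def mult_ac)
    have *: "((\<lambda>x. f x * e x) \<longlongrightarrow> 0) F" if "(f \<longlongrightarrow> 0) F" for F
      using that by (intro tendsto_norm_zero_cancel[of "\<lambda>x. f x * e x"]) (simp add: norm_mult ne tendsto_norm_zero)
    show "(((\<lambda>x. f x * e x) \<circ> real_of_ereal) \<longlongrightarrow> 0) (at_right (-\<infinity>))"
      using *[OF lim(2)] by (simp add: ereal_tendsto_simps)
    show "(((\<lambda>x. f x * e x) \<circ> real_of_ereal) \<longlongrightarrow> 0) (at_left \<infinity>)"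
      using *[OF lim(1)] by (simp add: ereal_tendsto_simps)
  qed simp
  then have "(LINT x|lborel. c * (f x * e x) + f' x * e x) = 0"
    by (simp add: interval_lebesgue_integral_def set_lebesgue_integral_def mult_ac)
  then have "c * (LINT x|lborel. f x * e x) + (LINT x|lborel. f' x * e x) = 0"
    using i by simp
  then show ?thesis by (simp add: ft_def e_def c_def add_eq_0_iff2)
qed

text \<open>The threshold \<open>k\<close> reflects that for small \<open>Re lam\<close> a function
  and its first derivatives need not be integrable or tend to 0; only the later derivatives are
  controlled.\<close>

definition deriv_chain :: "nat \<Rightarrow> (nat \<Rightarrow> real \<Rightarrow> complex) \<Rightarrow> bool" where
  "deriv_chain k D \<longleftrightarrow> (\<forall>m x. (D m has_vector_derivative D (Suc m) x) (at x)) \<and>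
     (\<forall>m\<ge>k. integrable lborel (D m) \<and> (D m \<longlongrightarrow> 0) at_top \<and> (D m \<longlongrightarrow> 0) at_bot)"

text \<open>Integrating by parts once more does not change the regularised transform, so any order
  from \<open>k\<close> on may be used.\<close>

lemma ft_deriv_chain:
  assumes D: "deriv_chain k D" and t: "t \<noteq> 0" and m: "m \<ge> k"
  shows "(- 1 / (2 * of_real pi * \<i> * of_real t)) ^ m * ft (D m) t =
    (- 1 / (2 * of_real pi * \<i> * of_real t)) ^ k * ft (D k) t"
  using m
proof (induction m rule: dec_induct)
  case (step m)
  have "ft (D (Suc m)) t = - (2 * of_real pi * \<i> * of_real t) * ft (D m) t"
    using D step.hyps by (intro ft_deriv)
      (auto simp: deriv_chain_def intro: has_vector_derivative_continuous)
  then show ?case using step.IH t by (simp add: field_simps)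
qed simp

text \<open>Agreement on a nonempty open set spreads by the identity theorem, and at poles both
  functions have the normalised value 0. This uniqueness makes the description that defines
  \<open>local_zeta\<close> computable.\<close>

lemma nicely_meromorphic_eqI:
  assumes F: "F nicely_meromorphic_on UNIV" and G: "G nicely_meromorphic_on UNIV"
    and U: "open U" "U \<noteq> {}" "\<And>z. z \<in> U \<Longrightarrow> F z = G z"
  shows "F = G"
proof
  fix z :: complex
  have mero: "(\<lambda>z. F z - G z) meromorphic_on UNIV"
    using F G by (intro meromorphic_intros) (auto simp: nicely_meromorphic_on_def)
  obtain u where u: "u \<in> U" using U(2) by blast
  have "\<not> (\<forall>\<^sub>\<approx>x\<in>UNIV. F x - G x \<noteq> 0)"
  proof
    assume "\<forall>\<^sub>\<approx>x\<in>UNIV. F x - G x \<noteq> 0"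
    then have "\<forall>\<^sub>F x in at u. F x - G x \<noteq> 0" by (simp add: eventually_cosparse_open_eq)
    moreover have "\<forall>\<^sub>F x in at u. x \<in> U" using U(1) u by (rule eventually_at_in_open')
    ultimately have "\<forall>\<^sub>F x in at u. False" by eventually_elim (use U(3) in auto)
    then show False by simp
  qed
  with meromorphic_imp_constant_or_avoid[OF mero, of 0] have "\<forall>\<^sub>\<approx>x\<in>UNIV. F x - G x = 0" by auto
  then have ev: "\<forall>\<^sub>F x in at z. F x = G x" by (simp add: eventually_cosparse_open_eq)
  then have pole: "is_pole F z \<longleftrightarrow> is_pole G z" by (intro is_pole_cong) auto
  show "F z = G z"
  proof (cases "is_pole F z")
    case True
    then have "\<not> F \<midarrow>z\<rightarrow> F z" "\<not> G \<midarrow>z\<rightarrow> G z" using pole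
      by (metis at_neq_bot is_pole_def not_tendsto_and_filterlim_at_infinity)+
    then have "F z = 0" "G z = 0" using F G unfolding nicely_meromorphic_on_def by blast+
    then show ?thesis by simp
  next
    case False
    then have "F \<midarrow>z\<rightarrow> F z" "G \<midarrow>z\<rightarrow> G z" using F G pole by (auto simp: nicely_meromorphic_on_def)
    moreover from this(1) have "G \<midarrow>z\<rightarrow> F z" by (rule Lim_transform_eventually[OF _ ev])
    ultimately show ?thesis using LIM_unique by blast
  qed
qed

lemma pochhammer_nonzero_if_Im: "Im z \<noteq> 0 \<Longrightarrow> pochhammer z m \<noteq> 0"
  by (auto simp: pochhammer_eq_0_iff)

lemma local_zeta_eqI:
  assumes F: "F nicely_meromorphic_on UNIV"
    and eq: "\<And>m s. - real m < Re s \<Longrightarrow> Re s < 2 * Re lam \<Longrightarrow> pochhammer s m \<noteq> 0 \<Longrightarrow>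
        F s = (- of_int \<epsilon>) ^ m / pochhammer s m * mellin_integral \<epsilon> (nderiv m f) (s + of_nat m)"
  shows "local_zeta lam \<epsilon> f = F"
  unfolding local_zeta_def
proof (rule the_equality)
  fix G assume G: "G nicely_meromorphic_on UNIV \<and>
     (\<forall>(m::nat) s. - real m < Re s \<and> Re s < 2 * Re lam \<and> pochhammer s m \<noteq> 0 \<longrightarrow>
        G s = (- of_int \<epsilon>) ^ m / pochhammer s m * mellin_integral \<epsilon> (nderiv m f) (s + of_nat m))"
  \<comment> \<open>The order is large enough for the strip \<open>- m < Re s < 2 * Re lam\<close>
    to be nonempty.\<close>
  define m where "m = nat \<lceil>- 2 * Re lam\<rceil> + 1"
  have m: "- real m < 2 * Re lam" unfolding m_def by linarith
  \<comment> \<open>Pochhammer symbols have only real zeros, so in the upper half of the strip both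
    functions are given by the same integral.\<close>
  define U where "U = {s. - real m < Re s \<and> Re s < 2 * Re lam \<and> 0 < Im s}"
  have "U = {s. Re s > - real m} \<inter> {s. Re s < 2 * Re lam} \<inter> {s. 0 < Im s}" by (auto simp: U_def)
  then have "open U" by (simp add: open_Int open_halfspace_Re_gt open_halfspace_Re_lt open_halfspace_Im_gt)
  moreover have "Complex (Re lam - real m / 2) 1 \<in> U" using m by (simp add: U_def field_simps)
  moreover have "G z = F z" if "z \<in> U" for z
    using G eq[of m z] that pochhammer_nonzero_if_Im[of z m] by (auto simp: U_def)
  ultimately show "G = F" using G F by (intro nicely_meromorphic_eqI[of G F U]) auto
qed (use F eq in auto)

text \<open>A zero-free entire factor keeps poles as poles, so the value 0 there stays the right
  one.\<close>

lemma nicely_meromorphic_mult_entire: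
  assumes F: "F nicely_meromorphic_on UNIV" and E: "E holomorphic_on UNIV" "\<And>z. E z \<noteq> 0"
  shows "(\<lambda>z. E z * F z) nicely_meromorphic_on UNIV"
proof -
  have Ec: "E \<midarrow>z\<rightarrow> E z" for z
    using E(1) holomorphic_on_imp_continuous_on[of E UNIV] by (simp add: continuous_on_def)
  have "E analytic_on UNIV" using E(1) by (simp add: analytic_on_open)
  then have "E meromorphic_on UNIV" by (rule analytic_on_imp_meromorphic_on)
  then have "(\<lambda>z. E z * F z) meromorphic_on UNIV"
    using F by (intro meromorphic_intros) (auto simp: nicely_meromorphic_on_def)
  moreover have "is_pole (\<lambda>z. E z * F z) z \<and> E z * F z = 0 \<or> (\<lambda>z. E z * F z) \<midarrow>z\<rightarrow> E z * F z" for z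
  proof (cases "F \<midarrow>z\<rightarrow> F z")
    case True
    then show ?thesis using tendsto_mult[OF Ec True] by blast
  next
    case False
    then have "is_pole F z" "F z = 0" using F by (auto simp: nicely_meromorphic_on_def)
    then show ?thesis
      using tendsto_mult_filterlim_at_infinity[OF Ec E(2)] by (auto simp: is_pole_def)
  qed
  ultimately show ?thesis by (auto simp: nicely_meromorphic_on_def)
qed

text \<open>At its poles \<open>Gamma\<close> has the conventional value 0, which is the
  normalisation that nicely meromorphic functions require.\<close>

lemma nicely_meromorphic_Gamma_affine:
  assumes u: "u \<noteq> 0"
  shows "(\<lambda>z. Gamma (u * z + v)) nicely_meromorphic_on UNIV"
proof -
  have pole: "is_pole (\<lambda>z. Gamma (u * z + v)) z" if "u * z + v \<in> \<int>\<^sub>\<le>\<^sub>0" for z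
  proof -
    from that obtain n where n: "u * z + v = - of_nat n" by (auto elim!: nonpos_Ints_cases')
    have "filterlim (\<lambda>z. u * z + v) (at (u * z + v)) (at z)"
      unfolding filterlim_at using u
      by (auto intro!: tendsto_intros simp: eventually_at_filter)
    then show ?thesis
      using filterlim_compose[OF is_pole_Gamma[of n, unfolded is_pole_def]] n
      by (simp add: is_pole_def)
  qed
  have cont: "(\<lambda>z. Gamma (u * z + v)) analytic_on {z}" if "u * z + v \<notin> \<int>\<^sub>\<le>\<^sub>0" for z
    using that by (intro analytic_intros) auto
  have "(\<lambda>z. Gamma (u * z + v)) = (\<lambda>z. inverse (rGamma (u * z + v)))"
    by (simp add: rGamma_inverse_Gamma)
  moreover have "(\<lambda>z. inverse (rGamma (u * z + v))) meromorphic_on UNIV"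
    by (intro meromorphic_intros analytic_on_imp_meromorphic_on analytic_intros)
  ultimately have "(\<lambda>z. Gamma (u * z + v)) meromorphic_on UNIV" by simp
  then show ?thesis
    using pole cont[THEN analytic_at_imp_isCont] unfolding nicely_meromorphic_on_def
    by (auto simp: isCont_def Gamma_eq_zero_iff)
qed

text \<open>Here \<open>D m\<close> is meant to be the \<open>m\<close>-th derivative of \<open>D 0\<close>.\<close>

definition is_local_zeta :: "complex \<Rightarrow> (nat \<Rightarrow> real \<Rightarrow> complex) \<Rightarrow> int \<Rightarrow> (complex \<Rightarrow> complex) \<Rightarrow> bool" where
  "is_local_zeta lam D \<epsilon> F \<longleftrightarrow> F nicely_meromorphic_on UNIV \<and>
    (\<forall>m w. - real m < Re w \<and> Re w < 2 * Re lam \<and> pochhammer w m \<noteq> 0 \<longrightarrow>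
      has_mellin (\<lambda>x. D m (of_int \<epsilon> * x)) (w + of_nat m) ((- of_int \<epsilon>) ^ m * pochhammer w m * F w))"

lemma nderiv_scaled_chain:
  assumes D: "\<And>m x. (D m has_vector_derivative D (Suc m) x) (at x)"
  shows "nderiv m (\<lambda>x. C * D 0 (k * x)) = (\<lambda>x. C * of_real k ^ m * D m (k * x))"
    and "smooth (\<lambda>x. C * D 0 (k * x))"
proof -
  have *: "((\<lambda>x. C * of_real k ^ m * D m (k * x)) has_vector_derivative C * of_real k ^ Suc m * D (Suc m) (k * x)) (at x)" for m x
  proof -
    have "((\<lambda>x. k * x) has_real_derivative k) (at x)" by (auto intro!: derivative_eq_intros)
    from vector_diff_chain_at[OF this[THEN has_field_derivative_at_within, unfolded has_real_derivative_iff_has_vector_derivative] D[of m "k * x"]]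
    have "((\<lambda>x. D m (k * x)) has_vector_derivative k *\<^sub>R D (Suc m) (k * x)) (at x)" by (simp add: o_def)
    from has_vector_derivative_mult_right[OF this, of "C * of_real k ^ m"] show ?thesis
      by (simp add: scaleR_conv_of_real mult_ac)
  qed
  from nderiv_chain[of "\<lambda>m x. C * of_real k ^ m * D m (k * x)", OF *]
  show "nderiv m (\<lambda>x. C * D 0 (k * x)) = (\<lambda>x. C * of_real k ^ m * D m (k * x))"
    and "smooth (\<lambda>x. C * D 0 (k * x))" by simp_all
qed

text \<open>Dilation by \<open>k\<close> gives \<open>k ^ m\<close> from the chain rule and
  \<open>k powr (- (s + m))\<close> from the Mellin integral; the two combine to
  \<open>k powr (- s)\<close> for every \<open>m\<close>.\<close>

lemma local_zeta_scaled:
  assumes D: "\<And>m x. (D m has_vector_derivative D (Suc m) x) (at x)"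
    and F: "is_local_zeta lam D \<epsilon> F" and \<epsilon>: "\<epsilon> \<in> {1, -1}" and C: "C \<noteq> 0" and k: "k > 0"
  shows "local_zeta lam \<epsilon> (\<lambda>x. C * D 0 (k * x)) = (\<lambda>s. C * of_real k powr (- s) * F s)"
proof (rule local_zeta_eqI)
  show "(\<lambda>s. C * of_real k powr (- s) * F s) nicely_meromorphic_on UNIV"
    using F C k by (intro nicely_meromorphic_mult_entire) (auto simp: is_local_zeta_def intro!: holomorphic_intros)
  fix m :: nat and s assume s: "- real m < Re s" "Re s < 2 * Re lam" "pochhammer s m \<noteq> 0"
  have [measurable]: "D m \<in> borel_measurable borel"
    using D by (intro borel_measurable_continuous_onI continuous_at_imp_continuous_on)
      (auto intro: has_vector_derivative_continuous)
  have "has_mellin (\<lambda>x. D m (of_int \<epsilon> * x)) (s + of_nat m) ((- of_int \<epsilon>) ^ m * pochhammer s m * F s)"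
    using F s by (auto simp: is_local_zeta_def)
  then have "has_mellin (\<lambda>x. C * of_real k ^ m * D m (of_int \<epsilon> * (k * x))) (s + of_nat m)
      (C * of_real k ^ m * (of_real k powr (- (s + of_nat m)) * ((- of_int \<epsilon>) ^ m * pochhammer s m * F s)))"
    using k by (intro has_mellin_cmult has_mellin_scale[of "\<lambda>x. D m (of_int \<epsilon> * x)"]) auto
  moreover have "of_real k ^ m * complex_of_real k powr (- (s + of_nat m)) = of_real k powr (- s)"
  proof -
    have "complex_of_real k powr (of_nat m + - (s + of_nat m)) = of_real k powr of_nat m * of_real k powr (- (s + of_nat m))"
      by (rule powr_add)
    then show ?thesis using k by (simp add: powr_nat')
  qed
  then have "C * of_real k ^ m * (of_real k powr (- (s + of_nat m)) * ((- of_int \<epsilon>) ^ m * pochhammer s m * F s)) =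
      C * of_real k powr (- s) * ((- of_int \<epsilon>) ^ m * pochhammer s m * F s)"
    by (simp only: mult.assoc[symmetric]) (simp only: mult.assoc)
  ultimately have "has_mellin (\<lambda>x. C * of_real k ^ m * D m (k * (of_int \<epsilon> * x))) (s + of_nat m)
      (C * of_real k powr (- s) * ((- of_int \<epsilon>) ^ m * pochhammer s m * F s))"
    by (simp only: mult.left_commute[of k])
  from has_mellin_imp_mellin_integral[OF this]
  have "mellin_integral \<epsilon> (nderiv m (\<lambda>x. C * D 0 (k * x))) (s + of_nat m) =
      C * of_real k powr (- s) * ((- of_int \<epsilon>) ^ m * pochhammer s m * F s)"
    by (simp add: nderiv_scaled_chain[of D, OF D])
  moreover have "(- of_int \<epsilon>) ^ m * (- of_int \<epsilon>) ^ m = (1::complex)"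
    using \<epsilon> by (auto simp flip: power_mult_distrib)
  ultimately show "C * of_real k powr (- s) * F s = (- of_int \<epsilon>) ^ m / pochhammer s m *
      mellin_integral \<epsilon> (nderiv m (\<lambda>x. C * D 0 (k * x))) (s + of_nat m)"
    using s(3) by (simp add: field_simps)
qed

text \<open>At \<open>t = 0\<close> the regularised value scales in the same way as the transform
  elsewhere, because the local zeta functions carry \<open>k powr (- s)\<close> and are taken at
  \<open>s = 1\<close>.\<close>

lemma fourier_scaled:
  assumes D: "\<And>m x. (D m has_vector_derivative D (Suc m) x) (at x)"
    and F: "is_local_zeta lam D 1 F" "is_local_zeta lam D (- 1) G" and C: "C \<noteq> 0" and k: "k > 0"
  shows "fourier lam (\<lambda>x. C * D 0 (k * x)) t = C / of_real k * fourier lam (D 0) (t / k)"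
proof (cases "t = 0")
  case True
  have "local_zeta lam 1 (\<lambda>x. C * D 0 (k * x)) = (\<lambda>s. C * of_real k powr (- s) * F s)"
    "local_zeta lam (- 1) (\<lambda>x. C * D 0 (k * x)) = (\<lambda>s. C * of_real k powr (- s) * G s)"
    using C k by (auto intro!: local_zeta_scaled[of D, OF D F(1)] local_zeta_scaled[of D, OF D F(2)])
  moreover have "local_zeta lam 1 (D 0) = F" "local_zeta lam (- 1) (D 0) = G"
    using local_zeta_scaled[of D, OF D F(1), of 1 1] local_zeta_scaled[of D, OF D F(2), of 1 1] by auto
  ultimately show ?thesis using True k by (simp add: fourier_def powr_minus field_simps)
next
  case False
  define m where "m = (LEAST m::nat. Re lam + real m / 2 > 1 / 2)"
  have [measurable]: "D m \<in> borel_measurable borel"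
    using D by (intro borel_measurable_continuous_onI continuous_at_imp_continuous_on)
      (auto intro: has_vector_derivative_continuous)
  have "(LINT x|lborel. D m x * exp (2 * of_real pi * \<i> * of_real x * of_real (t / k))) =
      \<bar>k\<bar> *\<^sub>R (LINT x|lborel. D m (0 + k * x) * exp (2 * of_real pi * \<i> * of_real (0 + k * x) * of_real (t / k)))"
    using k by (intro lborel_integral_real_affine) auto
  also have "\<dots> = k *\<^sub>R (LINT x|lborel. D m (k * x) * exp (2 * of_real pi * \<i> * of_real x * of_real t))"
    using k by (simp add: mult_ac)
  finally have 1: "(LINT x|lborel. D m (k * x) * exp (2 * of_real pi * \<i> * of_real x * of_real t)) =
     (LINT x|lborel. D m x * exp (2 * of_real pi * \<i> * of_real x * of_real (t / k))) / of_real k"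
    using k by (simp add: scaleR_conv_of_real)
  have 2: "nderiv m (D 0) = D m" by (rule nderiv_chain[of D, OF D])
  have "(LINT x|lborel. C * of_real k ^ m * D m (k * x) * exp (2 * of_real pi * \<i> * of_real x * of_real t)) =
     C * of_real k ^ m * (LINT x|lborel. D m (k * x) * exp (2 * of_real pi * \<i> * of_real x * of_real t))"
    by (subst integral_mult_right_zero[symmetric]) (simp add: mult_ac)
  then have 3: "(LINT x|lborel. C * of_real k ^ m * D m (k * x) * exp (2 * of_real pi * \<i> * of_real x * of_real t)) =
     C * of_real k ^ m * ((LINT x|lborel. D m x * exp (2 * of_real pi * \<i> * of_real x * of_real (t / k))) / of_real k)"
    unfolding 1 .
  have 4: "(- 1 / (2 * of_real pi * \<i> * of_real t)) ^ m * of_real k ^ m = (- 1 / (2 * of_real pi * \<i> * complex_of_real (t / k))) ^ m"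
    unfolding power_mult_distrib[symmetric] using k by simp
  have tk: "t / k \<noteq> 0" using False k by simp
  show ?thesis
    unfolding fourier_def Let_def m_def[symmetric] nderiv_scaled_chain[of D, OF D] 2 if_not_P[OF False] if_not_P[OF tk] 3 4[symmetric]
    by (simp only: times_divide_eq_right times_divide_eq_left mult_ac)
qed

section \<open>Gaussians\<close>

lemma tendsto_zero_of_decay:
  fixes f :: "real \<Rightarrow> complex"
  assumes "\<And>x. \<bar>x\<bar> * norm (f x) \<le> C"
  shows "(f \<longlongrightarrow> 0) at_top" "(f \<longlongrightarrow> 0) at_bot"
proof -
  have "(f \<longlongrightarrow> 0) at_infinity"
  proof (rule Lim_null_comparison)
    have "\<forall>\<^sub>F x in at_infinity. x \<noteq> (0::real)" 
      by (auto simp: eventually_at_infinity intro!: exI[of _ 1])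
    then show "\<forall>\<^sub>F x in at_infinity. norm (f x) \<le> \<bar>C * inverse x\<bar>"
    proof eventually_elim
      case (elim x)
      have "\<bar>x\<bar> * norm (f x) \<le> \<bar>C\<bar>" using assms[of x] by linarith
      with elim show ?case by (simp add: abs_mult field_simps)
    qed
    show "((\<lambda>x. \<bar>C * inverse x\<bar>) \<longlongrightarrow> 0) at_infinity"
      by (intro tendsto_rabs_zero tendsto_mult_right_zero tendsto_inverse_0)
  qed
  then show "(f \<longlongrightarrow> 0) at_top" "(f \<longlongrightarrow> 0) at_bot"
    using tendsto_mono[OF at_top_le_at_infinity] tendsto_mono[OF at_bot_le_at_infinity] by blast+
qed

lemma has_bochner_integral_halves:
  fixes f :: "real \<Rightarrow> complex"
  assumes [measurable]: "f \<in> borel_measurable borel"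
    and "has_mellin f 1 v" "has_mellin (\<lambda>x. f (- x)) 1 w"
  shows "has_bochner_integral lborel f (v + w)"
proof -
  have eq: "(\<lambda>x. indicator {0<..} x *\<^sub>R (complex_of_real x powr (1 - 1) * g x)) = (\<lambda>x. indicator {0<..} x *\<^sub>R g x)" for g
    by (auto simp: indicator_def fun_eq_iff)
  have 1: "has_bochner_integral lborel (\<lambda>x. indicator {0<..} x *\<^sub>R f x) v"
    using assms(2) unfolding has_mellin_def eq .
  have "has_bochner_integral lborel (\<lambda>x. indicator {0<..} x *\<^sub>R f (- x)) w"
    using assms(3) unfolding has_mellin_def eq .
  from lborel_has_bochner_integral_real_affine_iff[of "-1" _ _ 0, THEN iffD1, OF _ this]
  have 2: "has_bochner_integral lborel (\<lambda>x. indicator {0<..} (- x) *\<^sub>R f x) w" by simp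
  have "has_bochner_integral lborel (\<lambda>x. indicator {0<..} x *\<^sub>R f x + indicator {0<..} (- x) *\<^sub>R f x) (v + w)"
    by (rule has_bochner_integral_add[OF 1 2])
  moreover have "AE x in lborel. indicator {0<..} x *\<^sub>R f x + indicator {0<..} (- x) *\<^sub>R f x = f x"
    using AE_lborel_singleton[of 0] by eventually_elim (auto simp: indicator_def)
  ultimately show ?thesis by (subst has_bochner_integral_cong_AE[symmetric]) auto
qed

text \<open>For \<open>n = 0\<close> the truncated \<open>n - 1\<close> is harmless, since its
  coefficient is 0.\<close>

primrec gauss_deriv :: "nat \<Rightarrow> nat \<Rightarrow> real \<Rightarrow> complex" where
  "gauss_deriv 0 n x = of_real (x ^ n * exp (- (pi * x\<^sup>2)))"
| "gauss_deriv (Suc m) n x = of_nat n * gauss_deriv m (n - 1) x - 2 * of_real pi * gauss_deriv m (n + 1) x"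

lemma gauss_deriv_has_vector_derivative:
  "(gauss_deriv m n has_vector_derivative gauss_deriv (Suc m) n x) (at x)"
proof (induction m arbitrary: n)
  case 0
  have "((\<lambda>x. x ^ n * exp (- (pi * x\<^sup>2))) has_real_derivative
      real n * (x ^ (n - 1) * exp (- (pi * x\<^sup>2))) - 2 * pi * (x ^ (n + 1) * exp (- (pi * x\<^sup>2)))) (at x)"
    by (rule derivative_eq_intros refl)+ (simp add: power2_eq_square algebra_simps)
  then have "((\<lambda>x. complex_of_real (x ^ n * exp (- (pi * x\<^sup>2)))) has_vector_derivative
      of_real (real n * (x ^ (n - 1) * exp (- (pi * x\<^sup>2))) - 2 * pi * (x ^ (n + 1) * exp (- (pi * x\<^sup>2))))) (at x)"
    by (intro has_vector_derivative_of_real) (simp add: has_real_derivative_iff_has_vector_derivative)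
  moreover have "gauss_deriv 0 n = (\<lambda>x. complex_of_real (x ^ n * exp (- (pi * x\<^sup>2))))" by (simp add: fun_eq_iff)
  ultimately show ?case by simp
next
  case (Suc m)
  have "((\<lambda>x. of_nat n * gauss_deriv m (n - 1) x - 2 * of_real pi * gauss_deriv m (n + 1) x) has_vector_derivative
      of_nat n * gauss_deriv (Suc m) (n - 1) x - 2 * of_real pi * gauss_deriv (Suc m) (n + 1) x) (at x)"
    by (intro has_vector_derivative_diff has_vector_derivative_mult_right Suc.IH)
  moreover have "gauss_deriv (Suc m) n = (\<lambda>x. of_nat n * gauss_deriv m (n - 1) x - 2 * of_real pi * gauss_deriv m (n + 1) x)"
    by (simp add: fun_eq_iff)
  ultimately show ?case by (simp only: gauss_deriv.simps(2)[of "Suc m"])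
qed

lemma gauss_deriv_measurable [measurable]: "gauss_deriv m n \<in> borel_measurable borel"
  by (rule borel_measurable_continuous_onI)
     (meson continuous_at_imp_continuous_on gauss_deriv_has_vector_derivative has_vector_derivative_continuous)

lemma gauss_bound: "\<exists>C. \<forall>x::real. \<bar>x\<bar> ^ K * exp (- (pi * x\<^sup>2)) \<le> C"
proof -
  from powr_le_exp[of "real K / 2"] obtain C where C: "\<And>u. u \<ge> 0 \<Longrightarrow> u powr (real K / 2) \<le> C * exp (pi * u)" by auto
  \<comment> \<open>The maximum with 1 covers \<open>x = 0\<close>, where \<open>0 ^ 0 = 1\<close>
    occurs for \<open>K = 0\<close>.\<close>
  have "\<bar>x\<bar> ^ K * exp (- (pi * x\<^sup>2)) \<le> max C 1" for x :: real
  proof (cases "x = 0")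
    case False
    have "(x\<^sup>2) powr (real K / 2) = \<bar>x\<bar> ^ K"
    proof -
      have "(x\<^sup>2) powr (real K / 2) = (\<bar>x\<bar> powr 2) powr (real K / 2)" using False by simp
      also have "\<dots> = \<bar>x\<bar> powr real K" by (simp only: powr_powr) simp
      finally show ?thesis using False by (simp add: powr_realpow)
    qed
    with C[of "x\<^sup>2"] have "\<bar>x\<bar> ^ K \<le> C * exp (pi * x\<^sup>2)" by simp
    also have "\<dots> \<le> max C 1 * exp (pi * x\<^sup>2)" by (intro mult_right_mono) auto
    finally show ?thesis by (simp add: exp_minus field_simps)
  qed (cases K, auto)
  then show ?thesis by blast
qed

lemma gauss_deriv_bound: "\<exists>C. \<forall>x. \<bar>x\<bar> ^ K * norm (gauss_deriv m n x) \<le> C"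
proof (induction m arbitrary: n)
  case 0
  from gauss_bound[of "K + n"] show ?case by (simp add: norm_mult norm_power power_add mult_ac)
next
  case (Suc m)
  from Suc.IH[of "n - 1"] obtain C where C: "\<And>x. \<bar>x\<bar> ^ K * norm (gauss_deriv m (n - 1) x) \<le> C" by blast
  from Suc.IH[of "n + 1"] obtain D where D: "\<And>x. \<bar>x\<bar> ^ K * norm (gauss_deriv m (n + 1) x) \<le> D" by blast
  have "\<bar>x\<bar> ^ K * norm (gauss_deriv (Suc m) n x) \<le> real n * C + 2 * pi * D" for x
  proof -
    have "norm (gauss_deriv (Suc m) n x) \<le> real n * norm (gauss_deriv m (n - 1) x) + 2 * pi * norm (gauss_deriv m (n + 1) x)"
      using norm_triangle_ineq4[of "of_nat n * gauss_deriv m (n - 1) x" "2 * of_real pi * gauss_deriv m (n + 1) x"]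
      by (simp add: norm_mult)
    from mult_left_mono[OF this, of "\<bar>x\<bar> ^ K"]
    have "\<bar>x\<bar> ^ K * norm (gauss_deriv (Suc m) n x) \<le>
        real n * (\<bar>x\<bar> ^ K * norm (gauss_deriv m (n - 1) x)) + 2 * pi * (\<bar>x\<bar> ^ K * norm (gauss_deriv m (n + 1) x))"
      by (simp add: algebra_simps)
    also have "\<dots> \<le> real n * C + 2 * pi * D" by (intro add_mono mult_left_mono C D) auto
    finally show ?thesis .
  qed
  then show ?case by blast
qed

lemma gauss_deriv_uminus: "gauss_deriv m n (- x) = (- 1) ^ (n + m) * gauss_deriv m n x"
proof (induction m arbitrary: n)
  case 0
  show ?case by (simp add: power_minus[of x])
next
  case (Suc m)
  show ?case
  proof (cases n)
    case (Suc n')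
    then show ?thesis by (simp add: Suc.IH algebra_simps)
  qed (simp add: Suc.IH)
qed

lemma rapid_gauss: "rapid 0 (gauss_deriv m n)"
  unfolding rapid_def
proof (intro conjI allI impI)
  fix K :: nat
  from gauss_deriv_bound[of K m n] obtain C where C: "\<And>x. \<bar>x\<bar> ^ K * norm (gauss_deriv m n x) \<le> C" by blast
  have "norm (gauss_deriv m n x) \<le> C / x ^ K" if "x > 0" for x
    using C[of x] that by (simp add: field_simps)
  then show "\<exists>C. \<forall>x>0. norm (gauss_deriv m n x) \<le> C / x ^ K" by blast
qed simp

lemma integrable_gauss_deriv: "integrable lborel (gauss_deriv m n)"
proof -
  have 1: "has_mellin (gauss_deriv m n) 1 (mellin_integral 1 (gauss_deriv m n) 1)"
    by (rule has_mellin_rapid[OF rapid_gauss]) simp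
  have "has_mellin (\<lambda>x. gauss_deriv m n (- x)) 1 ((- 1) ^ (n + m) * mellin_integral 1 (gauss_deriv m n) 1)"
    unfolding gauss_deriv_uminus by (rule has_mellin_cmult[OF 1])
  from has_bochner_integral_halves[OF _ 1 this] show ?thesis by (simp add: has_bochner_integral_iff)
qed

lemma deriv_chain_gauss: "deriv_chain 0 (\<lambda>m. gauss_deriv m n)"
  unfolding deriv_chain_def
proof (intro conjI allI impI)
  fix m :: nat
  from gauss_deriv_bound[of 1 m n] obtain C where "\<And>x. \<bar>x\<bar> * norm (gauss_deriv m n x) \<le> C" by auto
  from tendsto_zero_of_decay[OF this]
  show "(gauss_deriv m n \<longlongrightarrow> 0) at_top" "(gauss_deriv m n \<longlongrightarrow> 0) at_bot" .
qed (auto simp: integrable_gauss_deriv intro: gauss_deriv_has_vector_derivative simp del: gauss_deriv.simps)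

text \<open>This is the characteristic function of the standard normal law, rescaled by
  \<open>sqrt (2 * pi)\<close>.\<close>

lemma ft_gauss_0: "ft (gauss_deriv 0 0) t = of_real (exp (- (pi * t\<^sup>2)))"
proof -
  define c where "c = sqrt (2 * pi)"
  have c: "c > 0" "c * c = 2 * pi" by (auto simp: c_def)
  have "char std_normal_distribution (c * t) = (LINT x|lborel. std_normal_density x *\<^sub>R iexp (c * t * x))"
    unfolding char_def by (subst integral_density) (auto simp: normal_density_nonneg)
  also have "\<dots> = \<bar>c\<bar> *\<^sub>R (LINT x|lborel. std_normal_density (0 + c * x) *\<^sub>R iexp (c * t * (0 + c * x)))"
    using c by (intro lborel_integral_real_affine) auto
  also have "\<dots> = c *\<^sub>R (LINT x|lborel. std_normal_density (c * x) *\<^sub>R iexp (c * t * (c * x)))"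
    using c by simp
  also have "\<dots> = (LINT x|lborel. c *\<^sub>R (std_normal_density (c * x) *\<^sub>R iexp (c * t * (c * x))))"
    by (rule integral_scaleR_right[symmetric])
  also have "(\<lambda>x. c *\<^sub>R (std_normal_density (c * x) *\<^sub>R iexp (c * t * (c * x)))) =
      (\<lambda>x. gauss_deriv 0 0 x * exp (2 * of_real pi * \<i> * of_real x * of_real t))"
  proof
    fix x
    have 1: "(c * x)\<^sup>2 / 2 = pi * x\<^sup>2" using c(2) by (simp add: power2_eq_square algebra_simps)
    have 2: "c * t * (c * x) = 2 * pi * x * t" using c(2) by (simp add: algebra_simps)
    have "std_normal_density (c * x) = exp (- (pi * x\<^sup>2)) / c"
      using 1 by (simp add: std_normal_density_def c_def)
    then show "c *\<^sub>R (std_normal_density (c * x) *\<^sub>R iexp (c * t * (c * x))) =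
        gauss_deriv 0 0 x * exp (2 * of_real pi * \<i> * of_real x * of_real t)"
      unfolding 2 using c(1) by (simp add: scaleR_conv_of_real mult_ac)
  qed
  also have "(LINT x|lborel. gauss_deriv 0 0 x * exp (2 * of_real pi * \<i> * of_real x * of_real t)) = ft (gauss_deriv 0 0) t"
    by (simp add: ft_def)
  finally have "ft (gauss_deriv 0 0) t = of_real (exp (- ((c * t)\<^sup>2) / 2))"
    by (simp add: char_std_normal_distribution)
  also have "- ((c * t)\<^sup>2) / 2 = - (pi * t\<^sup>2)" using c(2) by (simp add: power2_eq_square algebra_simps)
  finally show ?thesis .
qed

text \<open>The case \<open>j = 1\<close> comes from \<open>j = 0\<close>, because
  \<open>x * exp (- (pi * x\<^sup>2))\<close> is \<open>- 1 / (2 * pi)\<close> times the derivative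
  of the Gaussian.\<close>

lemma ft_gauss:
  assumes "j \<le> 1"
  shows "ft (gauss_deriv 0 j) t = (\<i> * of_real t) ^ j * of_real (exp (- (pi * t\<^sup>2)))"
proof (cases "j = 0")
  case True
  then show ?thesis using ft_gauss_0 by simp
next
  case False
  then have j: "j = 1" using assms by simp
  have "ft (gauss_deriv (Suc 0) 0) t = - (2 * of_real pi * \<i> * of_real t) * ft (gauss_deriv 0 0) t"
    using deriv_chain_gauss[of 0] unfolding deriv_chain_def
    by (intro ft_deriv) (auto intro: has_vector_derivative_continuous simp del: gauss_deriv.simps)
  moreover have "gauss_deriv (Suc 0) 0 = (\<lambda>x. (- 2 * of_real pi) * gauss_deriv 0 1 x)" by (simp add: fun_eq_iff)
  moreover have "ft (\<lambda>x. (- 2 * of_real pi) * gauss_deriv 0 1 x) t = - 2 * of_real pi * ft (gauss_deriv 0 1) t"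
    unfolding ft_def by (subst integral_mult_right_zero[symmetric]) (simp add: mult_ac del: gauss_deriv.simps)
  ultimately have "(- 2 * of_real pi) * ft (gauss_deriv 0 1) t = (- 2 * of_real pi) * (\<i> * of_real t * of_real (exp (- (pi * t\<^sup>2))))"
    unfolding ft_gauss_0 by (simp add: mult_ac)
  then have "ft (gauss_deriv 0 1) t = \<i> * of_real t * of_real (exp (- (pi * t\<^sup>2)))"
    by (subst (asm) mult_cancel_left) auto
  then show ?thesis unfolding j by simp
qed

definition gauss_mellin :: "nat \<Rightarrow> complex \<Rightarrow> complex" where
  "gauss_mellin n w = of_real pi powr (- ((w + of_nat n) / 2)) * Gamma ((w + of_nat n) / 2) / 2"

lemma has_mellin_gauss:
  assumes "Re w > - real n"
  shows "has_mellin (gauss_deriv 0 n) w (gauss_mellin n w)"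
proof -
  have "has_mellin (\<lambda>x. of_real (exp (- (pi * x)))) ((w + of_nat n) / 2)
      (of_real pi powr (- ((w + of_nat n) / 2)) * Gamma ((w + of_nat n) / 2))"
    using assms by (intro has_mellin_scale[of "\<lambda>x. of_real (exp (- x))"] has_mellin_exp) auto
  then have "has_mellin (\<lambda>x. of_real (exp (- (pi * x\<^sup>2)))) (w + of_nat n) (gauss_mellin n w)"
    unfolding gauss_mellin_def by (intro has_mellin_power2[of "\<lambda>x. of_real (exp (- (pi * x)))"]) auto
  then have "has_mellin (\<lambda>x. of_real x powr of_nat n * of_real (exp (- (pi * x\<^sup>2)))) w (gauss_mellin n w)"
    by (rule has_mellin_powr_times)
  then show ?thesis
    by (subst has_mellin_cong[of _ "\<lambda>x. of_real x powr of_nat n * of_real (exp (- (pi * x\<^sup>2)))"])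
       (auto simp: powr_nat')
qed

text \<open>The Gaussian is not flat at 0, so poles of \<open>gauss_mellin\<close> can lie in the
  half-plane \<open>Re w > - m\<close>; the Pochhammer condition excludes them.\<close>

lemma has_mellin_gauss_deriv:
  "Re w > - real m \<Longrightarrow> pochhammer w m \<noteq> 0 \<Longrightarrow>
    has_mellin (gauss_deriv m n) (w + of_nat m) ((- 1) ^ m * pochhammer w m * gauss_mellin n w)"
proof (induction m arbitrary: n w)
  case 0
  then show ?case using has_mellin_gauss[of n w] by (simp del: gauss_deriv.simps)
next
  case (Suc m)
  have p: "w \<noteq> 0" "pochhammer (w + 1) m \<noteq> 0" "Re (w + 1) > - real m"
    using Suc.prems by (auto simp: pochhammer_rec)
  define u where "u = (w + of_nat n) / 2"
  \<comment> \<open>A zero of \<open>u\<close> would mean \<open>w = - n\<close> with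
    \<open>n \<le> m\<close>, which is a zero of the Pochhammer symbol.\<close>
  have u0: "u \<noteq> 0"
  proof
    assume "u = 0"
    then have w: "w = - of_nat n" by (simp add: u_def add_eq_0_iff2)
    then have "n \<le> m" using Suc.prems(1) by simp
    then have "pochhammer w (Suc m) = 0" unfolding w by (subst pochhammer_of_nat_eq_0_iff) auto
    then show False using Suc.prems(2) by simp
  qed
  \<comment> \<open>The recurrence survives at the negative integers, where both Gamma values are 0
    by convention; it would break only at \<open>u = 0\<close>.\<close>
  have G: "Gamma (u + 1) = u * Gamma u"
  proof (cases "u \<in> \<int>\<^sub>\<le>\<^sub>0")
    case True
    then obtain k where k: "u = - of_nat k" by (auto elim!: nonpos_Ints_cases')
    with u0 have "k > 0" by (cases k) auto
    with k have "u + 1 = - of_nat (k - 1)" by (simp add: of_nat_diff)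
    then have "u + 1 \<in> \<int>\<^sub>\<le>\<^sub>0" by simp
    then have "Gamma (u + 1) = 0" "Gamma u = 0" using True Gamma_eq_zero_iff by blast+
    then show ?thesis by simp
  qed (rule Gamma_plus1)
  have pp: "complex_of_real pi powr (- (u + 1)) * of_real pi = of_real pi powr (- u)"
    by (simp add: powr_diff)
  have e2: "(w + 1 + of_nat (n + 1)) / 2 = u + 1" by (simp add: u_def field_simps)
  have "2 * of_real pi * gauss_mellin (n + 1) (w + 1) = (complex_of_real pi powr (- (u + 1)) * of_real pi) * Gamma (u + 1)"
    unfolding gauss_mellin_def e2 by simp
  also have "\<dots> = (2 * u) * gauss_mellin n w" unfolding pp G by (simp add: gauss_mellin_def u_def)
  also have "2 * u = w + of_nat n" by (simp add: u_def field_simps)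
  finally have r2: "2 * of_real pi * gauss_mellin (n + 1) (w + 1) = (w + of_nat n) * gauss_mellin n w" .
  have r1: "of_nat n * gauss_mellin (n - 1) (w + 1) = of_nat n * gauss_mellin n w"
    by (cases n) (auto simp: gauss_mellin_def add_ac)
  have 1: "has_mellin (gauss_deriv m n') (w + 1 + of_nat m) ((- 1) ^ m * pochhammer (w + 1) m * gauss_mellin n' (w + 1))" for n'
    using p by (intro Suc.IH) auto
  have "has_mellin (\<lambda>x. of_nat n * gauss_deriv m (n - 1) x + (- 2 * of_real pi) * gauss_deriv m (n + 1) x) (w + 1 + of_nat m)
      (of_nat n * ((- 1) ^ m * pochhammer (w + 1) m * gauss_mellin (n - 1) (w + 1)) +
       (- 2 * of_real pi) * ((- 1) ^ m * pochhammer (w + 1) m * gauss_mellin (n + 1) (w + 1)))"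
    by (intro has_mellin_add has_mellin_cmult 1)
  also have "of_nat n * ((- 1) ^ m * pochhammer (w + 1) m * gauss_mellin (n - 1) (w + 1)) +
       (- 2 * of_real pi) * ((- 1) ^ m * pochhammer (w + 1) m * gauss_mellin (n + 1) (w + 1)) =
       (- 1) ^ m * pochhammer (w + 1) m * (of_nat n * gauss_mellin (n - 1) (w + 1) - 2 * of_real pi * gauss_mellin (n + 1) (w + 1))"
    by (simp add: algebra_simps)
  also have "\<dots> = (- 1) ^ Suc m * pochhammer w (Suc m) * gauss_mellin n w"
    unfolding r1 r2 by (simp add: pochhammer_rec algebra_simps)
  also have "(\<lambda>x. of_nat n * gauss_deriv m (n - 1) x + (- 2 * of_real pi) * gauss_deriv m (n + 1) x) = gauss_deriv (Suc m) n"
    by (simp add: fun_eq_iff)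
  also have "w + 1 + of_nat m = w + of_nat (Suc m)" by simp
  finally show ?case .
qed

lemma is_local_zeta_gauss:
  assumes "\<epsilon> \<in> {1, -1}"
  shows "is_local_zeta lam (\<lambda>m. gauss_deriv m n) \<epsilon> (\<lambda>w. of_int \<epsilon> ^ n * gauss_mellin n w)"
  unfolding is_local_zeta_def
proof (intro conjI allI impI)
  have "(\<lambda>w. (of_int \<epsilon> ^ n / 2 * of_real pi powr (- ((w + of_nat n) / 2))) * Gamma ((1 / 2) * w + of_nat n / 2)) nicely_meromorphic_on UNIV"
    using assms by (intro nicely_meromorphic_mult_entire nicely_meromorphic_Gamma_affine) (auto intro!: holomorphic_intros)
  then show "(\<lambda>w. of_int \<epsilon> ^ n * gauss_mellin n w) nicely_meromorphic_on UNIV"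
    by (simp add: gauss_mellin_def add_divide_distrib mult.assoc)
  fix m :: nat and w
  assume w: "- real m < Re w \<and> Re w < 2 * Re lam \<and> pochhammer w m \<noteq> 0"
  then have *: "has_mellin (gauss_deriv m n) (w + of_nat m) ((- 1) ^ m * pochhammer w m * gauss_mellin n w)"
    by (intro has_mellin_gauss_deriv) auto
  show "has_mellin (\<lambda>x. gauss_deriv m n (of_int \<epsilon> * x)) (w + of_nat m)
     ((- of_int \<epsilon>) ^ m * pochhammer w m * (of_int \<epsilon> ^ n * gauss_mellin n w))"
  proof (cases "\<epsilon> = 1")
    case False
    then have "\<epsilon> = - 1" using assms by auto
    with has_mellin_cmult[OF *, of "(- 1) ^ (n + m)"] show ?thesis
      by (simp add: gauss_deriv_uminus power_add mult_ac flip: power_mult_distrib)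
  qed (use * in simp)
qed

text \<open>Rapid decay lets the chain of derivatives start at 0, which undoes the regularisation.
  At \<open>t = 0\<close> the two half-line values \<open>1 / 2\<close> add up for
  \<open>j = 0\<close>, and opposite values cancel for \<open>j = 1\<close>.\<close>

lemma fourier_gauss:
  assumes "j \<le> 1"
  shows "fourier lam (gauss_deriv 0 j) t = (\<i> * of_real t) ^ j * of_real (exp (- (pi * t\<^sup>2)))"
proof (cases "t = 0")
  case True
  have "local_zeta lam \<epsilon> (gauss_deriv 0 j) = (\<lambda>w. of_int \<epsilon> ^ j * gauss_mellin j w)" if "\<epsilon> \<in> {1, -1}" for \<epsilon>
    using local_zeta_scaled[of "\<lambda>m. gauss_deriv m j", OF gauss_deriv_has_vector_derivative is_local_zeta_gauss[OF that] that, of 1 1]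
    by (simp del: gauss_deriv.simps)
  then have "fourier lam (gauss_deriv 0 j) t = gauss_mellin j 1 + (- 1) ^ j * gauss_mellin j 1"
    using True by (simp add: fourier_def del: gauss_deriv.simps)
  moreover have "gauss_mellin 0 1 = 1 / 2"
  proof -
    have "complex_of_real pi powr (- (1 / 2)) * csqrt (of_real pi) = 1"
      by (simp add: csqrt_conv_powr flip: powr_add)
    moreover have "csqrt (complex_of_real pi) = of_real (sqrt pi)" by simp
    ultimately show ?thesis unfolding gauss_mellin_def by (simp add: Gamma_one_half_complex)
  qed
  ultimately show ?thesis using True assms by (cases j) auto
next
  case False
  define m where "m = (LEAST m::nat. Re lam + real m / 2 > 1 / 2)"
  have "nderiv m (gauss_deriv 0 j) = gauss_deriv m j"
    by (rule nderiv_chain[of "\<lambda>m. gauss_deriv m j", OF gauss_deriv_has_vector_derivative])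
  then have "fourier lam (gauss_deriv 0 j) t = (- 1 / (2 * of_real pi * \<i> * of_real t)) ^ m * ft (gauss_deriv m j) t"
    using False by (simp add: fourier_def Let_def m_def ft_def del: gauss_deriv.simps)
  also have "\<dots> = ft (gauss_deriv 0 j) t"
    using ft_deriv_chain[OF deriv_chain_gauss[of j] False, of m] by (simp del: gauss_deriv.simps)
  finally show ?thesis using ft_gauss[OF assms] by simp
qed

section \<open>The Fourier transform of the flat function\<close>

text \<open>Integrability is read off from the Mellin transform at exponent 1, reached with
  \<open>w = 1 - of_nat m\<close>.\<close>

lemma integrable_flat_deriv:
  assumes "Re a + real m > 1"
  shows "integrable lborel (flat_deriv m a)"
proof -
  have "has_mellin (flat_deriv m a) (1 - of_nat m + of_nat m) ((- 1) ^ m * pochhammer (1 - of_nat m) m * flat_mellin a (1 - of_nat m))"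
    using assms by (intro has_mellin_flat_deriv) auto
  then have "integrable lborel (\<lambda>x. indicator {0<..} x *\<^sub>R (complex_of_real x powr (1 - 1) * flat_deriv m a x))"
    by (simp add: has_mellin_def has_bochner_integral_iff)
  moreover have "(\<lambda>x. indicator {0<..} x *\<^sub>R (complex_of_real x powr (1 - 1) * flat_deriv m a x)) = flat_deriv m a"
    by (auto simp: fun_eq_iff indicator_def flat_deriv_nonpos)
  ultimately show ?thesis by simp
qed

lemma deriv_chain_flat:
  assumes "Re a + real k > 1"
  shows "deriv_chain k (\<lambda>m. flat_deriv m a)"
  unfolding deriv_chain_def
proof (intro conjI allI impI)
  fix m assume m: "k \<le> m"
  show "integrable lborel (flat_deriv m a)"
    using assms m by (intro integrable_flat_deriv) linarith
  from flat_deriv_bound[of 1 a m] assms m obtain C where C: "\<And>x. x > 0 \<Longrightarrow> norm (flat_deriv m a x) \<le> C * x powr (- 1)" by auto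
  have "\<bar>x\<bar> * norm (flat_deriv m a x) \<le> max C 0" for x
  proof (cases "x > 0")
    case True
    then show ?thesis using C[OF True] by (simp add: powr_minus field_simps max_def)
  qed (simp add: flat_deriv_nonpos)
  from tendsto_zero_of_decay[OF this]
  show "(flat_deriv m a \<longlongrightarrow> 0) at_top" "(flat_deriv m a \<longlongrightarrow> 0) at_bot" .
qed (rule flat_deriv_has_vector_derivative)

text \<open>The Fourier transform of \<open>flat a\<close> off the origin, where \<open>Re a + k > 1\<close>; see
  \<open>ft_deriv_chain\<close> for the independence of \<open>k\<close>.\<close>

definition flat_ft :: "nat \<Rightarrow> complex \<Rightarrow> real \<Rightarrow> complex" where
  "flat_ft k a t = (- 1 / (2 * of_real pi * \<i> * of_real t)) ^ k * ft (flat_deriv k a) t"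

lemma ft_measurable [measurable]:
  assumes [measurable]: "f \<in> borel_measurable borel"
  shows "ft f \<in> borel_measurable borel"
  unfolding ft_def by measurable

text \<open>Integrating by parts \<open>K\<close> times in place of \<open>k\<close> gives decay of
  order \<open>K\<close> for each \<open>K \<ge> k\<close>, and \<open>K = k\<close> also controls
  the growth at 0.\<close>

lemma rapid_flat_ft:
  assumes a: "Re a + real k > 1" and \<epsilon>: "\<epsilon> \<in> {1, -1}"
  shows "rapid k (\<lambda>t. flat_ft k a (\<epsilon> * t))"
  unfolding rapid_def
proof (intro conjI allI impI)
  show "(\<lambda>t. flat_ft k a (\<epsilon> * t)) \<in> borel_measurable borel"
    unfolding flat_ft_def by measurable
  fix K assume K: "k \<le> K"
  have "norm (flat_ft k a (\<epsilon> * t)) \<le> (LINT x|lborel. norm (flat_deriv K a x)) / (2 * pi) ^ K / t ^ K" if t: "t > 0" for t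
  proof -
    have "\<epsilon> * t \<noteq> 0" using t \<epsilon> by auto
    from ft_deriv_chain[OF deriv_chain_flat[OF a] this K]
    have "flat_ft k a (\<epsilon> * t) = (- 1 / (2 * of_real pi * \<i> * of_real (\<epsilon> * t))) ^ K * ft (flat_deriv K a) (\<epsilon> * t)"
      unfolding flat_ft_def by simp
    moreover have "norm (- 1 / (2 * of_real pi * \<i> * complex_of_real (\<epsilon> * t))) = 1 / (2 * pi * t)"
      using t \<epsilon> by (auto simp: norm_divide norm_mult)
    ultimately have "norm (flat_ft k a (\<epsilon> * t)) = (1 / (2 * pi * t)) ^ K * norm (ft (flat_deriv K a) (\<epsilon> * t))"
      by (simp only: norm_mult norm_power)
    also have "\<dots> \<le> (1 / (2 * pi * t)) ^ K * (LINT x|lborel. norm (flat_deriv K a x))"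
      using t by (intro mult_left_mono norm_ft_le) auto
    finally show ?thesis by (simp add: power_divide power_mult_distrib mult_ac)
  qed
  then show "\<exists>C. \<forall>t>0. norm (flat_ft k a (\<epsilon> * t)) \<le> C / t ^ K" by blast
qed

text \<open>Uniform in \<open>d\<close>: the argument is at most \<open>pi\<close> in absolute value
  and the modulus at least \<open>\<bar>y\<bar>\<close>. It supplies the dominating function when
  \<open>d\<close> tends to 0 below.\<close>

lemma norm_powr_add_imaginary_le:
  assumes w: "Re w > 0" and y: "y \<noteq> 0" and d: "d > 0"
  shows "norm (Complex d y powr (- w)) \<le> exp (pi * \<bar>Im w\<bar>) * \<bar>y\<bar> powr (- Re w)"
proof -
  define z where "z = Complex d y"
  have z0: "z \<noteq> 0" using d by (auto simp: z_def complex_eq_iff)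
  have "norm (z powr (- w)) = exp (Re (- w * Ln z))" using z0 by (simp add: powr_def)
  also have "Re (- w * Ln z) = Im w * Arg z - Re w * ln (norm z)"
    using z0 by (simp add: Re_Ln Arg_eq_Im_Ln)
  also have "exp \<dots> = exp (Im w * Arg z) * norm z powr (- Re w)"
    using z0 by (simp add: powr_def exp_diff exp_minus field_simps)
  also have "\<dots> \<le> exp (pi * \<bar>Im w\<bar>) * \<bar>y\<bar> powr (- Re w)"
  proof (intro mult_mono)
    have "\<bar>Im w * Arg z\<bar> \<le> \<bar>Im w\<bar> * pi"
      unfolding abs_mult using mpi_less_Arg[of z] Arg_le_pi[of z] by (intro mult_left_mono) auto
    then show "exp (Im w * Arg z) \<le> exp (pi * \<bar>Im w\<bar>)" by (simp add: mult.commute)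
    have "\<bar>y\<bar> \<le> norm z" using abs_Im_le_cmod[of z] by (simp add: z_def)
    then show "norm z powr (- Re w) \<le> \<bar>y\<bar> powr (- Re w)"
      using y w by (intro powr_mono2') auto
  qed auto
  finally show ?thesis by (simp add: z_def)
qed

text \<open>The principal argument of the base is \<open>- \<epsilon> * pi / 2\<close>; this is the
  origin of the phases in \<open>gamma_matrix\<close>.\<close>

lemma imaginary_powr:
  assumes x: "x > 0" and \<epsilon>: "\<epsilon> \<in> {1, -1::real}"
  shows "(- 2 * of_real pi * \<i> * of_real \<epsilon> * of_real x) powr (- w) =
    exp (of_real \<epsilon> * of_real pi * \<i> * w / 2) * of_real (2 * pi) powr (- w) * of_real x powr (- w)"
proof -
  have 1: "- 2 * complex_of_real pi * \<i> * of_real \<epsilon> * of_real x = of_real (2 * pi * x) * (- \<i> * of_real \<epsilon>)"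
    by simp
  have 2: "Ln (- \<i> * of_real \<epsilon>) = - \<i> * of_real pi / 2 * of_real \<epsilon>" using \<epsilon> by auto
  have 3: "Ln (of_real (2 * pi * x) * (- \<i> * of_real \<epsilon>)) = of_real (ln (2 * pi * x)) + Ln (- \<i> * of_real \<epsilon>)"
    using x \<epsilon> by (subst Ln_times_of_real) (auto simp del: of_real_mult simp: Ln_of_real)
  have "(- 2 * of_real pi * \<i> * of_real \<epsilon> * of_real x) powr (- w) =
      exp (- w * (of_real (ln (2 * pi * x)) + - \<i> * of_real pi / 2 * of_real \<epsilon>))"
    unfolding 1 powr_def 3 2 using x \<epsilon> by auto
  also have "of_real (ln (2 * pi * x)) = complex_of_real (ln (2 * pi)) + of_real (ln x)"
    using x by (simp add: ln_mult)
  also have "- w * (of_real (ln (2 * pi)) + of_real (ln x) + - \<i> * of_real pi / 2 * of_real \<epsilon>) =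
      of_real \<epsilon> * of_real pi * \<i> * w / 2 + - w * of_real (ln (2 * pi)) + - w * of_real (ln x)"
    by (simp add: algebra_simps)
  finally show ?thesis
    by (simp only: exp_add of_real_powr_eq_exp[OF x] of_real_powr_eq_exp[of "2 * pi", simplified] mult_minus_left) (simp add: of_real_powr_eq_exp[of "2 * pi", simplified])
qed

text \<open>The factor \<open>exp (- d * t)\<close> makes the double integral absolutely convergent.\<close>

lemma has_mellin_regularized_ft:
  assumes f: "integrable lborel f" and w: "Re w > 0" and d: "d > 0"
  shows "has_mellin (\<lambda>t. of_real (exp (- d * t)) * ft f (\<epsilon> * t)) w
    (Gamma w * (LINT x|lborel. f x * (of_real d - 2 * of_real pi * \<i> * of_real \<epsilon> * of_real x) powr (- w)))"
proof -
  have [measurable]: "f \<in> borel_measurable borel" using f by auto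
  define e where "e x t = exp (2 * complex_of_real pi * \<i> * of_real x * of_real (\<epsilon> * t))" for x t
  have [measurable]: "(\<lambda>(x,t). e x t) \<in> borel_measurable (lborel \<Otimes>\<^sub>M lborel)"
    unfolding e_def by measurable
  define g where "g t = indicator {0<..} t *\<^sub>R (complex_of_real t powr (w - 1) * of_real (exp (- d * t)))" for t
  have [measurable]: "g \<in> borel_measurable borel" unfolding g_def by measurable
  have ne: "norm (e x t) = 1" for x t unfolding e_def by simp
  have gi: "integrable lborel g"
    using has_mellin_exp_complex[OF w, of "of_real d"] d
    by (simp add: has_mellin_def has_bochner_integral_iff g_def[abs_def] exp_of_real[symmetric])
  have prod: "integrable (lborel \<Otimes>\<^sub>M lborel) (\<lambda>(x, t). f x * (g t * e x t))"
  proof (rule lborel_pair.Fubini_integrable)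
    show "(\<lambda>(x, t). f x * (g t * e x t)) \<in> borel_measurable (lborel \<Otimes>\<^sub>M lborel)"
      by measurable
    show "integrable lborel (\<lambda>x. LINT t|lborel. norm (case (x, t) of (x, t) \<Rightarrow> f x * (g t * e x t)))"
      using f by (simp add: norm_mult ne)
    have "integrable lborel (\<lambda>t. f x * (g t * e x t))" for x
      by (rule Bochner_Integration.integrable_bound[OF integrable_mult_right[OF gi, of "f x"]])
         (auto simp: norm_mult ne e_def)
    then show "AE x in lborel. integrable lborel (\<lambda>t. case (x, t) of (x, t) \<Rightarrow> f x * (g t * e x t))" by simp
  qed
  have inner: "(LINT t|lborel. f x * (g t * e x t)) = Gamma w * (f x * (of_real d - 2 * of_real pi * \<i> * of_real \<epsilon> * of_real x) powr (- w))" for x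
  proof -
    define c where "c = complex_of_real d - 2 * of_real pi * \<i> * of_real \<epsilon> * of_real x"
    have "Re c > 0" using d by (simp add: c_def)
    then have "(LINT t|lborel. indicator {0<..} t *\<^sub>R (complex_of_real t powr (w - 1) * exp (- c * of_real t))) = Gamma w * c powr (- w)"
      using has_mellin_exp_complex[OF w, of c] by (simp add: has_mellin_def has_bochner_integral_iff)
    moreover have "indicator {0<..} t *\<^sub>R (complex_of_real t powr (w - 1) * exp (- c * of_real t)) = g t * e x t" for t
    proof -
      have "exp (- c * of_real t) = of_real (exp (- d * t)) * e x t"
      proof -
        have "- c * of_real t = of_real (- d * t) + 2 * complex_of_real pi * \<i> * of_real x * of_real (\<epsilon> * t)"
          by (simp add: c_def algebra_simps)
        then show ?thesis by (simp only: e_def exp_add exp_of_real)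
      qed
      then show ?thesis by (simp add: g_def)
    qed
    ultimately have "(LINT t|lborel. g t * e x t) = Gamma w * c powr (- w)" by simp
    then show ?thesis by (simp add: c_def)
  qed
  have sw: "(LINT x|lborel. f x * (g t * e x t)) = indicator {0<..} t *\<^sub>R (complex_of_real t powr (w - 1) * (of_real (exp (- d * t)) * ft f (\<epsilon> * t)))" for t
  proof -
    have "(\<lambda>x. f x * (g t * e x t)) = (\<lambda>x. g t * (f x * e x t))" by (simp add: mult_ac)
    then show ?thesis by (simp add: g_def ft_def e_def)
  qed
  have "integrable lborel (\<lambda>t. LINT x|lborel. f x * (g t * e x t))"
    using lborel_pair.integrable_snd[OF prod] by simp
  moreover have "(LINT t|lborel. LINT x|lborel. f x * (g t * e x t)) = (LINT x|lborel. LINT t|lborel. f x * (g t * e x t))"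
    using lborel_pair.Fubini_integral[OF prod] by simp
  moreover have "(LINT x|lborel. LINT t|lborel. f x * (g t * e x t)) =
      Gamma w * (LINT x|lborel. f x * (of_real d - 2 * of_real pi * \<i> * of_real \<epsilon> * of_real x) powr (- w))"
    unfolding inner by simp
  ultimately show ?thesis unfolding sw has_mellin_def has_bochner_integral_iff by simp
qed

text \<open>Formally, interchanging the integrals gives \<open>Gamma s\<close> times the Mellin
  transform of \<open>flat a\<close> at \<open>1 - s\<close>, with the phase of
  \<open>(- 2 * pi * \<i> * \<epsilon> * x) powr (- s)\<close>. This is carried out for the
  \<open>k\<close>-th derivative at \<open>w = s - k\<close>, and the regularising factor is removed
  in a limit.\<close>

lemma mellin_flat_ft:
  assumes a: "Re a + real k > 1" and \<epsilon>: "\<epsilon> \<in> {1, -1}" and s: "Re s > real k"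
  shows "mellin_integral 1 (\<lambda>t. flat_ft k a (\<epsilon> * t)) s =
    of_real (2 * pi) powr (- s) * Gamma s * exp (of_real \<epsilon> * of_real pi * \<i> * s / 2) * flat_mellin a (1 - s)"
proof -
  define f where "f = flat_deriv k a"
  define w where "w = s - of_nat k"
  have w: "Re w > 0" using s by (simp add: w_def)
  have f: "integrable lborel f" using integrable_flat_deriv[OF a] by (simp add: f_def)
  have [measurable]: "f \<in> borel_measurable borel" by (simp add: f_def)
  define c where "c = - 1 / (2 * of_real pi * \<i> * complex_of_real \<epsilon>)"
  have c0: "c \<noteq> 0" using \<epsilon> by (auto simp: c_def)
  have flat_ft: "flat_ft k a (\<epsilon> * t) = c ^ k * (of_real t powr (- of_nat k) * ft f (\<epsilon> * t))" if "t > 0" for t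
  proof -
    have "- 1 / (2 * of_real pi * \<i> * complex_of_real (\<epsilon> * t)) = c / of_real t" by (simp add: c_def)
    moreover have "complex_of_real t powr (- of_nat k) = 1 / of_real t ^ k"
      using that by (simp add: powr_minus powr_nat' divide_inverse)
    ultimately show ?thesis by (simp add: flat_ft_def f_def power_divide)
  qed
  define M where "M = mellin_integral 1 (\<lambda>t. flat_ft k a (\<epsilon> * t)) s"
  have "has_mellin (\<lambda>t. flat_ft k a (\<epsilon> * t)) s M"
    unfolding M_def by (rule has_mellin_rapid[OF rapid_flat_ft[OF a \<epsilon>] s])
  then have "has_mellin (\<lambda>t. c ^ k * (of_real t powr (- of_nat k) * ft f (\<epsilon> * t))) s M"
    by (subst has_mellin_cong[of _ "\<lambda>t. flat_ft k a (\<epsilon> * t)"]) (auto simp: flat_ft)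
  from has_mellin_cmult[OF this, of "1 / c ^ k"] c0
  have "has_mellin (\<lambda>t. of_real t powr (- of_nat k) * ft f (\<epsilon> * t)) s (M / c ^ k)" by simp
  then have "has_mellin (\<lambda>t. of_real t powr of_nat k * (of_real t powr (- of_nat k) * ft f (\<epsilon> * t))) w (M / c ^ k)"
    by (rule has_mellin_powr_times[where s = w and a = "of_nat k", unfolded w_def diff_add_cancel, folded w_def])
  then have L: "has_mellin (\<lambda>t. ft f (\<epsilon> * t)) w (M / c ^ k)"
    by (subst has_mellin_cong[of _ "\<lambda>t. of_real t powr of_nat k * (of_real t powr (- of_nat k) * ft f (\<epsilon> * t))"])
       (auto simp: powr_minus)
  \<comment> \<open>A positive null sequence: the regularised identity is evaluated at
    \<open>d n\<close>, and both sides converge by dominated convergence.\<close>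
  define d where "d n = 1 / real (Suc n)" for n
  have d: "d n > 0" for n by (simp add: d_def)
  have d0: "d \<longlonglongrightarrow> 0" unfolding d_def using LIMSEQ_inverse_real_of_nat by (simp add: inverse_eq_divide)
  define J where "J n = (LINT x|lborel. f x * (of_real (d n) - 2 * of_real pi * \<i> * of_real \<epsilon> * of_real x) powr (- w))" for n
  have "(\<lambda>n. LINT t|lborel. indicator {0<..} t *\<^sub>R (complex_of_real t powr (w - 1) * (of_real (exp (- d n * t)) * ft f (\<epsilon> * t))))
      \<longlonglongrightarrow> (LINT t|lborel. indicator {0<..} t *\<^sub>R (complex_of_real t powr (w - 1) * ft f (\<epsilon> * t)))"
  proof (rule integral_dominated_convergence)
    show "integrable lborel (\<lambda>t. norm (indicator {0<..} t *\<^sub>R (complex_of_real t powr (w - 1) * ft f (\<epsilon> * t))))"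
      using L by (intro integrable_norm) (simp add: has_mellin_def has_bochner_integral_iff)
    show "AE t in lborel. norm (indicator {0<..} t *\<^sub>R (complex_of_real t powr (w - 1) * (of_real (exp (- d n * t)) * ft f (\<epsilon> * t))))
        \<le> norm (indicator {0<..} t *\<^sub>R (complex_of_real t powr (w - 1) * ft f (\<epsilon> * t)))" for n
      using d[of n] by (intro AE_I2) (auto simp: indicator_def norm_mult intro!: mult_left_mono mult_left_le_one_le)
    show "AE t in lborel. (\<lambda>n. indicator {0<..} t *\<^sub>R (complex_of_real t powr (w - 1) * (of_real (exp (- d n * t)) * ft f (\<epsilon> * t))))
        \<longlonglongrightarrow> indicator {0<..} t *\<^sub>R (complex_of_real t powr (w - 1) * ft f (\<epsilon> * t))"
    proof (rule AE_I2)
      fix t :: real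
      have "(\<lambda>n. complex_of_real (exp (- d n * t))) \<longlonglongrightarrow> of_real (exp (- 0 * t))"
        by (intro tendsto_intros d0)
      then have "(\<lambda>n. complex_of_real (exp (- d n * t))) \<longlonglongrightarrow> 1" by simp
      then have "(\<lambda>n. indicator {0<..} t *\<^sub>R (complex_of_real t powr (w - 1) * (of_real (exp (- d n * t)) * ft f (\<epsilon> * t))))
        \<longlonglongrightarrow> indicator {0<..} t *\<^sub>R (complex_of_real t powr (w - 1) * (1 * ft f (\<epsilon> * t)))"
        by (intro tendsto_scaleR tendsto_mult tendsto_const)
      then show "(\<lambda>n. indicator {0<..} t *\<^sub>R (complex_of_real t powr (w - 1) * (of_real (exp (- d n * t)) * ft f (\<epsilon> * t))))
        \<longlonglongrightarrow> indicator {0<..} t *\<^sub>R (complex_of_real t powr (w - 1) * ft f (\<epsilon> * t))" by simp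
    qed
  qed measurable
  moreover have "(LINT t|lborel. indicator {0<..} t *\<^sub>R (complex_of_real t powr (w - 1) * (of_real (exp (- d n * t)) * ft f (\<epsilon> * t)))) = Gamma w * J n" for n
    using has_mellin_regularized_ft[OF f w d[of n], of \<epsilon>] by (simp add: has_mellin_def has_bochner_integral_iff J_def)
  ultimately have lim1: "(\<lambda>n. Gamma w * J n) \<longlonglongrightarrow> M / c ^ k"
    using L by (simp add: has_mellin_def has_bochner_integral_iff)
  define P where "P = (- 1) ^ k * pochhammer (1 - s) k * flat_mellin a (1 - s)"
  have "has_mellin f ((1 - s) + of_nat k) P"
    unfolding P_def f_def using a s by (intro has_mellin_flat_deriv) simp
  then have P: "has_mellin f (1 - w) P" by (simp add: w_def algebra_simps)
  have eqx: "indicator {0<..} x *\<^sub>R (complex_of_real x powr (1 - w - 1) * f x) = f x * of_real x powr (- w)" for x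
    using flat_deriv_nonpos[of x k a] by (auto simp: indicator_def f_def)
  have fP: "has_bochner_integral lborel (\<lambda>x. f x * of_real x powr (- w)) P"
    using P unfolding has_mellin_def eqx .
  define q where "q = exp (of_real \<epsilon> * of_real pi * \<i> * w / 2) * of_real (2 * pi) powr (- w)"
  have "J \<longlonglongrightarrow> (LINT x|lborel. q * (f x * of_real x powr (- w)))"
    unfolding J_def
  proof (rule integral_dominated_convergence)
    show "integrable lborel (\<lambda>x. exp (pi * \<bar>Im w\<bar>) * (2 * pi) powr (- Re w) * norm (f x * of_real x powr (- w)))"
      using fP by (intro integrable_mult_right integrable_norm) (simp add: has_bochner_integral_iff)
    show "AE x in lborel. norm (f x * (of_real (d n) - 2 * of_real pi * \<i> * of_real \<epsilon> * of_real x) powr (- w)) \<le>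
        exp (pi * \<bar>Im w\<bar>) * (2 * pi) powr (- Re w) * norm (f x * of_real x powr (- w))" for n
    proof (rule AE_I2)
      fix x :: real
      show "norm (f x * (of_real (d n) - 2 * of_real pi * \<i> * of_real \<epsilon> * of_real x) powr (- w)) \<le>
        exp (pi * \<bar>Im w\<bar>) * (2 * pi) powr (- Re w) * norm (f x * of_real x powr (- w))"
      proof (cases "x > 0")
        case True
        have z: "of_real (d n) - 2 * of_real pi * \<i> * of_real \<epsilon> * of_real x = Complex (d n) (- 2 * pi * \<epsilon> * x)"
          by (simp add: complex_eq_iff)
        have "norm (Complex (d n) (- 2 * pi * \<epsilon> * x) powr (- w)) \<le> exp (pi * \<bar>Im w\<bar>) * \<bar>- 2 * pi * \<epsilon> * x\<bar> powr (- Re w)"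
          using True \<epsilon> by (intro norm_powr_add_imaginary_le w d) auto
        also have "\<bar>- 2 * pi * \<epsilon> * x\<bar> = 2 * pi * x" using True \<epsilon> by (auto simp: abs_mult)
        also have "(2 * pi * x) powr (- Re w) = (2 * pi) powr (- Re w) * norm (complex_of_real x powr (- w))"
          using True by (simp add: powr_mult norm_of_real_powr)
        finally show ?thesis unfolding z norm_mult
          using mult_left_mono[OF _ norm_ge_zero[of "f x"]] by (fastforce simp: mult_ac)
      qed (simp add: f_def flat_deriv_nonpos)
    qed
    show "AE x in lborel. (\<lambda>n. f x * (of_real (d n) - 2 * of_real pi * \<i> * of_real \<epsilon> * of_real x) powr (- w))
        \<longlonglongrightarrow> q * (f x * of_real x powr (- w))"
    proof (rule AE_I2)
      fix x :: real
      show "(\<lambda>n. f x * (of_real (d n) - 2 * of_real pi * \<i> * of_real \<epsilon> * of_real x) powr (- w))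
        \<longlonglongrightarrow> q * (f x * of_real x powr (- w))"
      proof (cases "x > 0")
        case True
        have "(\<lambda>n. f x * (of_real (d n) - 2 * of_real pi * \<i> * of_real \<epsilon> * of_real x) powr (- w))
          \<longlonglongrightarrow> f x * (of_real 0 - 2 * of_real pi * \<i> * of_real \<epsilon> * of_real x) powr (- w)"
          using True \<epsilon> by (intro tendsto_intros d0) (auto simp: complex_nonpos_Reals_iff)
        then show ?thesis using imaginary_powr[OF True \<epsilon>, of w] by (simp add: q_def mult_ac)
      qed (simp add: f_def flat_deriv_nonpos)
    qed
    have "(\<lambda>x. (of_real (d n) - 2 * of_real pi * \<i> * of_real \<epsilon> * complex_of_real x) powr (- w)) \<in> borel_measurable borel" for n
      using d[of n] by (intro borel_measurable_continuous_onI continuous_intros)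
        (auto simp: complex_nonpos_Reals_iff dest!: arg_cong[where f = Re])
    then show "(\<lambda>x. f x * (of_real (d n) - 2 * of_real pi * \<i> * of_real \<epsilon> * of_real x) powr (- w)) \<in> borel_measurable lborel" for n
      by measurable
  qed measurable
  then have "(\<lambda>n. Gamma w * J n) \<longlonglongrightarrow> Gamma w * (q * P)"
    using fP by (intro tendsto_mult tendsto_const) (simp add: has_bochner_integral_iff)
  from LIMSEQ_unique[OF lim1 this] have "M = c ^ k * (Gamma w * (q * P))" using c0 by (simp add: field_simps)
  \<comment> \<open>The Pochhammer symbol produced by the \<open>k\<close> derivatives turns
    \<open>Gamma w\<close> into \<open>Gamma s\<close>, and \<open>c ^ k\<close> turns the phase and
    the power of \<open>2 * pi\<close> at \<open>w\<close> into those at \<open>s\<close>.\<close>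
  moreover have "Gamma s = pochhammer w k * Gamma w"
  proof -
    have "w \<notin> \<int>\<^sub>\<le>\<^sub>0" using w by (auto elim!: nonpos_Ints_cases)
    from pochhammer_Gamma[OF this, of k] show ?thesis
      using Gamma_eq_zero_iff[of w] \<open>w \<notin> \<int>\<^sub>\<le>\<^sub>0\<close> by (simp add: w_def)
  qed
  moreover have "(- 1) ^ k * pochhammer (1 - s) k = pochhammer w k"
    using pochhammer_minus'[of "s - 1" k] by (simp add: w_def)
  moreover have "c ^ k * q = of_real (2 * pi) powr (- s) * exp (of_real \<epsilon> * of_real pi * \<i> * s / 2)"
  proof -
    have "complex_of_real (2 * pi) powr (- w) = of_real (2 * pi) powr (- s) * of_real (2 * pi) ^ k"
      by (simp add: w_def powr_diff powr_minus powr_nat' divide_inverse del: of_real_mult)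
    moreover have "exp (of_real \<epsilon> * of_real pi * \<i> * w / 2) = exp (of_real \<epsilon> * of_real pi * \<i> * s / 2) * (- \<i> * of_real \<epsilon>) ^ k"
    proof -
      have "exp (of_real \<epsilon> * of_real pi * \<i> * w / 2) = exp (of_real \<epsilon> * of_real pi * \<i> * s / 2 + of_nat k * (- of_real \<epsilon> * of_real pi * \<i> / 2))"
        by (simp add: w_def field_simps)
      also have "\<dots> = exp (of_real \<epsilon> * of_real pi * \<i> * s / 2) * exp (- of_real \<epsilon> * of_real pi * \<i> / 2) ^ k"
        by (simp only: exp_add exp_of_nat_mult)
      also have "exp (- of_real \<epsilon> * of_real pi * \<i> / 2) = - \<i> * of_real \<epsilon>"
        using \<epsilon> by (auto simp: exp_eq_polar cis_conv_exp[symmetric] mult_ac exp_minus)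
      finally show ?thesis .
    qed
    moreover have "c ^ k * of_real (2 * pi) ^ k * (- \<i> * of_real \<epsilon>) ^ k = 1"
    proof -
      have "c * of_real (2 * pi) * (- \<i> * of_real \<epsilon>) = 1" using \<epsilon> by (auto simp: c_def)
      then show ?thesis unfolding power_mult_distrib[symmetric] by simp
    qed
    ultimately show ?thesis by (simp add: q_def mult_ac)
  qed
  ultimately show ?thesis unfolding M_def P_def by (simp add: mult_ac)
qed

section \<open>The summation formula for Gaussians and their twists\<close>

text \<open>For \<open>m = 0\<close> this is the twist of \<open>gauss_deriv 0 j\<close>.\<close>

definition gauss_twist :: "complex \<Rightarrow> int \<Rightarrow> nat \<Rightarrow> nat \<Rightarrow> real \<Rightarrow> complex" where
  "gauss_twist lam l j m x = (- 1) ^ j * flat_deriv m (2 * lam + of_nat j) x +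
     \<i> powi l * (- 1) ^ m * flat_deriv m (2 * lam + of_nat j) (- x)"

lemma gauss_twist_has_vector_derivative:
  "(gauss_twist lam l j m has_vector_derivative gauss_twist lam l j (Suc m) x) (at x)"
proof -
  have "((\<lambda>x. - x) has_vector_derivative - 1) (at x)" by (auto intro!: derivative_eq_intros)
  from vector_diff_chain_at[OF this flat_deriv_has_vector_derivative]
  have "((\<lambda>x. flat_deriv m (2 * lam + of_nat j) (- x)) has_vector_derivative
     - flat_deriv (Suc m) (2 * lam + of_nat j) (- x)) (at x)" by (simp add: o_def del: flat_deriv.simps)
  then have "((\<lambda>x. (- 1) ^ j * flat_deriv m (2 * lam + of_nat j) x +
      \<i> powi l * (- 1) ^ m * flat_deriv m (2 * lam + of_nat j) (- x)) has_vector_derivative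
      (- 1) ^ j * flat_deriv (Suc m) (2 * lam + of_nat j) x +
      \<i> powi l * (- 1) ^ m * - flat_deriv (Suc m) (2 * lam + of_nat j) (- x)) (at x)"
    by (intro has_vector_derivative_add has_vector_derivative_mult_right flat_deriv_has_vector_derivative)
  then show ?thesis by (simp add: gauss_twist_def[abs_def] del: flat_deriv.simps)
qed

lemma nicely_meromorphic_flat_mellin:
  assumes "c \<noteq> 0"
  shows "(\<lambda>w. c * flat_mellin a w) nicely_meromorphic_on UNIV"
proof -
  have "(\<lambda>w. (c / 2 * of_real pi powr (- ((a - w) / 2))) * Gamma ((- 1 / 2) * w + a / 2)) nicely_meromorphic_on UNIV"
    using assms by (intro nicely_meromorphic_mult_entire nicely_meromorphic_Gamma_affine) (auto intro!: holomorphic_intros)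
  moreover have "(\<lambda>w. (c / 2 * of_real pi powr (- ((a - w) / 2))) * Gamma ((- 1 / 2) * w + a / 2)) = (\<lambda>w. c * flat_mellin a w)"
    by (simp add: fun_eq_iff flat_mellin_def diff_divide_distrib)
  ultimately show ?thesis by (simp only:)
qed

text \<open>Each half-line sees only one of the two flat summands, since \<open>flat_deriv\<close>
  vanishes on the nonpositive axis.\<close>

lemma is_local_zeta_gauss_twist:
  "is_local_zeta lam (gauss_twist lam l j) 1 (\<lambda>w. (- 1) ^ j * flat_mellin (2 * lam + of_nat j) w)"
  "is_local_zeta lam (gauss_twist lam l j) (- 1) (\<lambda>w. \<i> powi l * flat_mellin (2 * lam + of_nat j) w)"
proof -
  have *: "has_mellin (flat_deriv m (2 * lam + of_nat j)) (w + of_nat m)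
      ((- 1) ^ m * pochhammer w m * flat_mellin (2 * lam + of_nat j) w)" if "Re w < 2 * Re lam" for m w
    using that by (intro has_mellin_flat_deriv) auto
  show "is_local_zeta lam (gauss_twist lam l j) 1 (\<lambda>w. (- 1) ^ j * flat_mellin (2 * lam + of_nat j) w)"
    unfolding is_local_zeta_def
  proof (intro conjI allI impI nicely_meromorphic_flat_mellin)
    fix m :: nat and w assume w: "- real m < Re w \<and> Re w < 2 * Re lam \<and> pochhammer w m \<noteq> 0"
    then have "has_mellin (\<lambda>x. (- 1) ^ j * flat_deriv m (2 * lam + of_nat j) x) (w + of_nat m)
        ((- 1) ^ j * ((- 1) ^ m * pochhammer w m * flat_mellin (2 * lam + of_nat j) w))"
      by (intro has_mellin_cmult *) auto
    then show "has_mellin (\<lambda>x. gauss_twist lam l j m (of_int 1 * x)) (w + of_nat m)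
        ((- of_int 1) ^ m * pochhammer w m * ((- 1) ^ j * flat_mellin (2 * lam + of_nat j) w))"
      by (subst has_mellin_cong[of _ "\<lambda>x. (- 1) ^ j * flat_deriv m (2 * lam + of_nat j) x"])
         (auto simp: gauss_twist_def flat_deriv_nonpos mult_ac)
  qed simp
  show "is_local_zeta lam (gauss_twist lam l j) (- 1) (\<lambda>w. \<i> powi l * flat_mellin (2 * lam + of_nat j) w)"
    unfolding is_local_zeta_def
  proof (intro conjI allI impI nicely_meromorphic_flat_mellin)
    fix m :: nat and w assume w: "- real m < Re w \<and> Re w < 2 * Re lam \<and> pochhammer w m \<noteq> 0"
    then have "has_mellin (\<lambda>x. \<i> powi l * (- 1) ^ m * flat_deriv m (2 * lam + of_nat j) x) (w + of_nat m)
        (\<i> powi l * (- 1) ^ m * ((- 1) ^ m * pochhammer w m * flat_mellin (2 * lam + of_nat j) w))"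
      by (intro has_mellin_cmult *) auto
    moreover have "\<i> powi l * (- 1) ^ m * ((- 1) ^ m * pochhammer w m * flat_mellin (2 * lam + of_nat j) w) =
        (- of_int (- 1)) ^ m * pochhammer w m * (\<i> powi l * flat_mellin (2 * lam + of_nat j) w)"
    proof -
      have "(- 1) ^ m * (- 1) ^ m = (1::complex)" by (simp flip: power_mult_distrib)
      then show ?thesis by (simp add: mult_ac)
    qed
    ultimately show "has_mellin (\<lambda>x. gauss_twist lam l j m (of_int (- 1) * x)) (w + of_nat m)
        ((- of_int (- 1)) ^ m * pochhammer w m * (\<i> powi l * flat_mellin (2 * lam + of_nat j) w))"
      by (subst has_mellin_cong[of _ "\<lambda>x. \<i> powi l * (- 1) ^ m * flat_deriv m (2 * lam + of_nat j) x"])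
         (auto simp: gauss_twist_def flat_deriv_nonpos)
  qed simp
qed

text \<open>Multiplied by \<open>b 0\<close>, this value becomes the polar term at
  \<open>2 - 2 * lam\<close>; its Gamma factor has argument
  \<open>(2 * lam + j - 1) / 2\<close>.\<close>

lemma fourier_gauss_twist_0:
  "fourier lam (gauss_twist lam l j 0) 0 = ((- 1) ^ j + \<i> powi l) * flat_mellin (2 * lam + of_nat j) 1"
  using local_zeta_scaled[of "gauss_twist lam l j", OF gauss_twist_has_vector_derivative is_local_zeta_gauss_twist(1), of 1 1]
    local_zeta_scaled[of "gauss_twist lam l j", OF gauss_twist_has_vector_derivative is_local_zeta_gauss_twist(2), of 1 1]
  by (simp add: fourier_def algebra_simps)

definition fourier_order :: "complex \<Rightarrow> nat" where
  "fourier_order lam = (LEAST m::nat. Re lam + real m / 2 > 1 / 2)"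

lemma fourier_order: "2 * Re lam + real (fourier_order lam) > 1"
proof -
  obtain n where "1 - 2 * Re lam < real n" using reals_Archimedean2 by blast
  then have "\<exists>m::nat. Re lam + real m / 2 > 1 / 2" by (intro exI[of _ n]) linarith
  from LeastI_ex[OF this] show ?thesis unfolding fourier_order_def by linarith
qed

text \<open>Reflecting \<open>x\<close> moves the second half-line to the transform at
  \<open>- t\<close>; the sign \<open>(- 1) ^ k\<close> of the reflected derivative is absorbed by
  the power of \<open>- 1 / (2 * pi * \<i> * t)\<close>.\<close>

lemma fourier_gauss_twist:
  fixes lam :: complex and j :: nat and l :: int
  defines "a \<equiv> 2 * lam + of_nat j" and "k \<equiv> fourier_order lam"
  assumes t: "t \<noteq> 0"
  shows "fourier lam (gauss_twist lam l j 0) t = (- 1) ^ j * flat_ft k a t + \<i> powi l * flat_ft k a (- t)"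
proof -
  have a: "Re a + real k > 1" using fourier_order[of lam] by (simp add: a_def k_def)
  have f: "integrable lborel (flat_deriv k a)" by (rule integrable_flat_deriv[OF a])
  define e where "e x t = exp (2 * complex_of_real pi * \<i> * of_real x * of_real t)" for x t
  have "nderiv k (gauss_twist lam l j 0) = gauss_twist lam l j k"
    by (rule nderiv_chain[of "gauss_twist lam l j", OF gauss_twist_has_vector_derivative])
  then have "fourier lam (gauss_twist lam l j 0) t = (- 1 / (2 * of_real pi * \<i> * of_real t)) ^ k * ft (gauss_twist lam l j k) t"
    using t by (simp add: fourier_def Let_def k_def fourier_order_def ft_def)
  also have "ft (gauss_twist lam l j k) t = (LINT x|lborel. (- 1) ^ j * (flat_deriv k a x * e x t) +
      \<i> powi l * (- 1) ^ k * (flat_deriv k a (- x) * e x t))"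
    by (simp add: ft_def gauss_twist_def a_def e_def algebra_simps)
  also have "\<dots> = (- 1) ^ j * (LINT x|lborel. flat_deriv k a x * e x t) +
      \<i> powi l * (- 1) ^ k * (LINT x|lborel. flat_deriv k a (- x) * e x t)"
  proof -
    have "integrable lborel (\<lambda>x. flat_deriv k a (- x))"
      using lborel_integrable_real_affine[OF f, of "-1" 0] by simp
    from integrable_ft[OF this, of t] integrable_ft[OF f, of t] show ?thesis
      by (simp add: e_def)
  qed
  also have "(LINT x|lborel. flat_deriv k a (- x) * e x t) = ft (flat_deriv k a) (- t)"
    using lborel_integral_real_affine[of "- 1" "\<lambda>x. flat_deriv k a x * e x (- t)" 0] by (simp add: ft_def e_def)
  also have "(LINT x|lborel. flat_deriv k a x * e x t) = ft (flat_deriv k a) t"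
    by (simp add: ft_def e_def)
  also have "(- 1 / (2 * of_real pi * \<i> * of_real t)) ^ k *
      ((- 1) ^ j * ft (flat_deriv k a) t + \<i> powi l * (- 1) ^ k * ft (flat_deriv k a) (- t)) =
      (- 1) ^ j * flat_ft k a t + \<i> powi l * flat_ft k a (- t)"
  proof -
    have "(- 1 / (2 * of_real pi * \<i> * of_real t)) ^ k * (- 1) ^ k = (- 1 / (2 * of_real pi * \<i> * complex_of_real (- t))) ^ k"
      unfolding power_mult_distrib[symmetric] by simp
    moreover have "X * (A * F + B * S * G) = A * (X * F) + B * ((X * S) * G)" for X A B F S G :: complex
      by (simp add: algebra_simps)
    ultimately show ?thesis unfolding flat_ft_def by (simp only:)
  qed
  finally show ?thesis .
qed

text \<open>The factor 1 and the form \<open>1 / r * x\<close> match the pattern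
  \<open>C * D 0 (k * x)\<close> of the scaling lemmas. The dilation makes the transform a function
  of \<open>r * t\<close>, up to the factor \<open>r\<close>.\<close>

definition gauss_test :: "nat \<Rightarrow> real \<Rightarrow> real \<Rightarrow> complex" where
  "gauss_test j r = (\<lambda>x. 1 * gauss_deriv 0 j (1 / r * x))"

definition twist_test :: "complex \<Rightarrow> int \<Rightarrow> nat \<Rightarrow> real \<Rightarrow> real \<Rightarrow> complex" where
  "twist_test lam l j r = (\<lambda>x. of_real r powr (2 * lam) * gauss_twist lam l j 0 (r * x))"

lemma twist_test_0: "twist_test lam l j r 0 = 0"
  by (simp add: twist_test_def gauss_twist_def flat_def)

lemma gauss_test_0: "gauss_test j r 0 = (if j = 0 then 1 else 0)"
  by (simp add: gauss_test_def)

lemma smooth_gauss_test: "smooth (gauss_test j r)"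
  unfolding gauss_test_def
  by (rule nderiv_scaled_chain(2)[of "\<lambda>m. gauss_deriv m j", OF gauss_deriv_has_vector_derivative])

lemma smooth_twist_test: "smooth (twist_test lam l j r)"
  unfolding twist_test_def
  by (rule nderiv_scaled_chain(2)[of "gauss_twist lam l j", OF gauss_twist_has_vector_derivative])

text \<open>For \<open>x > 0\<close> the point \<open>- 1 / x\<close> is negative and the parity of
  the Gaussian gives \<open>(- 1) ^ j\<close>; for \<open>x < 0\<close> it is positive and
  \<open>sgn_half\<close> gives \<open>\<i> powi l\<close>. These are the two coefficients in
  \<open>gauss_twist\<close>.\<close>

lemma twist_formula_gauss_test:
  assumes r: "r > 0" and x: "x \<noteq> 0"
  shows "twist_formula lam l (gauss_test j r) x = twist_test lam l j r x"
proof -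
  have key: "of_real r powr (2 * lam) * (of_real (r * y) powr (- (2 * lam + of_nat j)) * E) =
      of_real y powr (- 2 * lam) * (of_real (1 / (r * y)) ^ j * E)" if y: "y > 0" for y :: real and E
  proof -
    have "complex_of_real (r * y) powr (- (2 * lam + of_nat j)) =
        of_real (r * y) powr (- (2 * lam)) * of_real (1 / (r * y)) ^ j"
    proof -
      have "complex_of_real (r * y) powr (- (2 * lam) - of_nat j) = of_real (r * y) powr (- (2 * lam)) / of_real (r * y) powr of_nat j"
        by (rule powr_diff)
      then show ?thesis using r y by (simp add: powr_nat' power_divide)
    qed
    moreover have "complex_of_real (r * y) powr (- (2 * lam)) = of_real r powr (- (2 * lam)) * of_real y powr (- (2 * lam))"
      using r y by (simp add: powr_times_real)
    ultimately show ?thesis using r by (simp add: powr_minus)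
  qed
  define E where "E = complex_of_real (exp (- (pi / (r * x)\<^sup>2)))"
  have g: "gauss_test j r (- 1 / x) = of_real ((1 / r * (- 1 / x)) ^ j) * E"
  proof -
    have "pi * (1 / r * (- 1 / x))\<^sup>2 = pi / (r * x)\<^sup>2" by (simp add: power2_eq_square)
    then show ?thesis unfolding gauss_test_def gauss_deriv.simps E_def by (simp only: of_real_mult mult_1)
  qed
  show ?thesis
  proof (cases "x > 0")
    case True
    have "(1 / r * (- 1 / x)) ^ j = (- 1) ^ j * (1 / (r * x)) ^ j"
      unfolding power_mult_distrib[symmetric] by simp
    then have "twist_formula lam l (gauss_test j r) x =
        (- 1) ^ j * (of_real x powr (- 2 * lam) * (of_real (1 / (r * x)) ^ j * E))"
      using True unfolding twist_formula_def g by (simp add: sgn_half_def mult_ac)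
    also have "\<dots> = (- 1) ^ j * (of_real r powr (2 * lam) * (of_real (r * x) powr (- (2 * lam + of_nat j)) * E))"
      unfolding key[OF True, of E] ..
    also have "\<dots> = twist_test lam l j r x"
      using True r mult_pos_pos[OF r True] by (simp add: twist_test_def gauss_twist_def flat_def E_def mult_ac not_less)
    finally show ?thesis .
  next
    case False
    then have y: "- x > 0" using x by simp
    have "(1 / r * (- 1 / x)) = 1 / (r * - x)" by simp
    then have "twist_formula lam l (gauss_test j r) x =
        \<i> powi l * (of_real (- x) powr (- 2 * lam) * (of_real (1 / (r * - x)) ^ j * E))"
      using y unfolding twist_formula_def g by (simp add: sgn_half_def mult_ac)
    also have "\<dots> = \<i> powi l * (of_real r powr (2 * lam) * (of_real (r * - x) powr (- (2 * lam + of_nat j)) * E))"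
      unfolding key[OF y, of E] ..
    also have "\<dots> = twist_test lam l j r x"
    proof -
      have "\<not> r * x > 0" "r * x < 0" using r y by (auto simp: zero_less_mult_iff mult_less_0_iff)
      then show ?thesis by (simp add: twist_test_def gauss_twist_def flat_def E_def mult_ac)
    qed
    finally show ?thesis .
  qed
qed

lemma gauss_test_in_V: "r > 0 \<Longrightarrow> gauss_test j r \<in> V_infty lam l"
  unfolding V_infty_def using smooth_gauss_test smooth_twist_test twist_formula_gauss_test by (auto intro!: exI[of _ "twist_test lam l j r"])

lemma twist_gauss_test:
  assumes r: "r > 0"
  shows "twist lam l (gauss_test j r) = twist_test lam l j r"
proof
  fix x
  show "twist lam l (gauss_test j r) x = twist_test lam l j r x"
  proof (cases "x = 0")
    case True
    have "nderiv 0 (twist_test lam l j r) differentiable (at 0)"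
      using smooth_twist_test unfolding smooth_def by blast
    then have "isCont (twist_test lam l j r) 0"
      by (simp add: nderiv_def differentiable_imp_continuous_within)
    then have "(twist_test lam l j r \<longlongrightarrow> twist_test lam l j r 0) (at 0)" by (simp add: isCont_def)
    then have "(twist_formula lam l (gauss_test j r) \<longlongrightarrow> twist_test lam l j r 0) (at 0)"
      by (rule Lim_transform_eventually) (auto simp: twist_formula_gauss_test[OF r] eventually_at_filter)
    then show ?thesis using True by (simp add: twist_def tendsto_Lim)
  qed (simp add: twist_def twist_formula_gauss_test[OF r])
qed

lemma twist_twist_test:
  assumes r: "r > 0"
  shows "twist lam l (twist_test lam l j r) = (\<lambda>x. \<i> powi l * gauss_deriv 0 j (1 / r * x))"
  using twist_twist[OF gauss_test_in_V[OF r, of j lam l]] unfolding twist_gauss_test[OF r]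
  by (simp add: fun_eq_iff gauss_test_def del: gauss_deriv.simps)

lemma twist_test_in_V:
  assumes r: "r > 0"
  shows "twist_test lam l j r \<in> V_infty lam l"
  unfolding V_infty_def
proof (intro CollectI conjI exI allI impI)
  show "smooth (\<lambda>x. \<i> powi l * gauss_deriv 0 j (1 / r * x))"
    by (rule nderiv_scaled_chain(2)[of "\<lambda>m. gauss_deriv m j", OF gauss_deriv_has_vector_derivative])
  show "\<i> powi l * gauss_deriv 0 j (1 / r * x) = twist_formula lam l (twist_test lam l j r) x" if "x \<noteq> 0" for x
    using that fun_cong[OF twist_twist_test[OF r, of lam l j], of x] by (simp add: twist_def del: gauss_deriv.simps)
qed (rule smooth_twist_test)

lemma fourier_gauss_scaled:
  assumes r: "r > 0" and C: "C \<noteq> 0" and j: "j \<le> 1"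
  shows "fourier lam (\<lambda>x. C * gauss_deriv 0 j (1 / r * x)) t =
    C * of_real r * ((\<i> * of_real (r * t)) ^ j * of_real (exp (- (pi * (r * t)\<^sup>2))))"
  using fourier_scaled[of "\<lambda>m. gauss_deriv m j", OF gauss_deriv_has_vector_derivative
      is_local_zeta_gauss[of 1] is_local_zeta_gauss[of "- 1"] C, of "1 / r" lam t] r fourier_gauss[OF j, of lam "r * t"]
  by (simp add: mult.commute del: gauss_deriv.simps)

lemma fourier_twist_test:
  assumes r: "r > 0"
  shows "fourier lam (twist_test lam l j r) t = of_real r powr (2 * lam - 1) * fourier lam (gauss_twist lam l j 0) (t / r)"
  using fourier_scaled[of "gauss_twist lam l j", OF gauss_twist_has_vector_derivative
      is_local_zeta_gauss_twist, of "of_real r powr (2 * lam)" r t] r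
  by (simp add: twist_test_def powr_diff)

text \<open>The summation formula for the test functions above, with the Dirichlet coefficients \<open>a\<close>
  on the side of the Gaussians.\<close>

definition theta_relation ::
    "complex \<Rightarrow> int \<Rightarrow> nat \<Rightarrow> (int \<Rightarrow> complex) \<Rightarrow> (int \<Rightarrow> complex) \<Rightarrow> complex \<Rightarrow> bool" where
  "theta_relation lam l N a b c \<longleftrightarrow> (\<forall>j\<le>1. \<forall>r>0.
     of_real r * (\<Sum>\<^sub>\<infinity>n. a n * ((\<i> * of_real (r * of_int n)) ^ j * of_real (exp (- (pi * (r * of_int n)\<^sup>2))))) =
     (if j = 0 then c else 0) + of_real r powr (2 * lam - 1) *
       (\<Sum>\<^sub>\<infinity>n. b n * fourier lam (gauss_twist lam l j 0) (of_int n / (r * of_nat N))))"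

text \<open>The first relation is the summation formula for the Gaussian, the second the one for its
  twist, whose own twist is the Gaussian up to \<open>\<i> powi l\<close>. Dividing by the constants
  that appear attaches them to \<open>\<alpha>\<close>.\<close>

lemma theta_relations:
  assumes N: "N > 0"
    and summation: "\<And>f. f \<in> V_infty lam l \<Longrightarrow>
      \<alpha>_inf * at_inf lam l f + (\<Sum>\<^sub>\<infinity>n. \<alpha> n * fourier lam f (of_int n)) =
      \<beta>_inf * at_inf lam l (twist lam l f) +
        (\<Sum>\<^sub>\<infinity>n. \<beta> n * fourier lam (twist lam l f) (of_int n / of_nat N))"
  shows "theta_relation lam l N \<alpha> \<beta> (\<i> powi l * \<beta>_inf)"
    and "theta_relation lam l N \<beta> (\<lambda>n. \<i> powi (- l) * of_nat N powr (2 * lam - 2) * \<alpha> n) (\<alpha>_inf / of_nat N)"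
proof -
  \<comment> \<open>The twist of the Gaussian vanishes at 0, so \<open>\<alpha>_inf\<close> drops
    out of the first relation; for the same reason \<open>\<beta>_inf\<close> drops out of the
    second.\<close>
  have ai: "at_inf lam l (gauss_test j r) = 0" if "r > 0" for j r
    using that by (simp add: at_inf_def twist_gauss_test twist_test_0)
  have ai2: "at_inf lam l (twist_test lam l j r) = \<i> powi l * (if j = 0 then 1 else 0)" if "r > 0" for j r
    using at_inf_twist[OF gauss_test_in_V[OF that, of j lam l]] that by (simp add: twist_gauss_test gauss_test_0)
  have ai3: "at_inf lam l (twist lam l (twist_test lam l j r)) = 0" if "r > 0" for j r
    using at_inf_twist[OF twist_test_in_V[OF that, of lam l j]] by (simp add: twist_test_0)
  show "theta_relation lam l N \<alpha> \<beta> (\<i> powi l * \<beta>_inf)"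
    unfolding theta_relation_def
  proof (intro allI impI)
    fix j :: nat and r :: real assume j: "j \<le> 1" and r: "r > 0"
    have 1: "(\<lambda>n. \<alpha> n * fourier lam (gauss_test j r) (of_int n)) = (\<lambda>n. of_real r *
        (\<alpha> n * ((\<i> * of_real (r * of_int n)) ^ j * of_real (exp (- (pi * (r * of_int n)\<^sup>2))))))"
      unfolding gauss_test_def by (subst fourier_gauss_scaled[OF r _ j]) (simp_all add: mult_ac)
    have 2: "(\<lambda>n. \<beta> n * fourier lam (twist_test lam l j r) (of_int n / of_nat N)) =
        (\<lambda>n. of_real r powr (2 * lam - 1) * (\<beta> n * fourier lam (gauss_twist lam l j 0) (of_int n / (r * of_nat N))))"
      by (subst fourier_twist_test[OF r]) (simp add: mult_ac)
    show "of_real r * (\<Sum>\<^sub>\<infinity>n. \<alpha> n * ((\<i> * of_real (r * of_int n)) ^ j * of_real (exp (- (pi * (r * of_int n)\<^sup>2))))) =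
     (if j = 0 then \<i> powi l * \<beta>_inf else 0) + of_real r powr (2 * lam - 1) *
       (\<Sum>\<^sub>\<infinity>n. \<beta> n * fourier lam (gauss_twist lam l j 0) (of_int n / (r * of_nat N)))"
      using summation[OF gauss_test_in_V[OF r, of j lam l]]
      unfolding twist_gauss_test[OF r] ai[OF r] ai2[OF r] 1 2 infsum_cmult_right'
      by (simp add: mult.commute)
  qed
  show "theta_relation lam l N \<beta> (\<lambda>n. \<i> powi (- l) * of_nat N powr (2 * lam - 2) * \<alpha> n) (\<alpha>_inf / of_nat N)"
    unfolding theta_relation_def
  proof (intro allI impI)
    fix j :: nat and r :: real assume j: "j \<le> 1" and r: "r > 0"
    \<comment> \<open>In the formula \<open>\<beta> n\<close> is paired with the transform at
      \<open>n / N\<close>; dilating by \<open>N * r\<close> turns this into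
      \<open>r * n\<close>.\<close>
    define R where "R = real N * r"
    have R: "R > 0" using N r by (simp add: R_def)
    define S where "S = (\<Sum>\<^sub>\<infinity>n. \<beta> n * ((\<i> * of_real (r * of_int n)) ^ j * of_real (exp (- (pi * (r * of_int n)\<^sup>2)))))"
    define T where "T = (\<Sum>\<^sub>\<infinity>n. \<alpha> n * fourier lam (gauss_twist lam l j 0) (of_int n / (r * of_nat N)))"
    have Rn: "R * (real_of_int n / real N) = r * of_int n" for n using N by (simp add: R_def)
    have 1: "(\<lambda>n. \<beta> n * fourier lam (\<lambda>x. \<i> powi l * gauss_deriv 0 j (1 / R * x)) (of_int n / of_nat N)) =
        (\<lambda>n. (\<i> powi l * of_real R) * (\<beta> n * ((\<i> * of_real (r * of_int n)) ^ j * of_real (exp (- (pi * (r * of_int n)\<^sup>2))))))"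
      by (subst fourier_gauss_scaled[OF R _ j]) (simp_all only: Rn, simp_all add: mult_ac)
    have 2: "(\<lambda>n. \<alpha> n * fourier lam (twist_test lam l j R) (of_int n)) =
        (\<lambda>n. of_real R powr (2 * lam - 1) * (\<alpha> n * fourier lam (gauss_twist lam l j 0) (of_int n / (r * of_nat N))))"
      by (subst fourier_twist_test[OF R]) (simp add: mult_ac R_def)
    have eq: "\<alpha>_inf * (\<i> powi l * (if j = 0 then 1 else 0)) + of_real R powr (2 * lam - 1) * T = \<i> powi l * of_real R * S"
      using summation[OF twist_test_in_V[OF R, of lam l j]]
      unfolding twist_twist_test[OF R, symmetric] ai3[OF R] ai2[OF R] S_def T_def
      unfolding twist_twist_test[OF R] 1 2 infsum_cmult_right' by simp
    have il: "\<i> powi (- l) * \<i> powi l = 1" by (simp flip: power_int_add)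
    have Rp: "of_real R powr (2 * lam - 1) = of_nat N * (of_nat N powr (2 * lam - 2) * complex_of_real r powr (2 * lam - 1))"
    proof -
      have "complex_of_real R powr (2 * lam - 1) = of_nat N powr (2 * lam - 1) * of_real r powr (2 * lam - 1)"
        using r unfolding R_def by (simp add: powr_times_real)
      moreover have "complex_of_nat N powr (1 + (2 * lam - 2)) = of_nat N * of_nat N powr (2 * lam - 2)"
        using N by (subst powr_add) simp
      ultimately show ?thesis by (simp add: algebra_simps)
    qed
    have "of_nat N * (of_real r * S) = of_real R * S" by (simp add: R_def)
    also have "\<dots> = \<i> powi (- l) * (\<i> powi l * of_real R * S)" by (simp only: mult.assoc[symmetric] il mult_1)
    also have "\<dots> = \<i> powi (- l) * \<i> powi l * (\<alpha>_inf * (if j = 0 then 1 else 0)) + \<i> powi (- l) * of_real R powr (2 * lam - 1) * T"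
      unfolding eq[symmetric] by (simp add: algebra_simps)
    also have "\<dots> = of_nat N * ((if j = 0 then \<alpha>_inf / of_nat N else 0) +
        of_real r powr (2 * lam - 1) * (\<i> powi (- l) * of_nat N powr (2 * lam - 2) * T))"
      unfolding il Rp using N by (simp add: algebra_simps)
    finally have "of_real r * S = (if j = 0 then \<alpha>_inf / of_nat N else 0) +
        of_real r powr (2 * lam - 1) * (\<i> powi (- l) * of_nat N powr (2 * lam - 2) * T)"
      using N by (subst (asm) mult_cancel_left) auto
    then show "of_real r * (\<Sum>\<^sub>\<infinity>n. \<beta> n * ((\<i> * of_real (r * of_int n)) ^ j * of_real (exp (- (pi * (r * of_int n)\<^sup>2))))) =
     (if j = 0 then \<alpha>_inf / of_nat N else 0) + of_real r powr (2 * lam - 1) *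
       (\<Sum>\<^sub>\<infinity>n. \<i> powi (- l) * of_nat N powr (2 * lam - 2) * \<alpha> n * fourier lam (gauss_twist lam l j 0) (of_int n / (r * of_nat N)))"
      unfolding S_def T_def by (simp only: mult.assoc infsum_cmult_right')
  qed
qed

section \<open>Splitting the Mellin integral\<close>

lemma infsum_int_split:
  fixes f :: "int \<Rightarrow> complex"
  assumes "summable (\<lambda>n. norm (f (int (Suc n))))" "summable (\<lambda>n. norm (f (- int (Suc n))))"
  shows "(\<Sum>\<^sub>\<infinity>n. f n) = f 0 + (\<Sum>n. f (int (Suc n))) + (\<Sum>n. f (- int (Suc n)))"
proof -
  have "((\<lambda>n. f (int (Suc n))) has_sum (\<Sum>n. f (int (Suc n)))) UNIV"
    by (rule norm_summable_imp_has_sum[OF assms(1)]) (rule summable_sums[OF summable_norm_cancel[OF assms(1)]])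
  then have 1: "(f has_sum (\<Sum>n. f (int (Suc n)))) (range (\<lambda>n. int (Suc n)))"
    by (subst has_sum_reindex) (auto simp: inj_on_def o_def)
  have "((\<lambda>n. f (- int (Suc n))) has_sum (\<Sum>n. f (- int (Suc n)))) UNIV"
    by (rule norm_summable_imp_has_sum[OF assms(2)]) (rule summable_sums[OF summable_norm_cancel[OF assms(2)]])
  then have 2: "(f has_sum (\<Sum>n. f (- int (Suc n)))) (range (\<lambda>n. - int (Suc n)))"
    by (subst has_sum_reindex) (auto simp: inj_on_def o_def)
  have 0: "(f has_sum f 0) {0}" using has_sum_finite[of "{0}" f] by simp
  have "(f has_sum (f 0 + (\<Sum>n. f (int (Suc n))) + (\<Sum>n. f (- int (Suc n)))))
     ({0} \<union> range (\<lambda>n. int (Suc n)) \<union> range (\<lambda>n. - int (Suc n)))"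
    by (intro has_sum_Un_disjoint 0 1 2) auto
  moreover have "{0} \<union> range (\<lambda>n. int (Suc n)) \<union> range (\<lambda>n. - int (Suc n)) = UNIV"
  proof -
    have "x \<in> {0} \<union> range (\<lambda>n. int (Suc n)) \<union> range (\<lambda>n. - int (Suc n))" for x :: int
    proof -
      consider "x = 0" | "x > 0" | "x < 0" by linarith
      then show ?thesis
      proof cases
        case 2
        then have "x = int (Suc (nat x - 1))" by simp
        then show ?thesis by blast
      next
        case 3
        then have "x = - int (Suc (nat (- x) - 1))" by simp
        then show ?thesis by blast
      qed simp
    qed
    then show ?thesis by blast
  qed
  ultimately show ?thesis by (simp add: infsumI)
qed

text \<open>The cut at 1 is strict on both sides, so the pieces of a split function add up only off
  the point 1.\<close>

lemma has_mellin_cong_off_one: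
  assumes [measurable]: "f \<in> borel_measurable borel" "g \<in> borel_measurable borel"
    and "\<And>x. x > 0 \<Longrightarrow> x \<noteq> 1 \<Longrightarrow> f x = g x"
  shows "has_mellin f s v \<longleftrightarrow> has_mellin g s v"
  unfolding has_mellin_def
proof (rule has_bochner_integral_cong_AE)
  show "AE x in lborel. indicator {0<..} x *\<^sub>R (complex_of_real x powr (s - 1) * f x) =
      indicator {0<..} x *\<^sub>R (complex_of_real x powr (s - 1) * g x)"
    using AE_lborel_singleton[of 1] by eventually_elim (auto simp: indicator_def assms(3))
qed measurable

definition upper :: "(real \<Rightarrow> complex) \<Rightarrow> real \<Rightarrow> complex" where
  "upper f x = indicator {1<..} x * f x"

lemma upper_measurable [measurable]: "f \<in> borel_measurable borel \<Longrightarrow> upper f \<in> borel_measurable borel"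
  unfolding upper_def by measurable

text \<open>The cut removes the behaviour at 0, hence convergence for every
  \<open>s\<close>.\<close>

lemma has_mellin_upper:
  assumes f: "rapid k f"
  shows "has_mellin (upper f) s (mellin_integral 1 (upper f) s)"
proof -
  define K where "K = max k (nat \<lceil>Re s\<rceil> + 1)"
  have K: "K \<ge> k" "real K > Re s" unfolding K_def by linarith+
  from rapidE[OF f K(1)] obtain D where D: "\<And>x. x > 0 \<Longrightarrow> norm (f x) \<le> D / x ^ K" by metis
  show ?thesis
    by (rule has_mellin_of_bounds[OF upper_measurable[OF rapid_measurable[OF f]], of 0 "Re s - 1" D "real K"])
       (use D K in \<open>auto simp: upper_def powr_minus powr_realpow divide_inverse\<close>)
qed

text \<open>For \<open>x > 1\<close> the modulus of the kernel grows with \<open>Re s\<close> and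
  ignores \<open>Im s\<close>, so one bound holds on a whole left half-plane. This is the control
  used in vertical strips.\<close>

lemma mellin_upper_bounded:
  assumes f: "rapid k f"
  shows "\<exists>C. \<forall>s. Re s \<le> \<sigma> \<longrightarrow> norm (mellin_integral 1 (upper f) s) \<le> C"
    and "(\<lambda>s. mellin_integral 1 (upper f) s) holomorphic_on UNIV"
proof -
  note [measurable] = rapid_measurable[OF f]
  define g where "g s x = indicator {0<..} x *\<^sub>R (complex_of_real x powr (s - 1) * upper f x)" for s x
  have [measurable]: "g s \<in> borel_measurable borel" for s unfolding g_def by measurable
  have int: "integrable lborel (g s)" for s
    using has_mellin_upper[OF f, of s] unfolding has_mellin_def has_bochner_integral_iff g_def[abs_def] by simp
  have eq: "mellin_integral 1 (upper f) s = (LINT x|lborel. g s x)" for s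
    by (simp add: mellin_integral_def set_lebesgue_integral_def g_def)
  have le: "norm (g s x) \<le> norm (g (of_real \<sigma>) x)" if "Re s \<le> \<sigma>" for s \<sigma> x
  proof (cases "x > 1")
    case True
    then have "x powr (Re s - 1) \<le> x powr (\<sigma> - 1)" using that by (intro powr_mono) auto
    then show ?thesis using True by (auto simp: g_def upper_def norm_mult norm_of_real_powr intro!: mult_right_mono)
  qed (simp add: g_def upper_def)
  show "\<exists>C. \<forall>s. Re s \<le> \<sigma> \<longrightarrow> norm (mellin_integral 1 (upper f) s) \<le> C"
  proof (intro exI allI impI)
    fix s assume s: "Re s \<le> \<sigma>"
    have "norm (LINT x|lborel. g s x) \<le> (LINT x|lborel. norm (g s x))" by (rule integral_norm_bound)
    also have "\<dots> \<le> (LINT x|lborel. norm (g (of_real \<sigma>) x))"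
      by (intro integral_mono integrable_norm int le[OF s])
    finally show "norm (mellin_integral 1 (upper f) s) \<le> (LINT x|lborel. norm (g (of_real \<sigma>) x))"
      by (simp add: eq)
  qed
  show "(\<lambda>s. mellin_integral 1 (upper f) s) holomorphic_on UNIV"
    unfolding eq
  proof (rule holomorphic_on_integral)
    show "(\<lambda>z. g z x) holomorphic_on UNIV" for x
      by (cases "x > 0") (auto simp: g_def intro!: holomorphic_intros)
    fix z0 :: complex
    have "Re z \<le> Re z0 + 1" if "z \<in> cball z0 1" for z
      using that abs_Re_le_cmod[of "z - z0"] by (simp add: dist_norm norm_minus_commute)
    then have "\<forall>z\<in>cball z0 1. \<forall>x\<in>space lborel. norm (g z x) \<le> norm (g (of_real (Re z0 + 1)) x)"
      using le by blast
    then show "\<exists>r>0. \<exists>G. cball z0 r \<subseteq> UNIV \<and> integrable lborel G \<and> (\<forall>z\<in>cball z0 r. \<forall>x\<in>space lborel. norm (g z x) \<le> G x)"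
      using integrable_norm[OF int[of "of_real (Re z0 + 1)"]] by (intro exI[of _ 1]) auto
  qed auto
qed

text \<open>Riemann's splitting: below 1 the relation replaces \<open>A x\<close> by
  \<open>B (1 / x)\<close> and powers; inversion sends the \<open>B\<close> part to the cut integral
  at \<open>p - s\<close>, and each \<open>x powr (- e)\<close> integrates to
  \<open>1 / (s - e)\<close>.\<close>

lemma has_mellin_split:
  assumes A: "rapid k A" and B: "rapid k B"
    and rel: "\<And>x. x > 0 \<Longrightarrow> A x = of_real x powr (- p) * B (1 / x) +
       (c1 * of_real x powr (- e1) + (c2 * of_real x powr (- e2) + c3 * of_real x powr (- e3)))"
    and s: "Re s > Re e1" "Re s > Re e2" "Re s > Re e3"
  shows "has_mellin A s (mellin_integral 1 (upper A) s + mellin_integral 1 (upper B) (p - s) +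
    (c1 / (s - e1) + (c2 / (s - e2) + c3 / (s - e3))))"
proof -
  note [measurable] = rapid_measurable[OF A] rapid_measurable[OF B]
  have ind: "has_mellin (\<lambda>x. c * (of_real x powr (- e) * indicator {..<1} x)) s (c / (s - e))" if "Re s > Re e" for c e
    using that has_mellin_cmult[OF has_mellin_powr_times[of "\<lambda>x. indicator {..<1} x" s "- e", OF has_mellin_below_one], of c] by simp
  have "has_mellin (upper B) (- (s + - p)) (mellin_integral 1 (upper B) (p - s))"
    using has_mellin_upper[OF B, of "p - s"] by (simp add: algebra_simps)
  then have "has_mellin (\<lambda>x. of_real x powr (- p) * upper B (1 / x)) s (mellin_integral 1 (upper B) (p - s))"
    by (intro has_mellin_powr_times has_mellin_inverse) auto
  then have "has_mellin (\<lambda>x. upper A x + of_real x powr (- p) * upper B (1 / x) +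
     (c1 * (of_real x powr (- e1) * indicator {..<1} x) + (c2 * (of_real x powr (- e2) * indicator {..<1} x) +
      c3 * (of_real x powr (- e3) * indicator {..<1} x)))) s
     (mellin_integral 1 (upper A) s + mellin_integral 1 (upper B) (p - s) +
    (c1 / (s - e1) + (c2 / (s - e2) + c3 / (s - e3))))"
    by (intro has_mellin_add has_mellin_upper[OF A] ind s)
  then show ?thesis
    by (subst has_mellin_cong_off_one) (auto simp: upper_def indicator_def rel field_simps)
qed

section \<open>Growth of order one\<close>

text \<open>Bounds for every exponent \<open>a > 1\<close> are closed under products and sums and
  can be assembled from regions of the plane; the shift by 1 keeps the base of the power at least
  1.\<close>

definition order_one_on :: "complex set \<Rightarrow> (complex \<Rightarrow> complex) \<Rightarrow> bool" where
  "order_one_on S F \<longleftrightarrow> (\<forall>a>1. \<exists>M. \<forall>z\<in>S. norm (F z) \<le> exp (M * (1 + norm z) powr a))"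

lemma order_one_on_subset: "order_one_on T F \<Longrightarrow> S \<subseteq> T \<Longrightarrow> order_one_on S F"
  unfolding order_one_on_def by blast

lemma order_one_on_cong: "order_one_on S F \<Longrightarrow> (\<And>z. z \<in> S \<Longrightarrow> F z = G z) \<Longrightarrow> order_one_on S G"
  unfolding order_one_on_def by metis

lemma one_le_powr: "a > 1 \<Longrightarrow> 1 \<le> (1 + norm z) powr a"
  by (rule ge_one_powr_ge_zero) auto

lemma order_one_on_mult:
  assumes "order_one_on S F" "order_one_on S G"
  shows "order_one_on S (\<lambda>z. F z * G z)"
  unfolding order_one_on_def
proof (intro allI impI)
  fix a :: real assume a: "a > 1"
  from assms a obtain M M' where M: "\<And>z. z \<in> S \<Longrightarrow> norm (F z) \<le> exp (M * (1 + norm z) powr a)"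
    and M': "\<And>z. z \<in> S \<Longrightarrow> norm (G z) \<le> exp (M' * (1 + norm z) powr a)" unfolding order_one_on_def by meson
  have "norm (F z * G z) \<le> exp ((M + M') * (1 + norm z) powr a)" if "z \<in> S" for z
    unfolding norm_mult distrib_right exp_add using that by (intro mult_mono M M') auto
  then show "\<exists>M. \<forall>z\<in>S. norm (F z * G z) \<le> exp (M * (1 + norm z) powr a)" by blast
qed

lemma order_one_on_add:
  assumes "order_one_on S F" "order_one_on S G"
  shows "order_one_on S (\<lambda>z. F z + G z)"
  unfolding order_one_on_def
proof (intro allI impI)
  fix a :: real assume a: "a > 1"
  from assms a obtain M M' where M: "\<And>z. z \<in> S \<Longrightarrow> norm (F z) \<le> exp (M * (1 + norm z) powr a)"
    and M': "\<And>z. z \<in> S \<Longrightarrow> norm (G z) \<le> exp (M' * (1 + norm z) powr a)" unfolding order_one_on_def by meson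
  have "norm (F z + G z) \<le> exp ((1 + max M M') * (1 + norm z) powr a)" if "z \<in> S" for z
  proof -
    define t where "t = (1 + norm z) powr a"
    have t: "t \<ge> 1" using one_le_powr[OF a] by (simp add: t_def)
    have "norm (F z + G z) \<le> exp (M * t) + exp (M' * t)"
      unfolding t_def using that by (intro order_trans[OF norm_triangle_ineq] add_mono M M')
    also have "\<dots> \<le> exp (max M M' * t) + exp (max M M' * t)"
      using t by (intro add_mono) (auto intro!: mult_right_mono)
    also have "\<dots> = 2 * exp (max M M' * t)" by simp
    also have "2 \<le> exp t" using exp_ge_add_one_self[of t] t by linarith
    then have "2 * exp (max M M' * t) \<le> exp t * exp (max M M' * t)" by (intro mult_right_mono) auto
    finally show ?thesis by (simp add: t_def ring_distribs exp_add)
  qed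
  then show "\<exists>M. \<forall>z\<in>S. norm (F z + G z) \<le> exp (M * (1 + norm z) powr a)" by blast
qed

lemma order_one_on_exp_bound:
  assumes "\<And>z. z \<in> S \<Longrightarrow> norm (F z) \<le> exp (C * (1 + norm z))"
  shows "order_one_on S F"
  unfolding order_one_on_def
proof (intro allI impI exI ballI)
  fix a :: real and z assume a: "a > 1" and z: "z \<in> S"
  have "(1 + norm z) powr 1 \<le> (1 + norm z) powr a" using a by (intro powr_mono) auto
  then have "1 + norm z \<le> (1 + norm z) powr a" by simp
  then have "C * (1 + norm z) \<le> \<bar>C\<bar> * (1 + norm z) powr a"
    by (intro mult_mono) auto
  with assms[OF z] show "norm (F z) \<le> exp (\<bar>C\<bar> * (1 + norm z) powr a)"
    by (meson exp_le_cancel_iff order_trans)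
qed

lemma order_one_on_bounded:
  assumes "\<And>z. z \<in> S \<Longrightarrow> norm (F z) \<le> C"
  shows "order_one_on S F"
proof (rule order_one_on_exp_bound)
  fix z assume "z \<in> S"
  have "norm (F z) \<le> \<bar>C\<bar>" using assms[OF \<open>z \<in> S\<close>] by linarith
  also have "\<bar>C\<bar> \<le> exp \<bar>C\<bar>" using exp_ge_add_one_self[of "\<bar>C\<bar>"] by linarith
  also have "\<dots> \<le> exp (\<bar>C\<bar> * (1 + norm z))" by (simp add: mult_le_cancel_left1)
  finally show "norm (F z) \<le> exp (\<bar>C\<bar> * (1 + norm z))" .
qed

lemma order_one_on_const: "order_one_on S (\<lambda>_. c)"
  by (rule order_one_on_bounded[of _ _ "norm c"]) simp

lemma order_one_on_ident: "order_one_on S (\<lambda>z. z)"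
proof (rule order_one_on_exp_bound)
  show "norm z \<le> exp (1 * (1 + norm z))" for z :: complex
    using exp_ge_add_one_self[of "1 + norm z"] unfolding mult_1 by linarith
qed

lemma order_one_on_affine:
  assumes "order_one_on T F" and "\<And>z. z \<in> S \<Longrightarrow> u * z + v \<in> T"
  shows "order_one_on S (\<lambda>z. F (u * z + v))"
  unfolding order_one_on_def
proof (intro allI impI)
  fix a :: real assume a: "a > 1"
  from assms(1) a obtain M where M: "\<And>z. z \<in> T \<Longrightarrow> norm (F z) \<le> exp (M * (1 + norm z) powr a)"
    unfolding order_one_on_def by meson
  define K where "K = 1 + norm u + norm v"
  have "norm (F (u * z + v)) \<le> exp (\<bar>M\<bar> * K powr a * (1 + norm z) powr a)" if z: "z \<in> S" for z
  proof -
    have "norm (u * z + v) \<le> norm u * norm z + norm v"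
      using norm_triangle_ineq[of "u * z" v] by (simp add: norm_mult)
    then have "1 + norm (u * z + v) \<le> K * (1 + norm z)"
      using mult_nonneg_nonneg[OF norm_ge_zero[of v] norm_ge_zero[of z]] norm_ge_zero[of u] norm_ge_zero[of z]
      unfolding K_def ring_distribs mult_1 mult_1_right by linarith
    then have "(1 + norm (u * z + v)) powr a \<le> (K * (1 + norm z)) powr a"
      using a by (intro powr_mono2) auto
    also have "\<dots> = K powr a * (1 + norm z) powr a"
      by (rule powr_mult) 
    finally have "M * (1 + norm (u * z + v)) powr a \<le> \<bar>M\<bar> * (K powr a * (1 + norm z) powr a)"
      by (intro mult_mono) auto
    with M[OF assms(2)[OF z]] show ?thesis by (metis exp_le_cancel_iff mult.assoc order_trans)
  qed
  then show "\<exists>M. \<forall>z\<in>S. norm (F (u * z + v)) \<le> exp (M * (1 + norm z) powr a)" by blast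
qed

lemma order_one_on_exp: "order_one_on S (\<lambda>z. exp (u * z + v))"
proof -
  have "order_one_on UNIV exp"
  proof (rule order_one_on_exp_bound)
    show "norm (exp z) \<le> exp (1 * (1 + norm z))" for z :: complex
      using complex_Re_le_cmod[of z] by simp
  qed
  then show ?thesis by (rule order_one_on_affine) simp
qed

lemma order_one_on_powr:
  assumes "x > 0"
  shows "order_one_on S (\<lambda>z. complex_of_real x powr (u * z + v))"
proof -
  have "(\<lambda>z. complex_of_real x powr (u * z + v)) = (\<lambda>z. exp ((u * of_real (ln x)) * z + v * of_real (ln x)))"
    using assms by (simp add: of_real_powr_eq_exp fun_eq_iff algebra_simps)
  then show ?thesis using order_one_on_exp by simp
qed

lemma order_one_on_union:
  assumes "order_one_on S F" "order_one_on T F"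
  shows "order_one_on (S \<union> T) F"
  unfolding order_one_on_def
proof (intro allI impI)
  fix a :: real assume a: "a > 1"
  from assms a obtain M M' where M: "\<And>z. z \<in> S \<Longrightarrow> norm (F z) \<le> exp (M * (1 + norm z) powr a)"
    and M': "\<And>z. z \<in> T \<Longrightarrow> norm (F z) \<le> exp (M' * (1 + norm z) powr a)" unfolding order_one_on_def by meson
  have "norm (F z) \<le> exp (max M M' * (1 + norm z) powr a)" if "z \<in> S \<union> T" for z
  proof -
    have "exp (M * (1 + norm z) powr a) \<le> exp (max M M' * (1 + norm z) powr a)"
      "exp (M' * (1 + norm z) powr a) \<le> exp (max M M' * (1 + norm z) powr a)"
      by (auto intro!: mult_right_mono)
    then show ?thesis using that M[of z] M'[of z] by (metis UnE order_trans)
  qed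
  then show "\<exists>M. \<forall>z\<in>S \<union> T. norm (F z) \<le> exp (M * (1 + norm z) powr a)" by blast
qed

lemma norm_Gamma_le: "Re z > 0 \<Longrightarrow> norm (Gamma z) \<le> Gamma (Re z)"
proof -
  assume z: "Re z > 0"
  have i: "integrable lborel (\<lambda>x. indicator {0<..} x *\<^sub>R (of_real x powr (w - 1) * complex_of_real (exp (- x))))"
    "(LINT x|lborel. indicator {0<..} x *\<^sub>R (of_real x powr (w - 1) * complex_of_real (exp (- x)))) = Gamma w" if "Re w > 0" for w
    using has_mellin_exp[OF that] by (auto simp: has_mellin_def has_bochner_integral_iff)
  have "norm (Gamma z) \<le> (LINT x|lborel. norm (indicator {0<..} x *\<^sub>R (of_real x powr (z - 1) * complex_of_real (exp (- x)))))"
    unfolding i(2)[OF z, symmetric] by (rule integral_norm_bound)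
  also have "\<dots> = (LINT x|lborel. Re (indicator {0<..} x *\<^sub>R (of_real x powr (of_real (Re z) - 1) * complex_of_real (exp (- x)))))"
  proof (rule Bochner_Integration.integral_cong[OF refl])
    fix x :: real
    show "norm (indicator {0<..} x *\<^sub>R (of_real x powr (z - 1) * complex_of_real (exp (- x)))) =
       Re (indicator {0<..} x *\<^sub>R (of_real x powr (of_real (Re z) - 1) * complex_of_real (exp (- x))))"
    proof (cases "x > 0")
      case True
      have "complex_of_real x powr (of_real (Re z) - 1) = of_real (x powr (Re z - 1))"
        using True powr_of_real[of x "Re z - 1"] by simp
      then show ?thesis using True by (simp add: norm_mult norm_of_real_powr)
    qed simp
  qed
  also have "\<dots> = Re (Gamma (of_real (Re z)))"
    using i[of "of_real (Re z)"] z integral_Re by (metis Re_complex_of_real)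
  also have "\<dots> = Gamma (Re z)" by (simp add: Gamma_complex_of_real)
  finally show ?thesis .
qed

text \<open>Descending to \<open>1 \<le> Re z \<le> 2\<close> by
  \<open>Gamma (z + 1) = z * Gamma z\<close> costs a factor of at most \<open>1 + norm z\<close> per
  step, and there are at most \<open>norm z\<close> steps.\<close>

lemma norm_Gamma_growth: "\<exists>C>0. \<forall>z. Re z \<ge> 1 \<longrightarrow> norm (Gamma z) \<le> C * (1 + norm z) powr norm z"
proof -
  have "compact {1..2::real}" by simp
  moreover have "continuous_on {1..2} (Gamma :: real \<Rightarrow> real)"
    by (intro continuous_intros) (auto elim!: nonpos_Ints_cases)
  ultimately have "compact (Gamma ` {1..2::real})" by (intro compact_continuous_image)
  then obtain C where C: "\<And>x::real. x \<in> {1..2} \<Longrightarrow> norm (Gamma x) \<le> C"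
    by (meson bounded_iff compact_imp_bounded imageI)
  have C0: "C > 0" using C[of 1] by auto
  have *: "norm (Gamma z) \<le> C * (1 + norm z) ^ n" if "Re z \<ge> real n + 1" "Re z \<le> real n + 2" for n z
    using that
  proof (induction n arbitrary: z)
    case 0
    then have "norm (Gamma z) \<le> Gamma (Re z)" by (intro norm_Gamma_le) auto
    also have "\<dots> \<le> C" using C[of "Re z"] 0 by auto
    finally show ?case by simp
  next
    case (Suc n)
    have "z - 1 \<notin> \<int>\<^sub>\<le>\<^sub>0" using Suc.prems by (auto elim!: nonpos_Ints_cases simp: complex_eq_iff)
    from Gamma_plus1[OF this] have "norm (Gamma z) = norm (z - 1) * norm (Gamma (z - 1))" by (simp add: norm_mult)
    also have "\<dots> \<le> (1 + norm z) * (C * (1 + norm z) ^ n)"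
    proof (intro mult_mono)
      have z1: "norm (z - 1) \<le> norm z"
      proof (rule power2_le_imp_le)
        show "(norm (z - 1))\<^sup>2 \<le> (norm z)\<^sup>2"
          using Suc.prems unfolding cmod_power2 by (simp add: power2_eq_square algebra_simps)
      qed simp
      then show "norm (z - 1) \<le> 1 + norm z" by simp
      have "norm (Gamma (z - 1)) \<le> C * (1 + norm (z - 1)) ^ n"
        using Suc.prems by (intro Suc.IH) auto
      also have "\<dots> \<le> C * (1 + norm z) ^ n" using z1 C0 by (intro mult_left_mono power_mono) auto
      finally show "norm (Gamma (z - 1)) \<le> C * (1 + norm z) ^ n" .
    qed auto
    finally show ?case by (simp add: mult_ac)
  qed
  have "norm (Gamma z) \<le> C * (1 + norm z) powr norm z" if z: "Re z \<ge> 1" for z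
  proof -
    define n where "n = nat \<lfloor>Re z - 1\<rfloor>"
    have rn: "real n = of_int \<lfloor>Re z - 1\<rfloor>" using z unfolding n_def by (subst of_nat_nat) auto
    have n: "real n \<le> Re z - 1" "Re z - 1 < real n + 1"
      unfolding rn by linarith+
    then have "norm (Gamma z) \<le> C * (1 + norm z) ^ n" by (intro *) auto
    also have "\<dots> = C * (1 + norm z) powr real n" by (subst powr_realpow) (auto intro: add_pos_nonneg)
    also have "\<dots> \<le> C * (1 + norm z) powr norm z"
      using n complex_Re_le_cmod[of z] C0 by (intro mult_left_mono powr_mono) auto
    finally show ?thesis .
  qed
  with C0 show ?thesis by blast
qed

lemma order_one_on_Gamma: "order_one_on {z. Re z \<ge> 1} Gamma"
  unfolding order_one_on_def
proof (intro allI impI)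
  fix a :: real assume a: "a > 1"
  from norm_Gamma_growth obtain C where C: "C > 0" "\<And>z. Re z \<ge> 1 \<Longrightarrow> norm (Gamma z) \<le> C * (1 + norm z) powr norm z" by blast
  have "norm (Gamma z) \<le> exp ((C + 1 / (a - 1)) * (1 + norm z) powr a)" if z: "Re z \<ge> 1" for z
  proof -
    define t where "t = 1 + norm z"
    have t: "t \<ge> 1" by (simp add: t_def)
    \<comment> \<open>The logarithm in the exponent of \<open>t powr norm z\<close> is traded for a
      small power of \<open>t\<close>; this is why the bound holds for each \<open>a > 1\<close> but
      is not claimed for \<open>a = 1\<close>.\<close>
    have "ln t \<le> t powr (a - 1) / (a - 1)" using t a by (intro ln_powr_bound) auto
    then have "norm z * ln t \<le> t * (t powr (a - 1) / (a - 1))"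
      using t by (intro mult_mono) (auto simp: t_def)
    also have "\<dots> = 1 / (a - 1) * t powr a"
      using t powr_add[of t 1 "a - 1"] by simp
    finally have 1: "t powr norm z \<le> exp (1 / (a - 1) * t powr a)"
      using t by (simp add: powr_def)
    have "C \<le> exp C" using exp_ge_add_one_self[of C] by linarith
    also have "\<dots> \<le> exp (C * t powr a)"
      using C(1) one_le_powr[OF a, of z] by (simp add: t_def mult_le_cancel_left1)
    finally have 2: "C \<le> exp (C * t powr a)" .
    have "norm (Gamma z) \<le> C * t powr norm z" using C(2)[OF z] by (simp add: t_def)
    also have "\<dots> \<le> exp (C * t powr a) * exp (1 / (a - 1) * t powr a)"
      using C(1) by (intro mult_mono 1 2) auto
    finally show ?thesis by (simp add: t_def ring_distribs flip: exp_add)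
  qed
  then show "\<exists>M. \<forall>z\<in>{z. Re z \<ge> 1}. norm (Gamma z) \<le> exp (M * (1 + norm z) powr a)" by blast
qed

lemma order_one_on_sin: "order_one_on S (\<lambda>z. sin (u * z + v))"
proof -
  have "order_one_on UNIV (sin :: complex \<Rightarrow> complex)"
  proof -
    have "sin = (\<lambda>z. 1 / (2 * \<i>) * (exp (\<i> * z + 0) + (- 1) * exp ((- \<i>) * z + 0)))"
      by (auto simp: sin_exp_eq fun_eq_iff field_simps)
    moreover have "order_one_on UNIV (\<lambda>z. 1 / (2 * \<i>) * (exp (\<i> * z + 0) + (- 1) * exp ((- \<i>) * z + 0)))"
      by (intro order_one_on_mult order_one_on_add order_one_on_const order_one_on_exp)
    ultimately show ?thesis by simp
  qed
  then show ?thesis by (rule order_one_on_affine) simp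
qed

text \<open>Reflection reduces to \<open>Gamma (1 - z)\<close>, which is moved to real part at least
  1 by \<open>k\<close> shifts; each Pochhammer factor divided out has modulus at least 1 because
  \<open>\<bar>Im z\<bar> \<ge> 1\<close>.\<close>

lemma order_one_on_rGamma_strip:
  "order_one_on {z. \<bar>Re z\<bar> \<le> R \<and> \<bar>Im z\<bar> \<ge> 1} rGamma"
proof -
  define k where "k = nat \<lceil>R\<rceil>"
  have k: "real k \<ge> R" unfolding k_def by (rule real_nat_ceiling_ge)
  define S where "S = {z. \<bar>Re z\<bar> \<le> R \<and> \<bar>Im z\<bar> \<ge> (1::real)}"
  have "order_one_on S (\<lambda>z. sin (of_real pi * z + 0) * (1 / of_real pi) * Gamma ((- 1) * z + (1 + of_nat k)) * (1 / pochhammer (1 - z) k))"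
  proof (intro order_one_on_mult order_one_on_sin order_one_on_const)
    show "order_one_on S (\<lambda>z. Gamma ((- 1) * z + (1 + of_nat k)))"
      by (rule order_one_on_affine[OF order_one_on_Gamma]) (use k in \<open>auto simp: S_def\<close>)
    show "order_one_on S (\<lambda>z. 1 / pochhammer (1 - z) k)"
    proof (rule order_one_on_bounded[of _ _ 1])
      fix z assume z: "z \<in> S"
      have "1 \<le> norm (1 - z + of_nat i)" for i
        using abs_Im_le_cmod[of "1 - z + of_nat i"] z by (auto simp: S_def)
      then have "(\<Prod>i<k. 1) \<le> (\<Prod>i<k. norm (1 - z + of_nat i))" by (intro prod_mono) auto
      also have "\<dots> = norm (pochhammer (1 - z) k)"
        by (simp add: pochhammer_prod prod_norm atLeast0LessThan)
      finally show "norm (1 / pochhammer (1 - z) k) \<le> 1" by (simp add: norm_divide divide_le_eq)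
    qed
  qed
  then show ?thesis unfolding S_def[symmetric]
  proof (rule order_one_on_cong)
    fix z assume z: "z \<in> S"
    then have ni: "1 - z \<notin> \<int>\<^sub>\<le>\<^sub>0" "z \<notin> \<int>\<^sub>\<le>\<^sub>0" by (auto simp: S_def complex_eq_iff elim!: nonpos_Ints_cases)
    have p: "pochhammer (1 - z) k \<noteq> 0" using z by (intro pochhammer_nonzero_if_Im) (auto simp: S_def)
    have "Gamma (1 - z) \<noteq> 0" using ni(1) Gamma_eq_zero_iff by blast
    then have "Gamma (1 - z + of_nat k) = pochhammer (1 - z) k * Gamma (1 - z)"
      using pochhammer_Gamma[OF ni(1), of k] by simp
    then have "Gamma (1 - z + of_nat k) * (1 / pochhammer (1 - z) k) = Gamma (1 - z)"
      using p by simp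
    moreover have "rGamma z = sin (of_real pi * z) / of_real pi * Gamma (1 - z)"
      using rGamma_reflection_complex[of z] ni by (simp add: rGamma_inverse_Gamma Gamma_eq_zero_iff field_simps)
    ultimately show "sin (of_real pi * z + 0) * (1 / of_real pi) * Gamma ((- 1) * z + (1 + of_nat k)) * (1 / pochhammer (1 - z) k) = rGamma z"
      by (simp add: algebra_simps)
  qed
qed

lemma entire_order_le_1:
  assumes F: "order_one_on UNIV F"
  shows "entire_order F \<le> 1"
proof (rule dense_ge)
  fix y :: ereal assume y: "1 < y"
  show "entire_order F \<le> y"
  proof (cases y)
    case (real a)
    then have a: "a > 1" using y by (simp add: one_ereal_def)
    \<comment> \<open>An exponent strictly between 1 and \<open>a\<close>, so that the constant
      \<open>\<bar>M\<bar> * 2 powr a'\<close> is absorbed by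
      \<open>norm z powr (a - a')\<close>.\<close>
    define a' where "a' = (1 + a) / 2"
    have a': "a' > 1" "a' < a" using a by (auto simp: a'_def)
    from F a' obtain M where M: "\<And>z. norm (F z) \<le> exp (M * (1 + norm z) powr a')" unfolding order_one_on_def by auto
    define C where "C = \<bar>M\<bar> * 2 powr a'"
    have "C \<le> norm z powr (a - a')" if "norm z \<ge> C powr (1 / (a - a'))" for z :: complex
    proof -
      have "C = (C powr (1 / (a - a'))) powr (a - a')" using a' by (simp add: powr_powr C_def)
      also have "\<dots> \<le> norm z powr (a - a')" using a' that by (intro powr_mono2) auto
      finally show ?thesis .
    qed
    then have "\<forall>\<^sub>F z::complex in at_infinity. \<bar>M\<bar> * 2 powr a' \<le> norm z powr (a - a')"
      unfolding eventually_at_infinity C_def by blast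
    moreover have "\<forall>\<^sub>F z::complex in at_infinity. 1 \<le> norm z"
      unfolding eventually_at_infinity by blast
    ultimately have "\<forall>\<^sub>F z in at_infinity. norm (F z) \<le> 1 * norm (complex_of_real (exp (norm z powr a)))"
    proof eventually_elim
      case (elim z)
      have "M * (1 + norm z) powr a' \<le> \<bar>M\<bar> * (2 * norm z) powr a'"
        using elim a' by (intro mult_mono powr_mono2) auto
      also have "\<dots> = \<bar>M\<bar> * 2 powr a' * norm z powr a'" by (simp add: powr_mult)
      also have "\<dots> \<le> norm z powr (a - a') * norm z powr a'" using elim by (intro mult_right_mono) auto
      also have "\<dots> = norm z powr a" by (simp flip: powr_add)
      finally show ?case using M[of z] by (smt (verit) exp_le_cancel_iff norm_of_real abs_exp_cancel)
    qed
    then have "F \<in> O[at_infinity](\<lambda>z. of_real (exp (norm z powr a)))" by (rule bigoI)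
    then have "ereal a \<in> {ereal a | a. a \<ge> 0 \<and> F \<in> O[at_infinity](\<lambda>z. of_real (exp (norm z powr a)))}"
      using a by auto
    then show ?thesis unfolding entire_order_def real by (rule Inf_lower)
  qed (use y in auto)
qed

section \<open>Analytic continuation of the Dirichlet series\<close>

text \<open>A datum holds one theta relation. Two instances with the sequences exchanged make every
  result about \<open>a\<close> available for both Dirichlet series.\<close>

locale theta_datum =
  fixes lam :: complex and l :: int and N :: nat and a b :: "int \<Rightarrow> complex" and c :: complex
    and D :: real and m :: nat
  assumes N: "N > 0"
    and a_bound: "\<And>n. norm (a (int (Suc n))) \<le> D * real (Suc n) ^ m" "\<And>n. norm (a (- int (Suc n))) \<le> D * real (Suc n) ^ m"
    and b_bound: "\<And>n. norm (b (int (Suc n))) \<le> D * real (Suc n) ^ m" "\<And>n. norm (b (- int (Suc n))) \<le> D * real (Suc n) ^ m"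
    and lam_cond: "\<And>i::nat. lam \<noteq> 1 / 2 - of_nat i / 2"
    and theta: "theta_relation lam l N a b c"
begin

definition p :: complex where "p = 2 - 2 * lam"
definition k :: nat where "k = fourier_order lam"
text \<open>Here \<open>k\<close> bounds the singularity of \<open>psi\<close> at 0, and
  \<open>m + 2\<close> is the loss in summing over \<open>n\<close>.\<close>

definition K :: nat where "K = k + m + 2"
definition ex :: "nat \<Rightarrow> complex" where "ex j = 2 * lam + of_nat j"
text \<open>The coefficients at \<open>n\<close> and \<open>- n\<close> merge because the Gaussian
  has parity \<open>j\<close>.\<close>

definition coef :: "nat \<Rightarrow> nat \<Rightarrow> complex" where
  "coef j n = a (int (Suc n)) + (- 1) ^ j * a (- int (Suc n))"
definition A :: "nat \<Rightarrow> real \<Rightarrow> complex" where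
  "A j r = \<i> ^ j * (\<Sum>n. coef j n * gauss_deriv 0 j (real (Suc n) * r))"
text \<open>The Fourier transform of the twisted Gaussian on the half-line of sign
  \<open>\<epsilon>\<close>, dilated by \<open>1 / N\<close>.\<close>

definition psi :: "nat \<Rightarrow> real \<Rightarrow> real \<Rightarrow> complex" where
  "psi j \<epsilon> x = (- 1) ^ j * flat_ft k (ex j) (\<epsilon> * (1 / real N * x)) + \<i> powi l * flat_ft k (ex j) (- \<epsilon> * (1 / real N * x))"
definition B :: "nat \<Rightarrow> real \<Rightarrow> complex" where
  "B j r = (\<Sum>n. b (int (Suc n)) * psi j 1 (real (Suc n) * r)) + (\<Sum>n. b (- int (Suc n)) * psi j (- 1) (real (Suc n) * r))"
definition S :: "nat \<Rightarrow> complex \<Rightarrow> complex" where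
  "S j s = (\<Sum>n. coef j n * of_nat (Suc n) powr (- s))"
definition xb :: "int \<Rightarrow> complex \<Rightarrow> complex" where
  "xb \<epsilon> s = (\<Sum>n. xi_term b \<epsilon> s n)"
text \<open>\<open>V1\<close> and \<open>V2\<close> are the rows of \<open>gamma_matrix s\<close> applied to the completed Dirichlet series of \<open>b\<close>.\<close>

definition V1 :: "complex \<Rightarrow> complex" where
  "V1 s = of_real (2 * pi) powr (- s) * Gamma s * (exp (of_real pi * s * \<i> / 2) * xb 1 s + exp (- (of_real pi * s * \<i> / 2)) * xb (- 1) s)"
definition V2 :: "complex \<Rightarrow> complex" where
  "V2 s = of_real (2 * pi) powr (- s) * Gamma s * (exp (- (of_real pi * s * \<i> / 2)) * xb 1 s + exp (of_real pi * s * \<i> / 2) * xb (- 1) s)"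
text \<open>The constant \<open>c\<close> and the term of index 0 on the Gaussian side are absent
  for \<open>j = 1\<close>, because the odd Gaussian vanishes at 0; on the other side the term of
  index 0 is kept for both parities.\<close>

definition cj :: "nat \<Rightarrow> complex" where "cj j = (if j = 0 then c else 0)"
definition aj :: "nat \<Rightarrow> complex" where "aj j = (if j = 0 then a 0 else 0)"
definition bj :: "nat \<Rightarrow> complex" where "bj j = b 0 * fourier lam (gauss_twist lam l j 0) 0"

lemma ex_k: "Re (ex j) + real k > 1"
  using fourier_order[of lam] by (simp add: ex_def k_def)

lemma coef_bound: "norm (coef j n) \<le> (2 * D) * real (Suc n) ^ m"
proof -
  have "norm (coef j n) \<le> norm (a (int (Suc n))) + norm (a (- int (Suc n)))"
    unfolding coef_def by (rule order_trans[OF norm_triangle_ineq]) (simp add: norm_mult norm_power)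
  also have "\<dots> \<le> D * real (Suc n) ^ m + D * real (Suc n) ^ m" by (intro add_mono a_bound)
  finally show ?thesis by simp
qed

lemma rapid_A: "rapid K (A j)"
proof -
  have "rapid (0 + m + 2) (\<lambda>x. \<Sum>n. coef j n * gauss_deriv 0 j (real (Suc n) * x))"
    by (rule rapid_series_rapid[OF rapid_gauss coef_bound])
  from rapid_cmult[OF rapid_mono[OF this], of K "\<i> ^ j"] show ?thesis
    unfolding A_def[abs_def] by (simp add: K_def del: gauss_deriv.simps)
qed

lemma rapid_psi:
  assumes "\<epsilon> \<in> {1, -1}"
  shows "rapid k (psi j \<epsilon>)"
proof -
  have *: "rapid k (\<lambda>x. flat_ft k (ex j) (\<epsilon>' * (1 / real N * x)))" if "\<epsilon>' \<in> {1, -1}" for \<epsilon>'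
    using N by (intro rapid_scale[OF rapid_flat_ft[OF ex_k that], of "1 / real N"]) auto
  show ?thesis unfolding psi_def[abs_def] using assms by (intro rapid_add rapid_cmult *) auto
qed

lemma rapid_B: "rapid K (B j)"
  unfolding B_def[abs_def] K_def
  by (intro rapid_add rapid_series_rapid[OF rapid_psi b_bound(1)] rapid_series_rapid[OF rapid_psi b_bound(2)]) auto

text \<open>Division by \<open>r\<close> turns \<open>r powr (2 * lam - 1)\<close> into
  \<open>r powr (- p)\<close>. The constant and the two terms of index 0 leave the exponents
  \<open>- 1\<close>, \<open>0\<close> and \<open>- p\<close>, hence the candidate poles 1, 0 and
  \<open>p\<close>.\<close>

lemma relation:
  assumes j: "j \<le> 1" and r: "r > 0"
  shows "A j r = of_real r powr (- p) * B j (1 / r) +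
    (cj j * of_real r powr (- 1) + (- aj j * of_real r powr (- 0) + bj j * of_real r powr (- p)))"
proof -
  define f where "f n = a n * ((\<i> * of_real (r * of_int n)) ^ j * of_real (exp (- (pi * (r * of_int n)\<^sup>2))))" for n
  define h where "h n = b n * fourier lam (gauss_twist lam l j 0) (of_int n / (r * of_nat N))" for n
  have f1: "f (int (Suc n)) = \<i> ^ j * (a (int (Suc n)) * gauss_deriv 0 j (real (Suc n) * r))" for n
    by (simp add: f_def power_mult_distrib mult_ac)
  have f2: "f (- int (Suc n)) = \<i> ^ j * ((- 1) ^ j * (a (- int (Suc n)) * gauss_deriv 0 j (real (Suc n) * r)))" for n
  proof -
    have e: "r * real_of_int (- int (Suc n)) = - (real (Suc n) * r)" by (simp add: algebra_simps)
    have "f (- int (Suc n)) = a (- int (Suc n)) * ((\<i> * of_real (- (real (Suc n) * r))) ^ j * of_real (exp (- (pi * (- (real (Suc n) * r))\<^sup>2))))"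
      unfolding f_def e ..
    also have "(\<i> * of_real (- (real (Suc n) * r))) ^ j = \<i> ^ j * ((- 1) ^ j * of_real ((real (Suc n) * r) ^ j))"
      unfolding of_real_power power_mult_distrib[symmetric] by simp
    finally show ?thesis by (simp add: mult_ac)
  qed
  have s1: "summable (\<lambda>n. norm (a (int (Suc n)) * gauss_deriv 0 j (real (Suc n) * r)))"
    by (rule rapid_series_summable[OF rapid_gauss a_bound(1) r])
  have s2: "summable (\<lambda>n. norm (a (- int (Suc n)) * gauss_deriv 0 j (real (Suc n) * r)))"
    by (rule rapid_series_summable[OF rapid_gauss a_bound(2) r])
  have sf: "summable (\<lambda>n. norm (f (int (Suc n))))" "summable (\<lambda>n. norm (f (- int (Suc n))))"
    unfolding f1 f2 using s1 s2 by (simp_all only: norm_mult norm_power norm_ii norm_minus_cancel norm_one power_one mult_1)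
  have "(\<Sum>n. f (int (Suc n))) + (\<Sum>n. f (- int (Suc n))) = (\<Sum>n. f (int (Suc n)) + f (- int (Suc n)))"
    by (rule suminf_add[OF summable_norm_cancel[OF sf(1)] summable_norm_cancel[OF sf(2)]])
  also have "\<dots> = (\<Sum>n. \<i> ^ j * (coef j n * gauss_deriv 0 j (real (Suc n) * r)))"
    unfolding f1 f2 by (simp add: coef_def algebra_simps del: gauss_deriv.simps)
  also have "\<dots> = A j r"
    unfolding A_def by (rule suminf_mult[OF summable_norm_cancel[OF rapid_series_summable[OF rapid_gauss coef_bound r]]])
  finally have F: "(\<Sum>\<^sub>\<infinity>n. f n) = aj j + A j r"
    unfolding infsum_int_split[OF sf] by (simp add: f_def aj_def add.assoc power_0_left)
  have ne: "1 / real N * (real (Suc n) * (1 / r)) \<noteq> 0" for n using N r by simp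
  have h1: "h (int (Suc n)) = b (int (Suc n)) * psi j 1 (real (Suc n) * (1 / r))" for n
  proof -
    have e: "real_of_int (int (Suc n)) / (r * real N) = 1 / real N * (real (Suc n) * (1 / r))" by simp
    show ?thesis unfolding h_def e fourier_gauss_twist[OF ne] psi_def ex_def k_def
      by (simp only: mult_1 mult_minus_left)
  qed
  have h2: "h (- int (Suc n)) = b (- int (Suc n)) * psi j (- 1) (real (Suc n) * (1 / r))" for n
  proof -
    have e: "real_of_int (- int (Suc n)) / (r * real N) = - (1 / real N * (real (Suc n) * (1 / r)))"
      using N r by (simp add: divide_simps)
    have ne': "- (1 / real N * (real (Suc n) * (1 / r))) \<noteq> 0" using ne[of n] by (simp only: neg_equal_0_iff_equal not_False_eq_True)
    show ?thesis unfolding h_def e fourier_gauss_twist[OF ne'] psi_def ex_def k_def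
      by (simp only: mult_1 mult_minus_left minus_minus)
  qed
  have r1: "1 / r > 0" using r by simp
  have sh: "summable (\<lambda>n. norm (h (int (Suc n))))" "summable (\<lambda>n. norm (h (- int (Suc n))))"
    unfolding h1 h2
    using rapid_series_summable[OF rapid_psi[of 1 j] b_bound(1) r1] rapid_series_summable[OF rapid_psi[of "- 1" j] b_bound(2) r1]
    by simp_all
  have H: "(\<Sum>\<^sub>\<infinity>n. h n) = bj j + B j (1 / r)"
    unfolding infsum_int_split[OF sh] h1 h2 B_def by (simp add: h_def bj_def add.assoc)
  have "of_real r * (\<Sum>\<^sub>\<infinity>n. f n) = cj j + of_real r powr (2 * lam - 1) * (\<Sum>\<^sub>\<infinity>n. h n)"
    using theta j r unfolding theta_relation_def f_def h_def cj_def by blast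
  then have *: "of_real r * (aj j + A j r) = cj j + of_real r powr (2 * lam - 1) * (bj j + B j (1 / r))"
    unfolding F H .
  have "complex_of_real r powr (1 + (- p)) = of_real r powr 1 * of_real r powr (- p)" by (rule powr_add)
  then have rp: "complex_of_real r powr (2 * lam - 1) = of_real r * of_real r powr (- p)"
    using r by (simp add: p_def algebra_simps)
  have "of_real r * A j r = of_real r * (of_real r powr (- p) * B j (1 / r) +
    (cj j * of_real r powr (- 1) + (- aj j * of_real r powr (- 0) + bj j * of_real r powr (- p))))"
    using * r unfolding rp by (simp add: powr_minus algebra_simps)
  then show ?thesis using r by (subst (asm) mult_cancel_left) auto
qed

lemma mellin_A:
  assumes "Re s > real K"
  shows "has_mellin (A j) s (\<i> ^ j * (S j s * gauss_mellin j s))"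
proof -
  have "mellin_integral 1 (gauss_deriv 0 j) s = gauss_mellin j s"
    using has_mellin_gauss[of j s] assms has_mellin_imp_mellin_integral[of "gauss_deriv 0 j" 1 s] by (simp del: gauss_deriv.simps)
  with has_mellin_rapid_series[OF rapid_gauss[of 0 j] coef_bound[of j], of s] assms
  have "has_mellin (\<lambda>x. \<Sum>n. coef j n * gauss_deriv 0 j (real (Suc n) * x)) s (S j s * gauss_mellin j s)"
    by (simp add: S_def K_def del: gauss_deriv.simps of_nat_Suc)
  then show ?thesis unfolding A_def[abs_def] by (rule has_mellin_cmult)
qed

lemma mellin_psi:
  assumes \<epsilon>: "\<epsilon> \<in> {1, -1}" and s: "Re s > real k"
  shows "mellin_integral 1 (psi j \<epsilon>) s = of_nat N powr s * (of_real (2 * pi) powr (- s) * Gamma s * flat_mellin (ex j) (1 - s) *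
    ((- 1) ^ j * exp (of_real \<epsilon> * of_real pi * \<i> * s / 2) + \<i> powi l * exp (of_real (- \<epsilon>) * of_real pi * \<i> * s / 2)))"
proof -
  define Q where "Q \<epsilon> = of_real (2 * pi) powr (- s) * Gamma s * exp (of_real \<epsilon> * of_real pi * \<i> * s / 2) * flat_mellin (ex j) (1 - s)" for \<epsilon> :: real
  have NN: "complex_of_real (1 / real N) powr (- s) = of_nat N powr s"
  proof -
    have "complex_of_real (1 / real N) powr (- s) = exp (- s * of_real (ln (1 / real N)))"
      using N by (intro of_real_powr_eq_exp) simp
    also have "ln (1 / real N) = - ln (real N)" using N by (simp add: ln_div)
    also have "exp (- s * of_real (- ln (real N))) = of_real (real N) powr s"
      using N by (subst of_real_powr_eq_exp) auto
    finally show ?thesis by simp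
  qed
  have *: "has_mellin (\<lambda>x. flat_ft k (ex j) (\<epsilon>' * (1 / real N * x))) s (of_nat N powr s * Q \<epsilon>')" if "\<epsilon>' \<in> {1, -1}" for \<epsilon>'
  proof -
    note rp = rapid_flat_ft[OF ex_k[of j] that]
    have "has_mellin (\<lambda>t. flat_ft k (ex j) (\<epsilon>' * t)) s (Q \<epsilon>')"
      using has_mellin_rapid[OF rp s] unfolding mellin_flat_ft[OF ex_k that s] Q_def .
    from has_mellin_scale[OF rapid_measurable[OF rp] _ this, of "1 / real N"] show ?thesis
      using N unfolding NN by simp
  qed
  have "has_mellin (psi j \<epsilon>) s ((- 1) ^ j * (of_nat N powr s * Q \<epsilon>) + \<i> powi l * (of_nat N powr s * Q (- \<epsilon>)))"
    unfolding psi_def[abs_def] using \<epsilon> by (intro has_mellin_add has_mellin_cmult *) auto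
  then have "mellin_integral 1 (psi j \<epsilon>) s = (- 1) ^ j * (of_nat N powr s * Q \<epsilon>) + \<i> powi l * (of_nat N powr s * Q (- \<epsilon>))"
    using has_mellin_imp_mellin_integral[of "psi j \<epsilon>" 1 s] by simp
  also have "\<dots> = of_nat N powr s * ((- 1) ^ j * Q \<epsilon> + \<i> powi l * Q (- \<epsilon>))" by (simp only: ring_distribs mult_ac)
  also have "(- 1) ^ j * Q \<epsilon> + \<i> powi l * Q (- \<epsilon>) = of_real (2 * pi) powr (- s) * Gamma s * flat_mellin (ex j) (1 - s) *
    ((- 1) ^ j * exp (of_real \<epsilon> * of_real pi * \<i> * s / 2) + \<i> powi l * exp (of_real (- \<epsilon>) * of_real pi * \<i> * s / 2))"
    unfolding Q_def by (simp only: ring_distribs mult_ac)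
  finally show ?thesis .
qed

lemma mellin_B:
  assumes s: "Re s > real K"
  shows "has_mellin (B j) s (of_nat N powr s * flat_mellin (ex j) (1 - s) * ((- 1) ^ j * V1 s + \<i> powi l * V2 s))"
proof -
  have sk: "Re s > real k" using s by (simp add: K_def)
  have 1: "has_mellin (\<lambda>x. \<Sum>n. b (int (Suc n)) * psi j 1 (real (Suc n) * x)) s (xb 1 s * mellin_integral 1 (psi j 1) s)"
    using has_mellin_rapid_series[OF rapid_psi[of 1 j] b_bound(1), of s] s by (simp add: xb_def xi_term_def K_def)
  have 2: "has_mellin (\<lambda>x. \<Sum>n. b (- int (Suc n)) * psi j (- 1) (real (Suc n) * x)) s (xb (- 1) s * mellin_integral 1 (psi j (- 1)) s)"
    using has_mellin_rapid_series[OF rapid_psi[of "- 1" j] b_bound(2), of s] s by (simp add: xb_def xi_term_def K_def)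
  have "has_mellin (B j) s (xb 1 s * mellin_integral 1 (psi j 1) s + xb (- 1) s * mellin_integral 1 (psi j (- 1)) s)"
    unfolding B_def[abs_def] by (rule has_mellin_add[OF 1 2])
  moreover have "xb 1 s * mellin_integral 1 (psi j 1) s + xb (- 1) s * mellin_integral 1 (psi j (- 1)) s =
      of_nat N powr s * flat_mellin (ex j) (1 - s) * ((- 1) ^ j * V1 s + \<i> powi l * V2 s)"
    proof -
    define e where "e = exp (of_real pi * s * \<i> / 2)"
    define e' where "e' = exp (- (of_real pi * s * \<i> / 2))"
    define P where "P = of_real (2 * pi) powr (- s) * Gamma s * flat_mellin (ex j) (1 - s)"
    have m1: "mellin_integral 1 (psi j 1) s = of_nat N powr s * (P * ((- 1) ^ j * e + \<i> powi l * e'))"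
      using mellin_psi[of 1 s j] sk by (simp add: P_def e_def e'_def mult_ac)
    have m2: "mellin_integral 1 (psi j (- 1)) s = of_nat N powr s * (P * ((- 1) ^ j * e' + \<i> powi l * e))"
      using mellin_psi[of "- 1" s j] sk by (simp add: P_def e_def e'_def mult_ac)
    show ?thesis unfolding m1 m2 V1_def V2_def e_def[symmetric] e'_def[symmetric] P_def by (simp only: ring_distribs mult_ac add_ac)
  qed
  ultimately show ?thesis by simp
qed

definition L :: "nat \<Rightarrow> complex \<Rightarrow> complex" where
  "L j s = mellin_integral 1 (upper (A j)) s + mellin_integral 1 (upper (B j)) (p - s)"

definition Z :: "nat \<Rightarrow> complex \<Rightarrow> complex" where
  "Z j s = L j s + (cj j / (s - 1) + (- aj j / s + bj j / (s - p)))"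

text \<open>Large enough for convergence on either side; the summand \<open>norm p\<close> also
  makes \<open>Re (p - s) > \<sigma>\<close> imply \<open>Re s < 0\<close>.\<close>

definition \<sigma> :: real where "\<sigma> = real K + norm p + 2"

lemma Re_p_less_sigma: "Re p < \<sigma>" "Re p - 1 < \<sigma>" "\<sigma> > 1" "real K < \<sigma>" "\<sigma> > 0"
  using complex_Re_le_cmod[of p] norm_ge_zero[of p] of_nat_0_le_iff[of K, where 'a = real]
  unfolding \<sigma>_def by linarith+

lemma Z_right:
  assumes j: "j \<le> 1" and s: "Re s > \<sigma>"
  shows "Z j s = \<i> ^ j * (S j s * gauss_mellin j s)"
proof -
  have "has_mellin (A j) s (L j s + (cj j / (s - 1) + (- aj j / (s - 0) + bj j / (s - p))))"
    unfolding L_def using s Re_p_less_sigma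
    by (intro has_mellin_split[OF rapid_A rapid_B relation[OF j]]) auto
  moreover have "has_mellin (A j) s (\<i> ^ j * (S j s * gauss_mellin j s))"
    using s Re_p_less_sigma by (intro mellin_A) auto
  ultimately show ?thesis unfolding has_mellin_def Z_def by (auto dest: has_bochner_integral_eq)
qed

text \<open>The split expression is symmetric under exchanging \<open>A\<close> with
  \<open>B\<close> and \<open>s\<close> with \<open>p - s\<close>, so the relation is solved for
  \<open>B\<close> and the splitting repeated.\<close>

lemma Z_left:
  assumes j: "j \<le> 1" and s: "Re (p - s) > \<sigma>"
  shows "Z j s = of_nat N powr (p - s) * flat_mellin (ex j) (1 - (p - s)) * ((- 1) ^ j * V1 (p - s) + \<i> powi l * V2 (p - s))"
proof -
  have rel: "B j x = of_real x powr (- p) * A j (1 / x) +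
    (- cj j * of_real x powr (- (p - 1)) + (aj j * of_real x powr (- p) + (- bj j) * of_real x powr (- 0)))" if x: "x > 0" for x
  proof -
    have inv: "complex_of_real (1 / x) powr z = of_real x powr (- z)" for z
      using x by (simp add: of_real_powr_eq_exp ln_div del: of_real_divide)
    define q where "q = complex_of_real x powr p"
    have q: "q \<noteq> 0" "complex_of_real x \<noteq> 0" using x by (auto simp: q_def)
    have 1: "A j (1 / x) = q * B j x + (cj j * of_real x + (- aj j + bj j * q))"
      using relation[OF j, of "1 / x"] x unfolding inv q_def by simp
    have 2: "complex_of_real x powr (- p) = 1 / q" by (simp add: q_def powr_minus divide_inverse)
    have "complex_of_real x powr (1 - p) = of_real x powr 1 / q" unfolding q_def by (rule powr_diff)
    then have 3: "complex_of_real x powr (- (p - 1)) = of_real x / q" by simp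
    have 4: "complex_of_real x powr (- 0) = 1" using x by simp
    show ?thesis unfolding 1 2 3 4 using q by (simp add: field_simps)
  qed
  have "has_mellin (B j) (p - s) (mellin_integral 1 (upper (B j)) (p - s) + mellin_integral 1 (upper (A j)) (p - (p - s)) +
     (- cj j / ((p - s) - (p - 1)) + (aj j / ((p - s) - p) + (- bj j) / ((p - s) - 0))))"
    using s Re_p_less_sigma
    by (intro has_mellin_split[OF rapid_B rapid_A rel]) auto
  moreover have "mellin_integral 1 (upper (B j)) (p - s) + mellin_integral 1 (upper (A j)) (p - (p - s)) +
     (- cj j / ((p - s) - (p - 1)) + (aj j / ((p - s) - p) + (- bj j) / ((p - s) - 0))) = Z j s"
  proof -
    have e: "(p - s) - (p - 1) = - (s - 1)" "(p - s) - p = - s" "(p - s) - 0 = - (s - p)" by simp_all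
    have "- cj j / ((p - s) - (p - 1)) = cj j / (s - 1)" "aj j / ((p - s) - p) = - aj j / s" "(- bj j) / ((p - s) - 0) = bj j / (s - p)"
      unfolding e minus_divide_divide by simp_all
    then show ?thesis by (simp add: Z_def L_def)
  qed
  moreover have "has_mellin (B j) (p - s) (of_nat N powr (p - s) * flat_mellin (ex j) (1 - (p - s)) * ((- 1) ^ j * V1 (p - s) + \<i> powi l * V2 (p - s)))"
    using s Re_p_less_sigma by (intro mellin_B) auto
  ultimately show ?thesis unfolding has_mellin_def by (auto dest: has_bochner_integral_eq)
qed

end

section \<open>Gamma factor identities and bounds for Dirichlet series\<close>

definition trig :: "nat \<Rightarrow> complex \<Rightarrow> complex" where
  "trig j u = (if j = 0 then cos (of_real pi * u / 2) else sin (of_real pi * u / 2))"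

text \<open>Reflection turns \<open>rGamma\<close> into a sine or cosine times the Gamma value that
  is missing from the duplication formula for \<open>u\<close>.\<close>

lemma rGamma_times_Gamma:
  assumes u: "u \<notin> \<int>\<^sub>\<le>\<^sub>0" and j: "j \<le> 1"
  shows "rGamma ((1 - u + of_nat j) / 2) * Gamma ((u + of_nat j) / 2) =
    trig j u / of_real pi * (exp ((1 - u) * of_real (ln 2)) * of_real (sqrt pi) * Gamma u)"
proof -
  have h1: "u / 2 \<notin> \<int>\<^sub>\<le>\<^sub>0"
  proof
    assume "u / 2 \<in> \<int>\<^sub>\<le>\<^sub>0"
    then obtain n where "u / 2 = - of_nat n" by (auto elim!: nonpos_Ints_cases')
    then have "u = - of_nat (2 * n)" by (simp add: field_simps)
    then show False using u by (auto simp del: of_nat_mult)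
  qed
  have h2: "u / 2 + 1 / 2 \<notin> \<int>\<^sub>\<le>\<^sub>0"
  proof
    assume "u / 2 + 1 / 2 \<in> \<int>\<^sub>\<le>\<^sub>0"
    then obtain n where "u / 2 + 1 / 2 = - of_nat n" by (auto elim!: nonpos_Ints_cases')
    then have "u = 2 * - of_nat n - 1" by (simp add: field_simps)
    moreover have "of_int (- int (2 * n + 1)) \<in> (\<int>\<^sub>\<le>\<^sub>0 :: complex set)" by (intro nonpos_Ints_of_int) simp
    moreover have "of_int (- int (2 * n + 1)) = (2 * - of_nat n - 1 :: complex)" by simp
    ultimately show False using u by metis
  qed
  have dup: "Gamma (u / 2) * Gamma (u / 2 + 1 / 2) = exp ((1 - u) * of_real (ln 2)) * of_real (sqrt pi) * Gamma u"
    using Gamma_legendre_duplication[OF h1 h2] by simp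
  have refl: "rGamma (1 - z) = sin (of_real pi * z) / of_real pi * Gamma z" if "z \<notin> \<int>\<^sub>\<le>\<^sub>0" for z :: complex
  proof -
    have "Gamma z \<noteq> 0" using that Gamma_eq_zero_iff by blast
    then have 1: "Gamma z * rGamma z = 1" by (simp add: rGamma_inverse_Gamma)
    have "rGamma (1 - z) = (Gamma z * rGamma z) * rGamma (1 - z)" unfolding 1 by simp
    also have "\<dots> = (rGamma z * rGamma (1 - z)) * Gamma z" by (simp only: mult_ac)
    finally show ?thesis unfolding rGamma_reflection_complex .
  qed
  show ?thesis
  proof (cases "j = 0")
    case True
    have e: "(1 - u + of_nat j) / 2 = 1 - (u / 2 + 1 / 2)" "(u + of_nat j) / 2 = u / 2"
      using True by (simp_all add: field_simps)
    have "of_real pi * (u / 2 + 1 / 2) = of_real pi / 2 - (- (of_real pi * u / 2))" by (simp add: field_simps)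
    then have sn: "sin (of_real pi * (u / 2 + 1 / 2)) = cos (of_real pi * u / 2)"
      using sin_cos_eq[of "of_real pi / 2 - (- (of_real pi * u / 2))"] by simp
    show ?thesis unfolding e refl[OF h2] sn trig_def if_P[OF True] dup[symmetric] by (simp only: mult_ac)
  next
    case False
    then have e: "(1 - u + of_nat j) / 2 = 1 - u / 2" "(u + of_nat j) / 2 = u / 2 + 1 / 2"
      using j by (simp_all add: field_simps)
    show ?thesis unfolding e refl[OF h1] trig_def if_not_P[OF False] dup[symmetric]
      by (simp only: mult_ac times_divide_eq_right)
  qed
qed

text \<open>The quotient of the Gamma factors of the two sides. It is used at
  \<open>u = 1 - s\<close> for the functional equation and at \<open>u = 2 * lam - 1\<close> for the
  residue at \<open>p\<close>.\<close>

lemma gamma_factor: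
  assumes u: "u \<notin> \<int>\<^sub>\<le>\<^sub>0" and j: "j \<le> 1"
  shows "of_real pi powr ((1 - u + of_nat j) / 2) * rGamma ((1 - u + of_nat j) / 2) *
      (of_real pi powr (- ((u + of_nat j) / 2)) * Gamma ((u + of_nat j) / 2)) =
    2 * of_real (2 * pi) powr (- u) * trig j u * Gamma u"
proof -
  define q where "q = complex_of_real (ln pi)"
  have pw: "complex_of_real pi powr z = exp (z * q)" for z unfolding q_def by (rule of_real_powr_eq_exp) simp
  have sq: "complex_of_real (sqrt pi) = exp (q / 2)"
  proof -
    have "sqrt pi = exp (ln (sqrt pi))" by simp
    also have "ln (sqrt pi) = ln pi / 2" by (rule ln_sqrt) simp
    finally have "complex_of_real (sqrt pi) = of_real (exp (ln pi / 2))" by (simp only:)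
    also have "\<dots> = exp (q / 2)" unfolding exp_of_real[symmetric] q_def by simp
    finally show ?thesis .
  qed
  have pi: "complex_of_real pi = exp q" unfolding q_def exp_of_real by simp
  have two: "complex_of_real (2 * pi) powr (- u) = exp (- u * of_real (ln 2)) * exp (- u * q)"
  proof -
    have "complex_of_real (2 * pi) powr (- u) = exp (- u * of_real (ln (2 * pi)))" by (rule of_real_powr_eq_exp) simp
    also have "ln (2 * pi) = ln 2 + ln pi" by (simp add: ln_mult)
    finally show ?thesis by (simp only: of_real_add distrib_left exp_add q_def)
  qed
  have e2: "exp ((1 - u) * of_real (ln 2)) = 2 * exp (- u * of_real (ln 2))"
  proof -
    have "exp (complex_of_real (ln 2)) = 2" unfolding exp_of_real by simp
    then show ?thesis by (simp add: left_diff_distrib exp_diff exp_minus field_simps)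
  qed
  have expo: "exp ((1 - u + of_nat j) / 2 * q) * exp (- ((u + of_nat j) / 2) * q) * exp (q / 2) = exp (- u * q) * exp q"
  proof -
    have "(1 - u + of_nat j) / 2 * q + - ((u + of_nat j) / 2) * q + q / 2 = - u * q + q" by (simp add: field_simps)
    then show ?thesis by (simp only: exp_add[symmetric])
  qed
  have "of_real pi powr ((1 - u + of_nat j) / 2) * rGamma ((1 - u + of_nat j) / 2) *
      (of_real pi powr (- ((u + of_nat j) / 2)) * Gamma ((u + of_nat j) / 2)) =
     (exp ((1 - u + of_nat j) / 2 * q) * exp (- ((u + of_nat j) / 2) * q)) * (rGamma ((1 - u + of_nat j) / 2) * Gamma ((u + of_nat j) / 2))"
    unfolding pw by (simp only: mult_ac)
  also have "\<dots> = (exp ((1 - u + of_nat j) / 2 * q) * exp (- ((u + of_nat j) / 2) * q) * exp (q / 2)) *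
     (trig j u / of_real pi * (2 * exp (- u * of_real (ln 2)) * Gamma u))"
    unfolding rGamma_times_Gamma[OF u j] e2 sq by (simp only: mult_ac times_divide_eq_left times_divide_eq_right)
  also have "\<dots> = 2 * (exp (- u * of_real (ln 2)) * exp (- u * q)) * trig j u * Gamma u"
    unfolding expo pi by simp
  finally show ?thesis unfolding two .
qed

lemma order_one_on_trig: "order_one_on T (\<lambda>s. trig j (u * s + v))"
proof (cases "j = 0")
  case True
  have "(\<lambda>s. trig j (u * s + v)) = (\<lambda>s. sin ((of_real pi * u / 2) * s + (of_real pi * v / 2 + of_real pi / 2)))"
  proof
    fix s
    have e: "(of_real pi * u / 2) * s + (of_real pi * v / 2 + of_real pi / 2) = of_real pi / 2 - (- (of_real pi * (u * s + v) / 2))"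
      by (simp add: field_simps)
    show "trig j (u * s + v) = sin ((of_real pi * u / 2) * s + (of_real pi * v / 2 + of_real pi / 2))"
      unfolding e using True sin_cos_eq[of "of_real pi / 2 - (- (of_real pi * (u * s + v) / 2))"] by (simp add: trig_def)
  qed
  then show ?thesis by (simp only: order_one_on_sin)
next
  case False
  have "(\<lambda>s. trig j (u * s + v)) = (\<lambda>s. sin ((of_real pi * u / 2) * s + of_real pi * v / 2))"
    using False by (simp add: trig_def fun_eq_iff field_simps)
  then show ?thesis by (simp only: order_one_on_sin)
qed

text \<open>The norms of the terms decrease in \<open>Re s\<close>, so the absolute series at the
  edge \<open>m + 2\<close> bounds the whole half-plane.\<close>

lemma dirichlet_bounded:
  assumes c: "\<And>n. norm (c n) \<le> D * real (Suc n) ^ m"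
  shows "\<exists>C. \<forall>s. Re s \<ge> real m + 2 \<longrightarrow> norm (\<Sum>n. c n * of_nat (Suc n) powr (- s)) \<le> C"
proof (intro exI allI impI)
  fix s assume s: "Re s \<ge> real m + 2"
  define s0 where "s0 = complex_of_real (real m + 2)"
  have s0: "summable (\<lambda>n. norm (c n * of_nat (Suc n) powr (- s0)))"
    by (rule summable_norm_dirichlet[OF c]) (simp add: s0_def)
  have sm: "summable (\<lambda>n. norm (c n * of_nat (Suc n) powr (- s)))"
    by (rule summable_norm_dirichlet[OF c s])
  have nrm: "norm (complex_of_nat (Suc n) powr (- z)) = real (Suc n) powr (- Re z)" for n z
    using norm_of_real_powr[of "real (Suc n)" "- z"] by simp
  have "norm (\<Sum>n. c n * of_nat (Suc n) powr (- s)) \<le> (\<Sum>n. norm (c n * of_nat (Suc n) powr (- s)))"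
    by (rule summable_norm[OF sm])
  also have "\<dots> \<le> (\<Sum>n. norm (c n * of_nat (Suc n) powr (- s0)))"
  proof (rule suminf_le[OF _ sm s0])
    fix n
    have "real (Suc n) powr (- Re s) \<le> real (Suc n) powr (- Re s0)"
      using s by (intro powr_mono) (auto simp: s0_def)
    then show "norm (c n * of_nat (Suc n) powr (- s)) \<le> norm (c n * of_nat (Suc n) powr (- s0))"
      unfolding norm_mult nrm by (intro mult_left_mono) auto
  qed
  finally show "norm (\<Sum>n. c n * of_nat (Suc n) powr (- s)) \<le> (\<Sum>n. norm (c n * of_nat (Suc n) powr (- s0)))" .
qed

context theta_datum
begin

text \<open>Together with \<open>rGamma ((s + of_nat j) / 2)\<close> this inverts the factor
  \<open>\<i> ^ j * gauss_mellin j s\<close>.\<close>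

definition G :: "nat \<Rightarrow> complex \<Rightarrow> complex" where
  "G j s = 2 * (- \<i>) ^ j * of_real pi powr ((s + of_nat j) / 2)"

text \<open>This is \<open>(s - 1) * (s - p)\<close> times \<open>S j s\<close>. The polar term \<open>- aj j / s\<close> of \<open>Z\<close> occurs only for
  \<open>j = 0\<close>, where \<open>rGamma (s / 2) / s = rGamma (s / 2 + 1) / 2\<close> has no pole.\<close>

definition E :: "nat \<Rightarrow> complex \<Rightarrow> complex" where
  "E j s = G j s * ((s - 1) * (s - p) * rGamma ((s + of_nat j) / 2) * L j s +
     rGamma ((s + of_nat j) / 2) * (cj j * (s - p) + bj j * (s - 1)) -
     aj j * (s - 1) * (s - p) * (rGamma (s / 2 + 1) / 2))"

lemma u_notin: "2 * lam - 1 \<notin> \<int>\<^sub>\<le>\<^sub>0"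
proof
  assume "2 * lam - 1 \<in> \<int>\<^sub>\<le>\<^sub>0"
  then obtain n where "2 * lam - 1 = - of_nat n" by (auto elim!: nonpos_Ints_cases')
  then have "lam = 1 / 2 - of_nat n / 2" by (simp add: field_simps)
  then show False using lam_cond by blast
qed

lemma p_ne_1: "p \<noteq> 1"
  using lam_cond[of 0] by (auto simp: p_def field_simps)

lemma E_eq:
  assumes j: "j \<le> 1" and s: "s \<noteq> 0" "s \<noteq> 1" "s \<noteq> p"
  shows "E j s = (s - 1) * (s - p) * (G j s * rGamma ((s + of_nat j) / 2) * Z j s)"
proof -
  define r where "r = rGamma ((s + of_nat j) / 2)"
  have a: "aj j * (rGamma (s / 2 + 1) / 2) = r * (aj j / s)"
  proof (cases "j = 0")
    case True
    have "s / 2 * rGamma (s / 2 + 1) = rGamma (s / 2)" by (rule rGamma_plus1)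
    then have r: "r = s / 2 * rGamma (s / 2 + 1)" using True by (simp add: r_def)
    show ?thesis unfolding r using s(1) by (simp add: field_simps)
  qed (simp add: aj_def)
  have "E j s = G j s * ((s - 1) * (s - p) * r * L j s + r * (cj j * (s - p) + bj j * (s - 1)) -
     (s - 1) * (s - p) * (aj j * (rGamma (s / 2 + 1) / 2)))"
    unfolding E_def r_def by (simp only: mult_ac)
  also have "\<dots> = (s - 1) * (s - p) * (G j s * r * Z j s)"
  proof -
    define e f q X Y where "e = cj j / (s - 1)" and "f = bj j / (s - p)" and "q = aj j / s" and "X = s - 1" and "Y = s - p"
    have c: "cj j = e * X" "bj j = f * Y" using s by (simp_all add: e_def f_def X_def Y_def)
    have Z: "Z j s = L j s + (e + (- q + f))" by (simp add: Z_def e_def f_def q_def)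
    show ?thesis
      unfolding a Z q_def[symmetric] X_def[symmetric] Y_def[symmetric] c by (simp add: algebra_simps)
  qed
  finally show ?thesis by (simp only: r_def)
qed

lemma E_right:
  assumes j: "j \<le> 1" and s: "Re s > \<sigma>"
  shows "E j s = (s - 1) * (s - p) * S j s"
proof -
  have s0: "s \<noteq> 0" "s \<noteq> 1" "s \<noteq> p" using s Re_p_less_sigma by auto
  define w where "w = (s + of_nat j) / 2"
  have "Re w > 0" using s Re_p_less_sigma by (simp add: w_def)
  then have "w \<notin> \<int>\<^sub>\<le>\<^sub>0" by (auto elim!: nonpos_Ints_cases)
  then have "Gamma w \<noteq> 0" using Gamma_eq_zero_iff by blast
  then have 1: "rGamma w * Gamma w = 1" by (simp add: rGamma_inverse_Gamma)
  have 2: "complex_of_real pi powr w * of_real pi powr (- w) = 1" by (simp add: powr_minus)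
  have 3: "(- \<i>) ^ j * \<i> ^ j = 1" by (simp flip: power_mult_distrib)
  have "G j s * rGamma w * Z j s = ((- \<i>) ^ j * \<i> ^ j) * (complex_of_real pi powr w * of_real pi powr (- w)) * (rGamma w * Gamma w) * S j s"
    unfolding Z_right[OF j s] G_def gauss_mellin_def w_def[symmetric] by (simp add: mult_ac)
  then show ?thesis unfolding E_eq[OF j s0] w_def[symmetric] 1 2 3 by simp
qed

lemma E_left:
  assumes j: "j \<le> 1" and s: "Re (p - s) > \<sigma>"
  shows "E j s = (s - 1) * (s - p) * (2 * (- \<i>) ^ j * of_real (2 * pi) powr (- (1 - s)) * trig j (1 - s) * Gamma (1 - s) *
     of_nat N powr (p - s) * ((- 1) ^ j * V1 (p - s) + \<i> powi l * V2 (p - s)))"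
proof -
  have Re: "Re s < 0" using s complex_Re_le_cmod[of p] of_nat_0_le_iff[of K, where 'a = real] by (simp add: \<sigma>_def)
  have s0: "s \<noteq> 0" "s \<noteq> 1" "s \<noteq> p" using s Re Re_p_less_sigma by auto
  have u: "1 - s \<notin> \<int>\<^sub>\<le>\<^sub>0" using Re by (auto elim!: nonpos_Ints_cases simp: complex_eq_iff)
  have e1: "(ex j - (1 - (p - s))) / 2 = (1 - s + of_nat j) / 2" by (simp add: ex_def p_def)
  have e2: "(s + of_nat j) / 2 = (1 - (1 - s) + of_nat j) / 2" by simp
  define W where "W = (- 1) ^ j * V1 (p - s) + \<i> powi l * V2 (p - s)"
  have "G j s * rGamma ((s + of_nat j) / 2) * Z j s =
    (- \<i>) ^ j * of_nat N powr (p - s) * W *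
    (of_real pi powr ((1 - (1 - s) + of_nat j) / 2) * rGamma ((1 - (1 - s) + of_nat j) / 2) *
      (of_real pi powr (- ((1 - s + of_nat j) / 2)) * Gamma ((1 - s + of_nat j) / 2)))"
    unfolding Z_left[OF j s] G_def flat_mellin_def e1 e2 W_def[symmetric] by simp
  also have "\<dots> = 2 * (- \<i>) ^ j * of_real (2 * pi) powr (- (1 - s)) * trig j (1 - s) * Gamma (1 - s) *
     of_nat N powr (p - s) * W"
    unfolding gamma_factor[OF u j] by (simp only: mult_ac)
  finally show ?thesis unfolding E_eq[OF j s0] W_def by simp
qed

text \<open>At 1 only the \<open>cj\<close> term is free of the factor \<open>s - 1\<close>; at
  \<open>p\<close>, in the next lemma, only the \<open>bj\<close> term is free of
  \<open>s - p\<close>.\<close>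

lemma E_at_1:
  assumes "j \<le> 1"
  shows "E j 1 = (1 - p) * (2 * cj j)"
proof (cases "j = 0")
  case True
  have "complex_of_real pi powr (1 / 2) * rGamma (1 / 2) = 1"
  proof -
    have "complex_of_real pi powr (1 / 2) = of_real (sqrt pi)"
      using powr_of_real[of pi "1 / 2"] by (simp add: powr_half_sqrt)
    then show ?thesis by (simp add: rGamma_inverse_Gamma Gamma_one_half_complex)
  qed
  then show ?thesis using True by (simp add: E_def G_def mult_ac)
qed (simp add: E_def cj_def aj_def)

lemma E_at_p:
  assumes j: "j \<le> 1"
  shows "E j p = (p - 1) * (2 * (- \<i>) ^ j * of_real (2 * pi) powr (- (2 * lam - 1)) * trig j (2 * lam - 1) * Gamma (2 * lam - 1) *
     ((- 1) ^ j + \<i> powi l) * b 0)"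
proof -
  define u where "u = 2 * lam - 1"
  have e1: "(p + of_nat j) / 2 = (1 - u + of_nat j) / 2" by (simp add: p_def u_def)
  have e2: "(2 * lam + of_nat j - 1) / 2 = (u + of_nat j) / 2" by (simp add: u_def)
  have u: "u \<notin> \<int>\<^sub>\<le>\<^sub>0" using u_notin by (simp add: u_def)
  have "E j p = (p - 1) * (- \<i>) ^ j * ((- 1) ^ j + \<i> powi l) * b 0 *
    (of_real pi powr ((1 - u + of_nat j) / 2) * rGamma ((1 - u + of_nat j) / 2) *
      (of_real pi powr (- ((u + of_nat j) / 2)) * Gamma ((u + of_nat j) / 2)))"
    unfolding E_def G_def bj_def fourier_gauss_twist_0 flat_mellin_def e1 e2 by simp
  then show ?thesis unfolding gamma_factor[OF u j] u_def[symmetric] by (simp only: mult_ac)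
qed

lemma L_holomorphic: "L j holomorphic_on T"
proof -
  have "(\<lambda>s. p - s) holomorphic_on UNIV" by (intro holomorphic_intros)
  from holomorphic_on_compose_gen[OF this mellin_upper_bounded(2)[OF rapid_B]]
  have "(\<lambda>s. mellin_integral 1 (upper (B j)) (p - s)) holomorphic_on UNIV" by (simp add: o_def)
  then have "(\<lambda>s. mellin_integral 1 (upper (A j)) s + mellin_integral 1 (upper (B j)) (p - s)) holomorphic_on UNIV"
    by (intro holomorphic_on_add mellin_upper_bounded(2)[OF rapid_A])
  then show ?thesis unfolding L_def[abs_def] by (rule holomorphic_on_subset) simp
qed

lemma E_holomorphic: "E j holomorphic_on T"
proof -
  have "L j holomorphic_on T" by (rule L_holomorphic)
  then show ?thesis unfolding E_def[abs_def] G_def by (intro holomorphic_intros) auto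
qed

lemma xb_bounded:
  assumes "\<epsilon> \<in> {1, -1}"
  shows "\<exists>C. \<forall>s. Re s \<ge> real m + 2 \<longrightarrow> norm (xb \<epsilon> s) \<le> C"
proof (cases "\<epsilon> = 1")
  case True
  then have "xb \<epsilon> s = (\<Sum>n. b (int (Suc n)) * of_nat (Suc n) powr (- s))" for s by (simp add: xb_def xi_term_def)
  then show ?thesis using dirichlet_bounded[OF b_bound(1)] by presburger
next
  case False
  then have "xb \<epsilon> s = (\<Sum>n. b (- int (Suc n)) * of_nat (Suc n) powr (- s))" for s
    using assms by (simp add: xb_def xi_term_def)
  then show ?thesis using dirichlet_bounded[OF b_bound(2)] by presburger
qed

lemma order_one_V: "order_one_on {s. Re s \<ge> \<sigma>} V1" "order_one_on {s. Re s \<ge> \<sigma>} V2"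
proof -
  have m: "real m + 2 \<le> \<sigma>" "1 \<le> \<sigma>" unfolding \<sigma>_def K_def by auto
  have xb: "order_one_on {s. Re s \<ge> \<sigma>} (xb \<epsilon>)" if \<epsilon>: "\<epsilon> \<in> {1, -1}" for \<epsilon>
  proof -
    from xb_bounded[OF \<epsilon>] obtain C where "\<And>s. Re s \<ge> real m + 2 \<Longrightarrow> norm (xb \<epsilon> s) \<le> C" by blast
    then show ?thesis using m by (intro order_one_on_bounded[of _ _ C]) auto
  qed
  have g: "order_one_on {s. Re s \<ge> \<sigma>} Gamma"
    by (rule order_one_on_subset[OF order_one_on_Gamma]) (use m in auto)
  have pw: "order_one_on {s. Re s \<ge> \<sigma>} (\<lambda>s. of_real (2 * pi) powr (- s))"
    using order_one_on_powr[of "2 * pi" _ "- 1" 0] by simp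
  have ex: "order_one_on {s. Re s \<ge> \<sigma>} (\<lambda>s. exp (of_real pi * s * \<i> / 2))"
    "order_one_on {s. Re s \<ge> \<sigma>} (\<lambda>s. exp (- (of_real pi * s * \<i> / 2)))"
    using order_one_on_exp[of _ "of_real pi * \<i> / 2" 0] order_one_on_exp[of _ "- of_real pi * \<i> / 2" 0]
    by (simp_all add: mult_ac)
  show "order_one_on {s. Re s \<ge> \<sigma>} V1" "order_one_on {s. Re s \<ge> \<sigma>} V2"
    unfolding V1_def[abs_def] V2_def[abs_def]
    by (intro order_one_on_mult order_one_on_add pw g ex xb; simp)+
qed

lemma order_one_factor: "order_one_on T (\<lambda>s. (s - 1) * (s - p))"
proof -
  have "order_one_on T (\<lambda>s. (s + (- 1)) * (s + (- p)))"
    by (intro order_one_on_mult order_one_on_add order_one_on_ident order_one_on_const)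
  then show ?thesis by simp
qed

lemma order_one_right:
  assumes j: "j \<le> 1"
  shows "order_one_on {s. Re s \<ge> \<sigma> + 1} (E j)"
proof -
  have m: "real m + 2 \<le> \<sigma>" unfolding \<sigma>_def K_def by auto
  from dirichlet_bounded[OF coef_bound[of j]] obtain C where C: "\<And>s. Re s \<ge> real m + 2 \<Longrightarrow> norm (S j s) \<le> C"
    unfolding S_def by blast
  have "order_one_on {s. Re s \<ge> \<sigma> + 1} (\<lambda>s. (s - 1) * (s - p) * S j s)"
    by (intro order_one_on_mult[OF order_one_factor] order_one_on_bounded[of _ _ C] C) (use m in auto)
  then show ?thesis by (rule order_one_on_cong) (use E_right[OF j] in auto)
qed

lemma order_one_left:
  assumes j: "j \<le> 1"
  shows "order_one_on {s. Re (p - s) \<ge> \<sigma> + 1} (E j)"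
proof -
  define T where "T = {s. Re (p - s) \<ge> \<sigma> + 1}"
  have Re: "Re s \<le> 0" if "s \<in> T" for s
    using that complex_Re_le_cmod[of p] of_nat_0_le_iff[of K, where 'a = real] by (simp add: \<sigma>_def T_def)
  have V: "order_one_on T (\<lambda>s. V1 ((- 1) * s + p))" "order_one_on T (\<lambda>s. V2 ((- 1) * s + p))"
    by (rule order_one_on_affine[OF order_one_V(1)], simp add: T_def)
       (rule order_one_on_affine[OF order_one_V(2)], simp add: T_def)
  have g: "order_one_on T (\<lambda>s. Gamma ((- 1) * s + 1))"
    by (rule order_one_on_affine[OF order_one_on_Gamma]) (use Re in auto)
  have "order_one_on T (\<lambda>s. (s - 1) * (s - p) * (2 * (- \<i>) ^ j * of_real (2 * pi) powr (1 * s + (- 1)) *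
     trig j ((- 1) * s + 1) * Gamma ((- 1) * s + 1) * of_real (real N) powr ((- 1) * s + p) *
     ((- 1) ^ j * V1 ((- 1) * s + p) + \<i> powi l * V2 ((- 1) * s + p))))"
    using N by (intro order_one_on_mult[OF order_one_factor] order_one_on_mult order_one_on_add order_one_on_const
        order_one_on_powr order_one_on_trig V g) auto
  then show ?thesis unfolding T_def[symmetric]
    by (rule order_one_on_cong) (subst E_left[OF j], auto simp: T_def)
qed

lemma order_one_strip: "order_one_on {s. \<bar>Re s\<bar> \<le> R} (E j)"
proof -
  \<comment> \<open>The bound on \<open>rGamma\<close> needs imaginary part at least 1 in absolute
    value, and its argument is \<open>s / 2\<close> plus a real number, hence the 2. The rest of the
    strip is a compact rectangle.\<close>
  define T where "T = {s. \<bar>Re s\<bar> \<le> R \<and> \<bar>Im s\<bar> \<ge> 2}"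
  have rg: "order_one_on T (\<lambda>s. rGamma ((1 / 2) * s + v))" if "\<bar>Re v\<bar> \<le> real j + 1" "Im v = 0" for v
    by (rule order_one_on_affine[OF order_one_on_rGamma_strip[of "R + real j + 1"]]) (use that in \<open>auto simp: T_def\<close>)
  from mellin_upper_bounded(1)[OF rapid_A[of j], of R] obtain C1 where C1: "\<And>s. Re s \<le> R \<Longrightarrow> norm (mellin_integral 1 (upper (A j)) s) \<le> C1" by blast
  from mellin_upper_bounded(1)[OF rapid_B[of j], of "Re p + R"] obtain C2 where C2: "\<And>s. Re s \<le> Re p + R \<Longrightarrow> norm (mellin_integral 1 (upper (B j)) s) \<le> C2" by blast
  have "norm (L j s) \<le> C1 + C2" if "\<bar>Re s\<bar> \<le> R" for s
    unfolding L_def using that by (intro order_trans[OF norm_triangle_ineq] add_mono C1 C2) auto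
  then have L: "order_one_on T (L j)" by (intro order_one_on_bounded[of _ _ "C1 + C2"]) (auto simp: T_def)
  have lin: "order_one_on T (\<lambda>s. s - w)" for w
    using order_one_on_add[OF order_one_on_ident order_one_on_const[of _ "- w"]] by simp
  have r1: "order_one_on T (\<lambda>s. rGamma ((s + of_nat j) / 2))"
    using rg[of "of_nat j / 2"] by (simp add: add_divide_distrib)
  have r2: "order_one_on T (\<lambda>s. rGamma (s / 2 + 1))"
    using rg[of 1] by simp
  have g: "order_one_on T (G j)"
    unfolding G_def[abs_def] using order_one_on_powr[of pi T "1 / 2" "of_nat j / 2"]
    by (intro order_one_on_mult order_one_on_const) (simp_all add: add_divide_distrib)
  have "order_one_on T (\<lambda>s. G j s * ((s - 1) * (s - p) * rGamma ((s + of_nat j) / 2) * L j s +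
     rGamma ((s + of_nat j) / 2) * (cj j * (s - p) + bj j * (s - 1)) +
     (- aj j) * (s - 1) * (s - p) * (rGamma (s / 2 + 1) * (1 / 2))))"
    by (intro order_one_on_mult order_one_on_add order_one_on_const lin r1 r2 g L)
  then have 1: "order_one_on T (E j)" by (rule order_one_on_cong) (simp add: E_def)
  define T' where "T' = cbox (Complex (- R) (- 2)) (Complex R 2)"
  have "compact (E j ` T')"
    unfolding T'_def by (intro compact_continuous_image holomorphic_on_imp_continuous_on[OF E_holomorphic] compact_cbox)
  then obtain C where "\<And>s. s \<in> T' \<Longrightarrow> norm (E j s) \<le> C" by (meson bounded_iff compact_imp_bounded imageI)
  then have 2: "order_one_on T' (E j)" by (rule order_one_on_bounded)
  show ?thesis
    by (rule order_one_on_subset[OF order_one_on_union[OF 1 2]]) (auto simp: T_def T'_def in_cbox_complex_iff)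
qed

lemma order_one_E:
  assumes j: "j \<le> 1"
  shows "order_one_on UNIV (E j)"
proof -
  \<comment> \<open>Outside both half-planes
    \<open>Re p - \<sigma> - 1 < Re s < \<sigma> + 1\<close>, and
    \<open>\<bar>Re p\<bar> \<le> norm p\<close>.\<close>
  have "s \<in> {s. Re s \<ge> \<sigma> + 1} \<union> {s. Re (p - s) \<ge> \<sigma> + 1} \<union> {s. \<bar>Re s\<bar> \<le> \<sigma> + 1 + norm p}" for s
    using abs_Re_le_cmod[of p] unfolding Un_iff mem_Collect_eq minus_complex.sel by linarith
  then show ?thesis
    using order_one_on_union[OF order_one_on_union[OF order_one_right[OF j] order_one_left[OF j]] order_one_strip]
    by (rule_tac order_one_on_subset) blast+
qed

end

section \<open>Simple poles, residues and continuation of the functional equation\<close>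

lemma simple_pole:
  assumes T: "open T" "z \<in> T" and g: "g holomorphic_on T"
    and X: "\<And>w. w \<in> T \<Longrightarrow> w \<noteq> z \<Longrightarrow> X w = g w / (w - z)"
  shows "residue X z = g z" and "is_pole X z \<Longrightarrow> zorder X z = - 1"
proof -
  have ev: "\<forall>\<^sub>F w in at z. X w = g w / (w - z)"
    using eventually_at_in_open[OF T] by eventually_elim (use X in auto)
  then have "residue X z = residue (\<lambda>w. g w / (w - z)) z" by (rule residue_cong) simp
  then show "residue X z = g z" using residue_simple[OF T g] by simp
  assume pole: "is_pole X z"
  \<comment> \<open>Were \<open>g z = 0\<close>, the quotient would tend to \<open>deriv g z\<close>
    and \<open>X\<close> could not have a pole.\<close>
  have "g z \<noteq> 0"
  proof
    assume g0: "g z = 0"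
    have "(g has_field_derivative deriv g z) (at z)" using holomorphic_derivI[OF g T] .
    then have "((\<lambda>w. (g w - g z) / (w - z)) \<longlongrightarrow> deriv g z) (at z)" by (simp add: has_field_derivative_iff)
    then have "(X \<longlongrightarrow> deriv g z) (at z)"
      by (rule Lim_transform_eventually) (use ev g0 in \<open>auto elim!: eventually_mono\<close>)
    then show False using pole unfolding is_pole_def
      by (meson at_neq_bot not_tendsto_and_filterlim_at_infinity)
  qed
  then show "zorder X z = - 1"
    by (intro zorder_eqI[OF T g]) (auto simp: X power_int_minus divide_inverse)
qed

text \<open>\<open>remove_sings\<close> inserts limits at removable points and 0 at poles, which is
  the normal form demanded of the continuation. If \<open>E\<close> vanishes at 1 or
  \<open>p\<close>, there is no pole and the residue formula gives 0.\<close>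

lemma meromorphic_quotient:
  fixes E :: "complex \<Rightarrow> complex" and p :: complex
  assumes E: "E holomorphic_on UNIV" and p: "p \<noteq> 1"
  defines "X \<equiv> remove_sings (\<lambda>s. E s / ((s - 1) * (s - p)))"
  shows "X nicely_meromorphic_on UNIV"
    and "\<And>s. s \<notin> {1, p} \<Longrightarrow> X s = E s / ((s - 1) * (s - p))"
    and "\<And>z. is_pole X z \<Longrightarrow> z \<in> {p, 1} \<and> - zorder X z \<le> 1"
    and "residue X 1 = E 1 / (1 - p)" and "residue X p = E p / (p - 1)"
proof -
  define f where "f s = E s / ((s - 1) * (s - p))" for s
  have Ea: "E analytic_on T" for T using E by (meson analytic_on_holomorphic analytic_on_subset open_UNIV subset_UNIV)
  have "f meromorphic_on UNIV"
    unfolding f_def by (intro meromorphic_intros analytic_on_imp_meromorphic_on[OF Ea] analytic_on_imp_meromorphic_on analytic_intros)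
  then show "X nicely_meromorphic_on UNIV"
    unfolding X_def f_def[symmetric] by (rule remove_sings_nicely_meromorphic)
  show Xs: "X s = E s / ((s - 1) * (s - p))" if "s \<notin> {1, p}" for s
  proof -
    have "f analytic_on {s}" unfolding f_def using that by (intro analytic_intros Ea) auto
    then have "remove_sings f s = f s" by (rule remove_sings_at_analytic)
    then show ?thesis unfolding X_def f_def[abs_def] .
  qed
  have h1: "(\<lambda>s. E s / (s - p)) holomorphic_on - {p}"
    by (intro holomorphic_intros holomorphic_on_subset[OF E]) auto
  have hp: "(\<lambda>s. E s / (s - 1)) holomorphic_on - {1}"
    by (intro holomorphic_intros holomorphic_on_subset[OF E]) auto
  have X1: "X w = (E w / (w - p)) / (w - 1)" if "w \<in> - {p}" "w \<noteq> 1" for w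
    using that Xs[of w] by (simp add: mult.commute)
  have Xp: "X w = (E w / (w - 1)) / (w - p)" if "w \<in> - {1}" "w \<noteq> p" for w
    using that Xs[of w] by simp
  note r1 = simple_pole[of "- {p}" 1, OF _ _ h1 X1]
  note rp = simple_pole[of "- {1}" p, OF _ _ hp Xp]
  show "residue X 1 = E 1 / (1 - p)" using r1(1) p by (auto simp: open_delete)
  show "residue X p = E p / (p - 1)" using rp(1) p by (auto simp: open_delete)
  fix z assume pole: "is_pole X z"
  have z: "z \<in> {p, 1}"
  proof (rule ccontr)
    assume z: "z \<notin> {p, 1}"
    have "isCont E z" using holomorphic_on_imp_continuous_on[OF E] by (simp add: continuous_on_eq_continuous_at)
    then have "isCont f z" unfolding f_def using z by (intro continuous_intros) auto
    then have "f \<midarrow>z\<rightarrow> f z" by (simp add: isCont_def)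
    moreover have "open (- {1, p})" by (simp add: open_Compl)
    then have "\<forall>\<^sub>F w in at z. w \<in> - {1, p}" using z by (intro eventually_at_in_open') auto
    then have "\<forall>\<^sub>F w in at z. f w = X w" by eventually_elim (auto simp: Xs f_def)
    ultimately have "X \<midarrow>z\<rightarrow> f z" by (rule Lim_transform_eventually)
    then show False using pole unfolding is_pole_def
      by (meson at_neq_bot not_tendsto_and_filterlim_at_infinity)
  qed
  moreover have "zorder X z = - 1" using z r1(2) rp(2) pole p by (auto simp: open_delete)
  ultimately show "z \<in> {p, 1} \<and> - zorder X z \<le> 1" by simp
qed

text \<open>Multiplication by both reciprocal Gamma factors makes the two sides entire.\<close>

lemma functional_equation_continuation:
  assumes F: "F holomorphic_on UNIV" and H: "H holomorphic_on UNIV" and W: "W holomorphic_on UNIV"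
    and Q: "Q holomorphic_on UNIV" "Q' holomorphic_on UNIV"
    and eq: "\<And>s. Re s < \<sigma> \<Longrightarrow> Im s > 0 \<Longrightarrow> Gamma s * F s * Q' s = W s * (Gamma (p - s) * H (p - s)) * Q s"
    and \<sigma>: "\<sigma> \<le> Re p"
    and s: "s \<notin> \<int>\<^sub>\<le>\<^sub>0" "p - s \<notin> \<int>\<^sub>\<le>\<^sub>0"
  shows "Gamma s * F s * Q' s = W s * (Gamma (p - s) * H (p - s)) * Q s"
proof -
  define \<Phi> where "\<Phi> s = F s * Q' s * rGamma (p - s) - W s * H (p - s) * Q s * rGamma s" for s
  have Hc: "(\<lambda>s. H (p - s)) holomorphic_on UNIV"
  proof -
    have "(\<lambda>s. p - s) holomorphic_on UNIV" by (intro holomorphic_intros)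
    from holomorphic_on_compose_gen[OF this H] show ?thesis by (simp add: o_def)
  qed
  have \<Phi>: "\<Phi> holomorphic_on UNIV"
    unfolding \<Phi>_def using F Hc W Q by (intro holomorphic_intros) auto
  have rG: "Gamma z * rGamma z = 1" if "z \<notin> \<int>\<^sub>\<le>\<^sub>0" for z :: complex
    using that Gamma_eq_zero_iff[of z] by (simp add: rGamma_inverse_Gamma)
  have nz: "rGamma z \<noteq> 0" if "z \<notin> \<int>\<^sub>\<le>\<^sub>0" for z :: complex using rG[OF that] by auto
  define U where "U = {s. Re s < \<sigma>} \<inter> {s. Im s > 0}"
  have U: "open U" unfolding U_def by (intro open_Int open_halfspace_Re_lt open_halfspace_Im_gt)
  have Uz: "\<Phi> z = 0" if "z \<in> U" for z
  proof -
    \<comment> \<open>The positive imaginary part keeps \<open>z\<close> off the nonpositive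
      integers. As \<open>p\<close> may be non-real, \<open>p - z\<close> is kept off them by
      \<open>Re z < \<sigma> \<le> Re p\<close>.\<close>
    have z: "z \<notin> \<int>\<^sub>\<le>\<^sub>0" "p - z \<notin> \<int>\<^sub>\<le>\<^sub>0"
      using that \<sigma> by (auto simp: U_def elim!: nonpos_Ints_cases simp: complex_eq_iff)
    have "\<Phi> z = (Gamma z * rGamma z) * (F z * Q' z * rGamma (p - z)) - (Gamma (p - z) * rGamma (p - z)) * (W z * H (p - z) * Q z * rGamma z)"
      unfolding \<Phi>_def rG[OF z(1)] rG[OF z(2)] by simp
    also have "\<dots> = (Gamma z * F z * Q' z - W z * (Gamma (p - z) * H (p - z)) * Q z) * (rGamma z * rGamma (p - z))"
      by (simp add: algebra_simps)
    finally show ?thesis using eq[of z] that by (simp add: U_def)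
  qed
  have u: "Complex (\<sigma> - 1) 1 \<in> U" by (simp add: U_def)
  have "\<Phi> s = 0"
    by (rule analytic_continuation_open[where f = \<Phi> and g = "\<lambda>_. 0" and s = U and s' = UNIV])
       (use U u \<Phi> Uz in auto)
  have "Gamma s * F s * Q' s - W s * (Gamma (p - s) * H (p - s)) * Q s =
      Gamma s * Gamma (p - s) * \<Phi> s"
  proof -
    have "Gamma s * Gamma (p - s) * \<Phi> s = Gamma s * F s * Q' s * (Gamma (p - s) * rGamma (p - s)) -
      W s * (Gamma (p - s) * H (p - s)) * Q s * (Gamma s * rGamma s)"
      by (simp add: \<Phi>_def algebra_simps)
    then show ?thesis unfolding rG[OF s(1)] rG[OF s(2)] by simp
  qed
  then show ?thesis unfolding \<open>\<Phi> s = 0\<close> by simp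
qed

text \<open>For nonzero \<open>n\<close> the inequality
  \<open>1 + \<bar>n\<bar> \<le> 2 * \<bar>n\<bar>\<close> explains the powers of 2; adding
  constants and exponents serves both sequences.\<close>

lemma polynomial_growth_common_bound:
  assumes "polynomial_growth a" "polynomial_growth b"
  obtains D m where "\<And>n. norm (a (int (Suc n))) \<le> D * real (Suc n) ^ m" "\<And>n. norm (a (- int (Suc n))) \<le> D * real (Suc n) ^ m"
    "\<And>n. norm (b (int (Suc n))) \<le> D * real (Suc n) ^ m" "\<And>n. norm (b (- int (Suc n))) \<le> D * real (Suc n) ^ m"
proof -
  from assms obtain C1 k1 C2 k2 where
    C1: "\<And>n. norm (a n) \<le> C1 * (1 + \<bar>real_of_int n\<bar>) ^ k1" and
    C2: "\<And>n. norm (b n) \<le> C2 * (1 + \<bar>real_of_int n\<bar>) ^ k2" unfolding polynomial_growth_def by metis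
  define D where "D = \<bar>C1\<bar> * 2 ^ k1 + \<bar>C2\<bar> * 2 ^ k2"
  have key: "C * (1 + \<bar>real_of_int i\<bar>) ^ k \<le> D * real (Suc n) ^ (k1 + k2)"
    if "\<bar>real_of_int i\<bar> = real (Suc n)" "\<bar>C\<bar> * 2 ^ k \<le> D" "k \<le> k1 + k2" for C k i n
  proof -
    have "C * (1 + \<bar>real_of_int i\<bar>) ^ k \<le> \<bar>C\<bar> * (2 * real (Suc n)) ^ k"
      using that(1) by (intro mult_mono power_mono) auto
    also have "\<dots> = (\<bar>C\<bar> * 2 ^ k) * real (Suc n) ^ k" by (simp only: power_mult_distrib mult.assoc)
    also have "\<dots> \<le> D * real (Suc n) ^ (k1 + k2)"
      using that by (intro mult_mono power_increasing) (auto simp: D_def)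
    finally show ?thesis .
  qed
  have D: "\<bar>C1\<bar> * 2 ^ k1 \<le> D" "\<bar>C2\<bar> * 2 ^ k2 \<le> D" by (auto simp: D_def)
  show ?thesis
  proof (rule that[of D "k1 + k2"])
    fix n
    show "norm (a (int (Suc n))) \<le> D * real (Suc n) ^ (k1 + k2)"
      by (rule order_trans[OF C1 key]) (use D in auto)
    show "norm (a (- int (Suc n))) \<le> D * real (Suc n) ^ (k1 + k2)"
      by (rule order_trans[OF C1 key]) (use D in auto)
    show "norm (b (int (Suc n))) \<le> D * real (Suc n) ^ (k1 + k2)"
      by (rule order_trans[OF C2 key]) (use D in auto)
    show "norm (b (- int (Suc n))) \<le> D * real (Suc n) ^ (k1 + k2)"
      by (rule order_trans[OF C2 key]) (use D in auto)
  qed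
qed

section \<open>Recombination of the two parities into each Dirichlet series\<close>

context theta_datum
begin

text \<open>The even and odd parts recombine to \<open>(s - 1) * (s - p)\<close> times the continued
  series of sign \<open>\<epsilon>\<close>.\<close>

definition EE :: "int \<Rightarrow> complex \<Rightarrow> complex" where
  "EE \<epsilon> s = (E 0 s + of_int \<epsilon> * E 1 s) / 2"

lemma EE_holomorphic: "EE \<epsilon> holomorphic_on T"
  unfolding EE_def[abs_def] by (intro holomorphic_intros E_holomorphic) auto

lemma EE_order: "entire_order (EE \<epsilon>) \<le> 1"
proof (rule entire_order_le_1)
  have "order_one_on UNIV (\<lambda>s. (E 0 s + of_int \<epsilon> * E 1 s) * (1 / 2))"
    by (intro order_one_on_mult order_one_on_add order_one_on_const order_one_E) auto
  then show "order_one_on UNIV (EE \<epsilon>)" by (simp add: EE_def[abs_def])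
qed

lemma EE_right:
  assumes \<epsilon>: "\<epsilon> \<in> {1, -1}" and s: "Re s > \<sigma>"
  shows "summable (\<lambda>n. norm (xi_term a \<epsilon> s n))" and "EE \<epsilon> s = (s - 1) * (s - p) * (\<Sum>n. xi_term a \<epsilon> s n)"
proof -
  have m: "Re s \<ge> real m + 2" using s norm_ge_zero[of p] of_nat_0_le_iff[of k, where 'a = real] unfolding \<sigma>_def K_def of_nat_add by linarith
  have sp: "summable (\<lambda>n. norm (xi_term a 1 s n))" "summable (\<lambda>n. norm (xi_term a (- 1) s n))"
    using summable_norm_dirichlet[OF a_bound(1) m] summable_norm_dirichlet[OF a_bound(2) m] by (simp_all add: xi_term_def)
  then show "summable (\<lambda>n. norm (xi_term a \<epsilon> s n))" using \<epsilon> by auto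
  have S: "S j s = (\<Sum>n. xi_term a 1 s n) + (- 1) ^ j * (\<Sum>n. xi_term a (- 1) s n)" for j
  proof -
    have "(\<lambda>n. coef j n * of_nat (Suc n) powr (- s)) = (\<lambda>n. xi_term a 1 s n + (- 1) ^ j * xi_term a (- 1) s n)"
      by (simp add: coef_def xi_term_def algebra_simps)
    then show ?thesis unfolding S_def
      using suminf_add[OF summable_norm_cancel[OF sp(1)] summable_mult[OF summable_norm_cancel[OF sp(2)], of "(- 1) ^ j"]]
        suminf_mult[OF summable_norm_cancel[OF sp(2)], of "(- 1) ^ j"] by simp
  qed
  show "EE \<epsilon> s = (s - 1) * (s - p) * (\<Sum>n. xi_term a \<epsilon> s n)"
    using \<epsilon> unfolding EE_def E_right[OF le0 s] E_right[OF order_refl s] S by (auto simp: field_simps)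
qed

lemma EE_at_1: "EE \<epsilon> 1 = (1 - p) * c"
  unfolding EE_def E_at_1[OF le0] E_at_1[OF order_refl] by (simp add: cj_def)

text \<open>Written in exponentials, the cosine for \<open>j = 0\<close> and the sine for
  \<open>j = 1\<close> partly cancel in the combination for \<open>\<epsilon>\<close>, leaving one
  exponential for each of the coefficients 1 and \<open>\<i> powi l\<close>.\<close>

lemma EE_at_p:
  assumes \<epsilon>: "\<epsilon> \<in> {1, -1}"
  shows "EE \<epsilon> p = (p - 1) * (of_int \<epsilon> * \<i> * of_real (2 * pi) powr (- (2 * lam - 1)) * Gamma (2 * lam - 1) *
    (\<i> powi l * exp (- of_int \<epsilon> * lam * of_real pi * \<i>) - exp (of_int \<epsilon> * lam * of_real pi * \<i>)) * b 0)"
proof -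
  define x where "x = of_real pi * (2 * lam - 1) / 2"
  define P where "P = exp (lam * of_real pi * \<i>)"
  define Q where "Q = exp (- (lam * of_real pi * \<i>))"
  have half: "exp (\<i> * of_real pi / 2) = \<i>" using cis_conv_exp[of "pi / 2"] by simp
  have e1: "exp (\<i> * x) = - \<i> * P"
  proof -
    have "\<i> * x = lam * of_real pi * \<i> - \<i> * of_real pi / 2" by (simp add: x_def field_simps)
    then show ?thesis by (simp add: exp_diff P_def half)
  qed
  have e2: "exp (- (\<i> * x)) = \<i> * Q"
  proof -
    have eq: "- (\<i> * x) = - (lam * of_real pi * \<i>) + \<i> * of_real pi / 2" by (simp add: x_def field_simps)
    show ?thesis unfolding eq exp_add half Q_def by (rule mult.commute)
  qed
  have t0: "trig 0 (2 * lam - 1) = (- \<i> * P + \<i> * Q) / 2"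
    unfolding trig_def x_def[symmetric] using e1 e2 by (simp add: cos_exp_eq)
  have t1: "trig 1 (2 * lam - 1) = (- \<i> * P - \<i> * Q) / (2 * \<i>)"
    unfolding trig_def x_def[symmetric] using e1 e2 by (simp add: sin_exp_eq)
  define M where "M = of_real (2 * pi) powr (- (2 * lam - 1)) * Gamma (2 * lam - 1) * b 0"
  have "EE \<epsilon> p = (p - 1) * M * (trig 0 (2 * lam - 1) * (1 + \<i> powi l) - of_int \<epsilon> * \<i> * trig 1 (2 * lam - 1) * (- 1 + \<i> powi l))"
    unfolding EE_def E_at_p[OF le0] E_at_p[OF order_refl] M_def by (simp add: field_simps)
  also have "\<dots> = (p - 1) * M * (of_int \<epsilon> * \<i> * (\<i> powi l * (if \<epsilon> = 1 then Q else P) - (if \<epsilon> = 1 then P else Q)))"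
    using \<epsilon> unfolding t0 t1 by (auto simp: field_simps)
  also have "(if \<epsilon> = 1 then Q else P) = exp (- of_int \<epsilon> * lam * of_real pi * \<i>)" using \<epsilon> by (auto simp: P_def Q_def)
  also have "(if \<epsilon> = 1 then P else Q) = exp (of_int \<epsilon> * lam * of_real pi * \<i>)" using \<epsilon> by (auto simp: P_def Q_def)
  finally show ?thesis unfolding M_def by (simp only: mult_ac)
qed

text \<open>The rows of \<open>gamma_matrix\<close> recombine the parities with weights
  \<open>cos x\<close> and \<open>\<i> * sin x\<close>. What remains carries
  \<open>2 * sin x * cos x = sin (pi * s)\<close>, which cancels against the reflection formula for
  \<open>Gamma s * Gamma (1 - s)\<close>.\<close>

lemma EE_left:
  assumes s: "Re (p - s) > \<sigma>" and im: "Im s > 0"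
  defines "e \<equiv> exp (of_real pi * s * \<i> / 2)" and "e' \<equiv> exp (- (of_real pi * s * \<i> / 2))"
  shows "of_real (2 * pi) powr (- s) * Gamma s * (e * EE 1 s + e' * EE (- 1) s) =
      (s - 1) * (s - p) * (of_nat N powr (p - s) * (\<i> powi l * V2 (p - s)))"
    and "of_real (2 * pi) powr (- s) * Gamma s * (e' * EE 1 s + e * EE (- 1) s) =
      (s - 1) * (s - p) * (of_nat N powr (p - s) * V1 (p - s))"
proof -
  define x where "x = of_real pi * s / 2"
  have ee: "e = cos x + \<i> * sin x" "e' = cos x - \<i> * sin x"
  proof -
    have "e = exp (\<i> * x)" by (simp add: e_def x_def mult_ac)
    then show "e = cos x + \<i> * sin x" by (simp add: exp_Euler)
    have "e' = exp (- (\<i> * x))" by (simp add: e'_def x_def mult_ac)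
    then show "e' = cos x - \<i> * sin x" by (simp add: exp_minus_Euler)
  qed
  have eq: "of_real pi * (1 - s) / 2 = of_real pi / 2 - x" by (simp add: x_def field_simps)
  have t: "trig 0 (1 - s) = sin x" "trig 1 (1 - s) = cos x"
    unfolding trig_def eq using sin_cos_eq[of x] cos_sin_eq[of x] by simp_all
  define Q where "Q = 2 * of_real (2 * pi) powr (- (1 - s)) * Gamma (1 - s) * of_nat N powr (p - s)"
  define X where "X = (s - 1) * (s - p)"
  have E0: "E 0 s = X * Q * (sin x * (V1 (p - s) + \<i> powi l * V2 (p - s)))"
    unfolding E_left[OF le0 s] t Q_def X_def by (simp add: mult_ac)
  have E1: "E 1 s = X * Q * (- \<i> * cos x * (- V1 (p - s) + \<i> powi l * V2 (p - s)))"
    unfolding E_left[OF order_refl s] t Q_def X_def by (simp add: mult_ac)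
  \<comment> \<open>Off the real axis \<open>sin (pi * s)\<close> has no zero, so it may be
    cancelled after reflection.\<close>
  have "s \<notin> \<int>" using im by (auto elim!: Ints_cases)
  have sn: "sin (of_real pi * s) \<noteq> 0"
  proof
    assume "sin (of_real pi * s) = 0"
    then have "s \<in> \<int>" by (subst (asm) sin_eq_0) (auto simp: field_simps)
    then show False using \<open>s \<notin> \<int>\<close> by simp
  qed
  have refl: "Gamma s * Gamma (1 - s) = of_real pi / sin (of_real pi * s)" by (rule Gamma_reflection_complex)
  have pw: "of_real (2 * pi) powr (- s) * of_real (2 * pi) powr (- (1 - s)) = 1 / complex_of_real (2 * pi)"
  proof -
    have "complex_of_real (2 * pi) powr (- s + - (1 - s)) = of_real (2 * pi) powr (- s) * of_real (2 * pi) powr (- (1 - s))"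
      by (rule powr_add)
    moreover have "- s + - (1 - s) = - 1" by simp
    moreover have "complex_of_real (2 * pi) powr (- 1) = 1 / of_real (2 * pi)"
      using powr_minus[of "complex_of_real (2 * pi)" 1] by (simp only: powr_one divide_inverse mult_1 powr_to_1)
    ultimately show ?thesis by (simp only:)
  qed
  have s2: "2 * sin x * cos x = sin (of_real pi * s)" using sin_double[of x] by (simp add: x_def)
  have norm: "of_real (2 * pi) powr (- s) * Gamma s * Q * (2 * sin x * cos x) = 2 * of_nat N powr (p - s) / 2"
  proof -
    have "of_real (2 * pi) powr (- s) * Gamma s * Q * (2 * sin x * cos x) =
      2 * (of_real (2 * pi) powr (- s) * of_real (2 * pi) powr (- (1 - s))) * (Gamma s * Gamma (1 - s)) * sin (of_real pi * s) * of_nat N powr (p - s)"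
      unfolding Q_def s2 by (simp only: mult_ac)
    then show ?thesis unfolding pw refl using sn by simp
  qed
  have "e * EE 1 s + e' * EE (- 1) s = cos x * E 0 s + \<i> * sin x * E 1 s"
    unfolding EE_def ee by (simp add: field_simps)
  also have "\<dots> = X * Q * (2 * sin x * cos x) * (\<i> powi l * V2 (p - s))"
    unfolding E0 E1 by (simp add: algebra_simps)
  finally have 1: "of_real (2 * pi) powr (- s) * Gamma s * (e * EE 1 s + e' * EE (- 1) s) =
     X * (of_real (2 * pi) powr (- s) * Gamma s * Q * (2 * sin x * cos x)) * (\<i> powi l * V2 (p - s))" by (simp only: mult_ac)
  show "of_real (2 * pi) powr (- s) * Gamma s * (e * EE 1 s + e' * EE (- 1) s) =
      (s - 1) * (s - p) * (of_nat N powr (p - s) * (\<i> powi l * V2 (p - s)))"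
    unfolding 1 norm X_def by simp
  have "e' * EE 1 s + e * EE (- 1) s = cos x * E 0 s - \<i> * sin x * E 1 s"
    unfolding EE_def ee by (simp add: field_simps)
  also have "\<dots> = X * Q * (2 * sin x * cos x) * V1 (p - s)"
    unfolding E0 E1 by (simp add: algebra_simps)
  finally have 2: "of_real (2 * pi) powr (- s) * Gamma s * (e' * EE 1 s + e * EE (- 1) s) =
     X * (of_real (2 * pi) powr (- s) * Gamma s * Q * (2 * sin x * cos x)) * V1 (p - s)" by (simp only: mult_ac)
  show "of_real (2 * pi) powr (- s) * Gamma s * (e' * EE 1 s + e * EE (- 1) s) =
      (s - 1) * (s - p) * (of_nat N powr (p - s) * V1 (p - s))"
    unfolding 2 norm X_def by simp
qed

lemma meromorphic_continuation:
  assumes \<epsilon>: "\<epsilon> \<in> {1, -1}"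
  defines "X \<equiv> remove_sings (\<lambda>s. EE \<epsilon> s / ((s - 1) * (s - p)))"
  shows "meromorphic_continuation_xi a \<epsilon> X"
    and "\<And>z. is_pole X z \<Longrightarrow> z \<in> {p, 1} \<and> - zorder X z \<le> 1"
    and "residue X 1 = c"
    and "residue X p = of_int \<epsilon> * \<i> * of_real (2 * pi) powr (- (2 * lam - 1)) * Gamma (2 * lam - 1) *
      (\<i> powi l * exp (- of_int \<epsilon> * lam * of_real pi * \<i>) - exp (of_int \<epsilon> * lam * of_real pi * \<i>)) * b 0"
    and "\<And>s. s \<notin> {1, p} \<Longrightarrow> EE \<epsilon> s = (s - 1) * (s - p) * X s"
proof -
  note Q = meromorphic_quotient[OF EE_holomorphic[of \<epsilon>] p_ne_1, folded X_def]
  have p1: "1 - p \<noteq> 0" "p - 1 \<noteq> 0" using p_ne_1 by auto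
  show EE: "EE \<epsilon> s = (s - 1) * (s - p) * X s" if "s \<notin> {1, p}" for s
    using Q(2)[OF that] that by auto
  have "X s = (\<Sum>n. xi_term a \<epsilon> s n)" if "Re s > \<sigma>" for s
  proof -
    have "s \<notin> {1, p}" using that Re_p_less_sigma by auto
    then show ?thesis using Q(2)[of s] EE_right(2)[OF \<epsilon> that] by auto
  qed
  then show "meromorphic_continuation_xi a \<epsilon> X"
    unfolding meromorphic_continuation_xi_def using Q(1) EE_right(1)[OF \<epsilon>] by blast
  show "\<And>z. is_pole X z \<Longrightarrow> z \<in> {p, 1} \<and> - zorder X z \<le> 1" by (rule Q(3))
  show "residue X 1 = c" using Q(4) EE_at_1 p1 by simp
  show "residue X p = of_int \<epsilon> * \<i> * of_real (2 * pi) powr (- (2 * lam - 1)) * Gamma (2 * lam - 1) *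
      (\<i> powi l * exp (- of_int \<epsilon> * lam * of_real pi * \<i>) - exp (of_int \<epsilon> * lam * of_real pi * \<i>)) * b 0"
    unfolding Q(5) EE_at_p[OF \<epsilon>] using p1 by simp
qed

end

text \<open>The functional equation is an identity of meromorphic functions; as a pointwise
  statement it is made off the points where a factor may have a pole and then carries a conventional
  value. For the same reason the entire functions in the last part are compared with the products
  off 1 and \<open>2 - 2 * lam\<close>.\<close>

theorem theorem3p4:
  fixes lam :: complex and l :: int and N :: nat
    and \<alpha> \<beta> :: "int \<Rightarrow> complex" and \<alpha>_inf \<beta>_inf :: complex
  assumes N: "N > 0"
    and growth_\<alpha>: "polynomial_growth \<alpha>"
    and growth_\<beta>: "polynomial_growth \<beta>"
    and lam_cond: "\<And>k::nat. lam \<noteq> 1 / 2 - of_nat k / 2"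
    and summation: "\<And>f. f \<in> V_infty lam l \<Longrightarrow>
      \<alpha>_inf * at_inf lam l f + (\<Sum>\<^sub>\<infinity>n. \<alpha> n * fourier lam f (of_int n)) =
      \<beta>_inf * at_inf lam l (twist lam l f) +
        (\<Sum>\<^sub>\<infinity>n. \<beta> n * fourier lam (twist lam l f) (of_int n / of_nat N))"
  shows "\<exists>\<xi>\<alpha> \<xi>\<beta> :: int \<Rightarrow> complex \<Rightarrow> complex.
    (\<forall>\<epsilon>\<in>{1, -1}.
       meromorphic_continuation_xi \<alpha> \<epsilon> (\<xi>\<alpha> \<epsilon>) \<and>
       meromorphic_continuation_xi \<beta> \<epsilon> (\<xi>\<beta> \<epsilon>) \<and>
       (\<forall>z. is_pole (\<xi>\<alpha> \<epsilon>) z \<longrightarrow> z \<in> {2 - 2 * lam, 1} \<and> - zorder (\<xi>\<alpha> \<epsilon>) z \<le> 1) \<and>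
       (\<forall>z. is_pole (\<xi>\<beta> \<epsilon>) z \<longrightarrow> z \<in> {2 - 2 * lam, 1} \<and> - zorder (\<xi>\<beta> \<epsilon>) z \<le> 1) \<and>
       residue (\<xi>\<alpha> \<epsilon>) 1 = \<i> powi l * \<beta>_inf \<and>
       residue (\<xi>\<alpha> \<epsilon>) (2 - 2 * lam) =
         of_int \<epsilon> * \<i> * of_real (2 * pi) powr (- (2 * lam - 1)) * Gamma (2 * lam - 1) *
         (\<i> powi l * exp (- of_int \<epsilon> * lam * of_real pi * \<i>) - exp (of_int \<epsilon> * lam * of_real pi * \<i>)) *
         \<beta> 0 \<and>
       residue (\<xi>\<beta> \<epsilon>) 1 = \<alpha>_inf / of_nat N \<and>
       residue (\<xi>\<beta> \<epsilon>) (2 - 2 * lam) =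
         - of_int \<epsilon> * \<i> * of_nat N powr (2 * lam - 2) *
         of_real (2 * pi) powr (- (2 * lam - 1)) * Gamma (2 * lam - 1) *
         (\<i> powi (- l) * exp (of_int \<epsilon> * of_real pi * \<i> * lam) - exp (- of_int \<epsilon> * of_real pi * \<i> * lam)) *
         \<alpha> 0) \<and>
    (\<forall>s. {s, 2 - 2 * lam - s} \<inter> ({1, 2 - 2 * lam} \<union> \<int>\<^sub>\<le>\<^sub>0) = {} \<longrightarrow>
       gamma_matrix s *v vector [completed (\<xi>\<alpha> 1) s, completed (\<xi>\<alpha> (-1)) s] =
       of_nat N powr (2 - 2 * lam - s) *s
         (Sigma_matrix l *v (gamma_matrix (2 - 2 * lam - s) *v
           vector [completed (\<xi>\<beta> 1) (2 - 2 * lam - s), completed (\<xi>\<beta> (-1)) (2 - 2 * lam - s)]))) \<and>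
    (\<forall>\<epsilon>\<in>{1, -1}. \<forall>X\<in>{\<xi>\<alpha> \<epsilon>, \<xi>\<beta> \<epsilon>}.
       \<exists>E. E holomorphic_on UNIV \<and>
           (\<forall>s. s \<notin> {1, 2 - 2 * lam} \<longrightarrow> E s = (s - 1) * (s + 2 * lam - 2) * X s) \<and>
           entire_order E \<le> 1)"
proof -
  \<comment> \<open>The factor with which \<open>\<alpha>\<close> enters the exchanged theta
    relation.\<close>
  define \<kappa> where "\<kappa> = \<i> powi (- l) * of_nat N powr (2 * lam - 2)"
  define b' where "b' n = \<kappa> * \<alpha> n" for n
  have growth_b': "polynomial_growth b'"
  proof -
    from growth_\<alpha> obtain C i where C: "\<And>n. norm (\<alpha> n) \<le> C * (1 + \<bar>real_of_int n\<bar>) ^ i"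
      unfolding polynomial_growth_def by blast
    have "norm (b' n) \<le> (norm \<kappa> * C) * (1 + \<bar>real_of_int n\<bar>) ^ i" for n
      using mult_left_mono[OF C[of n] norm_ge_zero[of \<kappa>]] by (simp add: b'_def norm_mult mult_ac)
    then show ?thesis unfolding polynomial_growth_def by blast
  qed
  have thA: "theta_relation lam l N \<alpha> \<beta> (\<i> powi l * \<beta>_inf)"
    and thB: "theta_relation lam l N \<beta> b' (\<alpha>_inf / of_nat N)"
    using theta_relations[OF N summation] by (auto simp: b'_def[abs_def] \<kappa>_def)
  obtain D1 m1 where D1:
    "\<And>n. norm (\<alpha> (int (Suc n))) \<le> D1 * real (Suc n) ^ m1" "\<And>n. norm (\<alpha> (- int (Suc n))) \<le> D1 * real (Suc n) ^ m1"
    "\<And>n. norm (\<beta> (int (Suc n))) \<le> D1 * real (Suc n) ^ m1" "\<And>n. norm (\<beta> (- int (Suc n))) \<le> D1 * real (Suc n) ^ m1"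
    using polynomial_growth_common_bound[OF growth_\<alpha> growth_\<beta>] by blast
  obtain D2 m2 where D2:
    "\<And>n. norm (\<beta> (int (Suc n))) \<le> D2 * real (Suc n) ^ m2" "\<And>n. norm (\<beta> (- int (Suc n))) \<le> D2 * real (Suc n) ^ m2"
    "\<And>n. norm (b' (int (Suc n))) \<le> D2 * real (Suc n) ^ m2" "\<And>n. norm (b' (- int (Suc n))) \<le> D2 * real (Suc n) ^ m2"
    using polynomial_growth_common_bound[OF growth_\<beta> growth_b'] by blast
  interpret A: theta_datum lam l N \<alpha> \<beta> "\<i> powi l * \<beta>_inf" D1 m1
    by unfold_locales (fact N D1 lam_cond thA)+
  interpret B: theta_datum lam l N \<beta> b' "\<alpha>_inf / of_nat N" D2 m2
    by unfold_locales (fact N D2 lam_cond thB)+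
  define p where "p = 2 - 2 * lam"
  have Ap: "A.p = p" by (simp only: A.p_def p_def)
  define XA where "XA \<epsilon> = remove_sings (\<lambda>s. A.EE \<epsilon> s / ((s - 1) * (s - p)))" for \<epsilon>
  define XB where "XB \<epsilon> = remove_sings (\<lambda>s. B.EE \<epsilon> s / ((s - 1) * (s - p)))" for \<epsilon>
  note contA = A.meromorphic_continuation[unfolded Ap, folded XA_def]
  note contB = B.meromorphic_continuation[unfolded Ap, folded XB_def]
  define e where "e s = exp (of_real pi * s * \<i> / 2)" for s
  define e' where "e' s = exp (- (of_real pi * s * \<i> / 2))" for s
  define Q where "Q s = (s - 1) * (s - p)" for s :: complex
  define T where "T s = complex_of_real (2 * pi) powr (- s)" for s
  \<comment> \<open>To the left of \<open>\<sigma>0\<close> the identities of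
    \<open>A.EE_left\<close> are available at \<open>s\<close> off the real axis, and the Dirichlet
    series of \<open>\<beta>\<close> converges at \<open>p - s\<close>.\<close>
  define \<sigma>0 where "\<sigma>0 = Re p - max A.\<sigma> B.\<sigma>"
  have \<sigma>0: "\<sigma>0 \<le> Re p" using A.Re_p_less_sigma by (simp add: \<sigma>0_def)
  have hol: "e holomorphic_on UNIV" "e' holomorphic_on UNIV" "Q holomorphic_on UNIV" "T holomorphic_on UNIV"
    "(\<lambda>s. Q (p - s)) holomorphic_on UNIV" "(\<lambda>s. of_nat N powr (p - s) * u) holomorphic_on UNIV" for u
    unfolding e_def e'_def Q_def T_def using N by (auto intro!: holomorphic_intros)
  have combo: "(\<lambda>s. T s * (f s * g s + h s * k s)) holomorphic_on UNIV"
    if "f holomorphic_on UNIV" "g holomorphic_on UNIV" "h holomorphic_on UNIV" "k holomorphic_on UNIV" for f g h k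
    using that hol(4) by (intro holomorphic_intros)
  \<comment> \<open>This links the two instances: the continuation of the \<open>\<beta>\<close>
    series built from the second relation agrees, where the series converges, with the series inside
    \<open>A.V1\<close> and \<open>A.V2\<close>.\<close>
  have BEE: "B.EE \<epsilon> z = Q z * A.xb \<epsilon> z" if "\<epsilon> \<in> {1, -1}" "Re z > B.\<sigma>" for \<epsilon> z
    using B.EE_right(2)[OF that] unfolding Ap A.xb_def Q_def .
  have region: "Re (p - s) > A.\<sigma>" "Re (p - s) > B.\<sigma>" if "Re s < \<sigma>0" for s
    using that unfolding \<sigma>0_def by auto
  \<comment> \<open>Cross-multiplying by \<open>Q (p - s)\<close> and \<open>Q s\<close> clears the
    poles at 1 and \<open>p\<close>, so that apart from the Gamma values only entire functions are
    compared.\<close>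
  have fe1: "Gamma s * (T s * (e s * A.EE 1 s + e' s * A.EE (- 1) s)) * Q (p - s) =
      (of_nat N powr (p - s) * \<i> powi l) * (Gamma (p - s) * (T (p - s) * (e' (p - s) * B.EE 1 (p - s) + e (p - s) * B.EE (- 1) (p - s)))) * Q s"
    if s: "s \<notin> \<int>\<^sub>\<le>\<^sub>0" "p - s \<notin> \<int>\<^sub>\<le>\<^sub>0" for s
  proof (rule functional_equation_continuation[where
        F = "\<lambda>s. T s * (e s * A.EE 1 s + e' s * A.EE (- 1) s)" and
        H = "\<lambda>s. T s * (e' s * B.EE 1 s + e s * B.EE (- 1) s)" and
        W = "\<lambda>s. of_nat N powr (p - s) * \<i> powi l" and Q = Q and Q' = "\<lambda>s. Q (p - s)", OF _ _ _ _ _ _ \<sigma>0 s])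
    fix z assume z: "Re z < \<sigma>0" "Im z > 0"
    have "Gamma z * (T z * (e z * A.EE 1 z + e' z * A.EE (- 1) z)) =
        Q z * (of_nat N powr (p - z) * (\<i> powi l * A.V2 (p - z)))"
      using A.EE_left(1)[unfolded Ap, OF region(1)[OF z(1)] z(2)] unfolding e_def e'_def Q_def T_def by (simp only: mult_ac)
    moreover have "Gamma (p - z) * (T (p - z) * (e' (p - z) * B.EE 1 (p - z) + e (p - z) * B.EE (- 1) (p - z))) = Q (p - z) * A.V2 (p - z)"
      using BEE[of 1, OF _ region(2)[OF z(1)]] BEE[of "- 1", OF _ region(2)[OF z(1)]]
      unfolding A.V2_def e_def e'_def T_def by (simp add: algebra_simps)
    ultimately show "Gamma z * (T z * (e z * A.EE 1 z + e' z * A.EE (- 1) z)) * Q (p - z) =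
      (of_nat N powr (p - z) * \<i> powi l) * (Gamma (p - z) * (T (p - z) * (e' (p - z) * B.EE 1 (p - z) + e (p - z) * B.EE (- 1) (p - z)))) * Q z"
      by (simp only: mult_ac)
  qed (intro combo hol A.EE_holomorphic B.EE_holomorphic)+
  have fe2: "Gamma s * (T s * (e' s * A.EE 1 s + e s * A.EE (- 1) s)) * Q (p - s) =
      (of_nat N powr (p - s) * 1) * (Gamma (p - s) * (T (p - s) * (e (p - s) * B.EE 1 (p - s) + e' (p - s) * B.EE (- 1) (p - s)))) * Q s"
    if s: "s \<notin> \<int>\<^sub>\<le>\<^sub>0" "p - s \<notin> \<int>\<^sub>\<le>\<^sub>0" for s
  proof (rule functional_equation_continuation[where
        F = "\<lambda>s. T s * (e' s * A.EE 1 s + e s * A.EE (- 1) s)" and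
        H = "\<lambda>s. T s * (e s * B.EE 1 s + e' s * B.EE (- 1) s)" and
        W = "\<lambda>s. of_nat N powr (p - s) * 1" and Q = Q and Q' = "\<lambda>s. Q (p - s)", OF _ _ _ _ _ _ \<sigma>0 s])
    fix z assume z: "Re z < \<sigma>0" "Im z > 0"
    have "Gamma z * (T z * (e' z * A.EE 1 z + e z * A.EE (- 1) z)) =
        Q z * (of_nat N powr (p - z) * A.V1 (p - z))"
      using A.EE_left(2)[unfolded Ap, OF region(1)[OF z(1)] z(2)] unfolding e_def e'_def Q_def T_def by (simp only: mult_ac)
    moreover have "Gamma (p - z) * (T (p - z) * (e (p - z) * B.EE 1 (p - z) + e' (p - z) * B.EE (- 1) (p - z))) = Q (p - z) * A.V1 (p - z)"
      using BEE[of 1, OF _ region(2)[OF z(1)]] BEE[of "- 1", OF _ region(2)[OF z(1)]]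
      unfolding A.V1_def e_def e'_def T_def by (simp add: algebra_simps)
    ultimately show "Gamma z * (T z * (e' z * A.EE 1 z + e z * A.EE (- 1) z)) * Q (p - z) =
      (of_nat N powr (p - z) * 1) * (Gamma (p - z) * (T (p - z) * (e (p - z) * B.EE 1 (p - z) + e' (p - z) * B.EE (- 1) (p - z)))) * Q z"
      by (simp only: mult_ac mult_1 mult_1_right)
  qed (intro combo hol A.EE_holomorphic B.EE_holomorphic)+
  have row: "Gamma s * (T s * (f s * A.EE 1 s + g s * A.EE (- 1) s)) = Q s * (f s * completed (XA 1) s + g s * completed (XA (- 1)) s)"
    "Gamma s * (T s * (f s * B.EE 1 s + g s * B.EE (- 1) s)) = Q s * (f s * completed (XB 1) s + g s * completed (XB (- 1)) s)"
    if "s \<notin> {1, p}" for f g s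
    unfolding contA(5)[of 1, OF _ that, simplified] contA(5)[of "- 1", OF _ that, simplified]
      contB(5)[of 1, OF _ that, simplified] contB(5)[of "- 1", OF _ that, simplified] completed_def T_def Q_def
    by (simp_all only: ring_distribs mult_ac)
  have FE: "e s * completed (XA 1) s + e' s * completed (XA (- 1)) s =
      of_nat N powr (p - s) * (\<i> powi l * (e' (p - s) * completed (XB 1) (p - s) + e (p - s) * completed (XB (- 1)) (p - s)))"
    "e' s * completed (XA 1) s + e s * completed (XA (- 1)) s =
      of_nat N powr (p - s) * (e (p - s) * completed (XB 1) (p - s) + e' (p - s) * completed (XB (- 1)) (p - s))"
    if s: "{s, p - s} \<inter> ({1, p} \<union> \<int>\<^sub>\<le>\<^sub>0) = {}" for s
  proof -
    have n: "s \<notin> \<int>\<^sub>\<le>\<^sub>0" "p - s \<notin> \<int>\<^sub>\<le>\<^sub>0" "s \<notin> {1, p}" "p - s \<notin> {1, p}" using s by auto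
    \<comment> \<open>Undoing the cross-multiplication is what requires both \<open>s\<close> and
      \<open>p - s\<close> to avoid 1 and \<open>p\<close>.\<close>
    have q: "Q s * Q (p - s) \<noteq> 0" using n(3,4) by (auto simp: Q_def)
    have cancel: "x = y" if "Q s * x * Q (p - s) = c * (Q (p - s) * z) * Q s" "y = c * z" for x y z c
    proof -
      have "(Q s * Q (p - s)) * x = (Q s * Q (p - s)) * y" using that by (simp only: mult_ac)
      then show ?thesis using q by (simp only: mult_cancel_left simp_thms)
    qed
    show "e s * completed (XA 1) s + e' s * completed (XA (- 1)) s =
      of_nat N powr (p - s) * (\<i> powi l * (e' (p - s) * completed (XB 1) (p - s) + e (p - s) * completed (XB (- 1)) (p - s)))"
      using fe1[OF n(1,2)] unfolding row(1)[OF n(3), of e e'] row(2)[OF n(4), of e' e]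
      by (rule cancel) (simp only: mult.assoc)
    show "e' s * completed (XA 1) s + e s * completed (XA (- 1)) s =
      of_nat N powr (p - s) * (e (p - s) * completed (XB 1) (p - s) + e' (p - s) * completed (XB (- 1)) (p - s))"
      using fe2[OF n(1,2)] unfolding row(1)[OF n(3), of e' e] row(2)[OF n(4), of e e']
      by (rule cancel) (simp only: mult_1_right)
  qed
  \<comment> \<open>The factor \<open>\<i> powi (- l)\<close> contained in \<open>b' 0\<close> moves
    the power of \<open>\<i>\<close> from one exponential to the other and accounts for the minus
    sign.\<close>
  have resB: "of_int \<epsilon> * \<i> * of_real (2 * pi) powr (- (2 * lam - 1)) * Gamma (2 * lam - 1) *
      (\<i> powi l * exp (- of_int \<epsilon> * lam * of_real pi * \<i>) - exp (of_int \<epsilon> * lam * of_real pi * \<i>)) * b' 0 =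
    - of_int \<epsilon> * \<i> * of_nat N powr (2 * lam - 2) * of_real (2 * pi) powr (- (2 * lam - 1)) * Gamma (2 * lam - 1) *
      (\<i> powi (- l) * exp (of_int \<epsilon> * of_real pi * \<i> * lam) - exp (- of_int \<epsilon> * of_real pi * \<i> * lam)) * \<alpha> 0" for \<epsilon>
  proof -
    define x y where "x = exp (of_int \<epsilon> * of_real pi * \<i> * lam)" and "y = exp (- of_int \<epsilon> * of_real pi * \<i> * lam)"
    have xy: "exp (of_int \<epsilon> * lam * of_real pi * \<i>) = x" "exp (- of_int \<epsilon> * lam * of_real pi * \<i>) = y"
      unfolding x_def y_def by (simp_all only: mult_ac)
    have il: "\<i> powi l * \<i> powi (- l) = 1" by (simp flip: power_int_add)
    have "(\<i> powi l * y - x) * \<i> powi (- l) = (\<i> powi l * \<i> powi (- l)) * y - \<i> powi (- l) * x" by (simp add: algebra_simps)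
    also have "\<dots> = - (\<i> powi (- l) * x - y)" unfolding il by simp
    finally have *: "(\<i> powi l * y - x) * \<i> powi (- l) = - (\<i> powi (- l) * x - y)" .
    have "of_int \<epsilon> * \<i> * of_real (2 * pi) powr (- (2 * lam - 1)) * Gamma (2 * lam - 1) * (\<i> powi l * y - x) * b' 0 =
       of_int \<epsilon> * \<i> * of_nat N powr (2 * lam - 2) * of_real (2 * pi) powr (- (2 * lam - 1)) * Gamma (2 * lam - 1) *
        ((\<i> powi l * y - x) * \<i> powi (- l)) * \<alpha> 0"
      unfolding b'_def \<kappa>_def by (simp only: mult_ac)
    then show ?thesis unfolding xy * x_def[symmetric] y_def[symmetric] by (simp only: mult_minus_left mult_minus_right)
  qed
  have sp: "s + 2 * lam - 2 = s - p" for s by (simp add: p_def)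
  show ?thesis
    unfolding p_def[symmetric] sp
  proof (rule exI[of _ XA], rule exI[of _ XB], intro conjI ballI allI impI)
    fix \<epsilon> :: int assume \<epsilon>: "\<epsilon> \<in> {1, - 1}"
    note cA = contA[OF \<epsilon>] and cB = contB[OF \<epsilon>]
    show "meromorphic_continuation_xi \<alpha> \<epsilon> (XA \<epsilon>)" by (rule cA(1))
    show "meromorphic_continuation_xi \<beta> \<epsilon> (XB \<epsilon>)" by (rule cB(1))
    show "z \<in> {p, 1}" if "is_pole (XA \<epsilon>) z" for z using cA(2)[OF that] by blast
    show "- zorder (XA \<epsilon>) z \<le> 1" if "is_pole (XA \<epsilon>) z" for z using cA(2)[OF that] by blast
    show "z \<in> {p, 1}" if "is_pole (XB \<epsilon>) z" for z using cB(2)[OF that] by blast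
    show "- zorder (XB \<epsilon>) z \<le> 1" if "is_pole (XB \<epsilon>) z" for z using cB(2)[OF that] by blast
    show "residue (XA \<epsilon>) 1 = \<i> powi l * \<beta>_inf" by (rule cA(3))
    show "residue (XB \<epsilon>) 1 = \<alpha>_inf / of_nat N" by (rule cB(3))
    show "residue (XA \<epsilon>) p = of_int \<epsilon> * \<i> * of_real (2 * pi) powr (- (2 * lam - 1)) * Gamma (2 * lam - 1) *
         (\<i> powi l * exp (- of_int \<epsilon> * lam * of_real pi * \<i>) - exp (of_int \<epsilon> * lam * of_real pi * \<i>)) * \<beta> 0"
      by (rule cA(4))
    show "residue (XB \<epsilon>) p = - of_int \<epsilon> * \<i> * of_nat N powr (2 * lam - 2) *
         of_real (2 * pi) powr (- (2 * lam - 1)) * Gamma (2 * lam - 1) *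
         (\<i> powi (- l) * exp (of_int \<epsilon> * of_real pi * \<i> * lam) - exp (- of_int \<epsilon> * of_real pi * \<i> * lam)) * \<alpha> 0"
      unfolding cB(4) by (rule resB)
    fix X assume "X \<in> {XA \<epsilon>, XB \<epsilon>}"
    then consider "X = XA \<epsilon>" | "X = XB \<epsilon>" by blast
    then show "\<exists>E. E holomorphic_on UNIV \<and> (\<forall>s. s \<notin> {1, p} \<longrightarrow> E s = (s - 1) * (s - p) * X s) \<and> entire_order E \<le> 1"
    proof cases
      case 1
      then show ?thesis using cA(5) A.EE_holomorphic[of \<epsilon> UNIV] A.EE_order[of \<epsilon>] by blast
    next
      case 2
      then show ?thesis using cB(5) B.EE_holomorphic[of \<epsilon> UNIV] B.EE_order[of \<epsilon>] by blast
    qed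
  next
    fix s assume "{s, p - s} \<inter> ({1, p} \<union> \<int>\<^sub>\<le>\<^sub>0) = {}"
    from FE[OF this] show "gamma_matrix s *v vector [completed (XA 1) s, completed (XA (- 1)) s] =
       of_nat N powr (p - s) *s (Sigma_matrix l *v (gamma_matrix (p - s) *v
           vector [completed (XB 1) (p - s), completed (XB (- 1)) (p - s)]))"
      unfolding gamma_matrix_def Sigma_matrix_def e_def e'_def
      by (simp add: vec_eq_iff forall_2 matrix_vector_mult_def sum_2 vector_2)
  qed
qed

end
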